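(* Fix a permutation $\pi$ and a mixed $k$-chain $\mathbf{c}$ for $\pi$. Then the Schubert polynomial satisfies \[\mathfrak{S}_\pi=\sum_{Q}\operatorname{wt}(Q),\] the sum over all biwords $Q$ whose recording chain for left insertion is $\mathbf{c}$, i.e. such that $\mathcal{L}(Q)=(D,\mathbf c)$ for some BPD $D$.
   Context: Permutations are in one-line notation, $\ell$ is length, $\pi t_{ab}$ swaps the entries of $\pi$ in positions $a,b$; $\rho\lessdot_k\pi$ means $\pi=\rho t_{ab}$ with $a\le k<b$ and $\ell(\pi)=\ell(\rho)+1$. A mixed $k$-chain for $\pi$ is a chain $\mathrm{id}\lessdot_{k_1}\pi_1\lessdot_{k_2}\cdots\lessdot_{k_\ell}\pi_\ell=\pi$ together with its labels $k_i$. Bumpless pipe dreams. Cells $(i,j)$ of the $n\times n$ grid (row $i$ from the top, column $j$ from the left) carry tiles recording which cell edges are joined by pipe segments: blank (none), horizontal (W–E), vertical (S–N), cross (W–E and S–N, two pipes), r-elbow (S–E), j-elbow (W–N), and, in intermediate stages only, bump (a W–N elbow and an S–E elbow carried by two different pipes). A bumpless pipe dream (BPD) of $\pi\in S_n$ is a tiling by the first six tiles whose segments form pipes such that for each $c$ the pipe $c$ enters at the bottom of column $c$, moves only north and east, and exits at the right end of row $\pi^{-1}(c)$ ("pipe $c$ exits from row $\pi^{-1}(c)$"), any two pipes crossing at most once; $\mathrm{BPD}(\pi)$ is the set of these, $\mathrm{perm}(D)=\pi$, and $I$ is the unique BPD of the identity. The weight of $D$ is $\prod x_i$ over the blank tiles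 $(i,j)$, and $\mathfrak S_\pi=\sum_{D\in\mathrm{BPD}(\pi)}\operatorname{wt}(D)$. During the algorithm one cell may be a bump; pipes, exits and crossings are traced the same way. A pipe has an r-turn at a cell where it enters from the south and leaves east (r-elbow or SE part of a bump). Moves. min-droop at $(a,b)$, where pipe $p$ has an r-turn: let $x>0$ be smallest with $(a+x,b)$ not a cross and $y>0$ smallest with $(a,b+y)$ not a cross. Within the rectangle with corners $(a,b)$ and $(a+x,b+y)$, $p$ runs up the left column from $(a+x,b)$ to $(a,b)$ and then along the top row to $(a,b+y)$; replace this by the route along the bottom row from $(a+x,b)$ to $(a+x,b+y)$ and up the right column to $(a,b+y)$, other pipes unchanged, tiles redetermined by the segments (so $p$ gets a W–N turn at $(a+x,b+y)$, which becomes a j-elbow if it was blank and a bump if it was an r-elbow). Set $\operatorname{min-droop}(a,b)=(a+x,b+y)$. cross-bump-swap at a bump $(a,b)$ whose two pipes also cross at $(a',b')$: $(a,b)$ becomes a cross and $(a',b')$ a bump; $\operatorname{cross-bump-swap}(a,b)=(a',b')$. A biletter $b_k$ is a pair of positive integers with $b\le k$; a biword is a word of biletters; its weight is $\operatorname{wt}((b_1)_{k_1}\cdots(b_\ell)_{k_\ell})=\prod_i x_{b_i}$. Left insertion $b_k\rightarrow D$: let $(i,j)$ be the r-elbow in row $b$ with $j$ minimal. (1) min-droop at $(i,j)$; let $(i_1,j_1)=\operatorname{min-droop}(i,j)$. (2) If $(i_1,j_1)$ is a j-elbow: (a) if $i_1\le k$, let $(i_1,j_2)$ be the r-elbow in row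 $i_1$ with $j_2>j_1$ minimal, set $(i,j)=(i_1,j_2)$, go to (1); (b) otherwise let $(i_1,j_0)$ be the r-elbow in row $i_1$ with $j_0<j_1$ maximal, set $(i,j)=(i_1,j_0)$, go to (1). (3) Otherwise $(i_1,j_1)$ is a bump: (a) if the pipe with the r-turn there exits from a row $r\le k$, set $(i,j)=(i_1,j_1)$ and go to (1); (b) otherwise, if the two pipes through $(i_1,j_1)$ cross somewhere, perform cross-bump-swap, set $(i,j)=\operatorname{cross-bump-swap}(i_1,j_1)$ and go to (1); if not, replace the bump by a cross and stop. For $D\in\mathrm{BPD}(\pi)$ the output lies in $\mathrm{BPD}(\pi t_{\alpha\beta})$ for some $\alpha\le k<\beta$ with $\pi\lessdot_k\pi t_{\alpha\beta}$. Recording chain for left insertion: $\mathcal L(\emptyset)=(I,\mathrm{id})$, and if $Q=b_kQ'$ with $\mathcal L(Q')=(D,\mathbf c')$ then $\mathcal L(Q)=(b_k\rightarrow D,\ \mathbf c'\lessdot_k\mathrm{perm}(b_k\rightarrow D))$ (the chain $\mathbf c'$ extended by one step labelled $k$). The second component is the recording chain for left insertion of $Q$. *)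

theory Defs
  imports Main "HOL-Combinatorics.Permutations" "HOL-Library.Poly_Mapping"
begin

section \<open>Permutations and mixed k-chains\<close>

text \<open>
  A permutation of \<open>{1..n}\<close> is a function \<open>\<pi>\<close> on the natural numbers with
  \<open>\<pi> permutes {1..n}\<close>; it fixes everything else, so the inclusions
  \<open>S_n \<subseteq> S_(n+1)\<close> are identities. The entry in position \<open>i\<close> is \<open>\<pi> i\<close>, and
  \<open>\<pi> t_ab\<close> is \<open>\<pi> \<circ> transpose a b\<close>.
\<close>

definition perm_length :: "(nat \<Rightarrow> nat) \<Rightarrow> nat" where
  "perm_length \<pi> = card {(i, j). i < j \<and> \<pi> i > \<pi> j}"

definition k_cover :: "nat \<Rightarrow> (nat \<Rightarrow> nat) \<Rightarrow> (nat \<Rightarrow> nat) \<Rightarrow> bool" where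
  "k_cover k \<rho> \<pi> \<longleftrightarrow>
     (\<exists>a b. 1 \<le> a \<and> a \<le> k \<and> k < b \<and> \<pi> = \<rho> \<circ> transpose a b \<and>
            perm_length \<pi> = perm_length \<rho> + 1)"

text \<open>The list \<open>[(k\<^sub>1, \<pi>\<^sub>1), \<dots>, (k\<^sub>l, \<pi>\<^sub>l)]\<close> stands for the chain whose
  \<open>i\<close>-th step is the \<open>k\<^sub>i\<close>-cover ending in \<open>\<pi>\<^sub>i\<close>; the starting point is not stored.\<close>

type_synonym labelled_chain = "(nat \<times> (nat \<Rightarrow> nat)) list"

fun chain_between :: "(nat \<Rightarrow> nat) \<Rightarrow> labelled_chain \<Rightarrow> (nat \<Rightarrow> nat) \<Rightarrow> bool" where
  "chain_between \<rho> [] \<pi> \<longleftrightarrow> \<rho> = \<pi>"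
| "chain_between \<rho> ((k, \<sigma>) # c) \<pi> \<longleftrightarrow> k_cover k \<rho> \<sigma> \<and> chain_between \<sigma> c \<pi>"

definition mixed_chain :: "labelled_chain \<Rightarrow> (nat \<Rightarrow> nat) \<Rightarrow> bool" where
  "mixed_chain c \<pi> \<longleftrightarrow> chain_between id c \<pi>"


section \<open>Tilings and pipes\<close>

text \<open>A tile is the set of its pipe segments, each directed the way pipes travel (north and
  east): \<open>(d, e)\<close> joins the side \<open>d\<close> where it is entered to the side \<open>e\<close> where it is left.\<close>

datatype side = North | East | South | West

type_synonym tile = "(side \<times> side) set"

definition blank_tile :: tile where "blank_tile = {}"
definition horizontal_tile :: tile where "horizontal_tile = {(West, East)}"
definition vertical_tile :: tile where "vertical_tile = {(South, North)}"
definition cross_tile :: tile where "cross_tile = {(West, East), (South, North)}"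
definition r_elbow :: tile where "r_elbow = {(South, East)}"
definition j_elbow :: tile where "j_elbow = {(West, North)}"
definition bump_tile :: tile where "bump_tile = {(West, North), (South, East)}"

text \<open>
  \<open>D i j\<close> is the tile in row \<open>i\<close> and column \<open>j\<close>, where \<open>i, j \<ge> 1\<close>; row and column 0 are
  padding and always blank. Tilings of an \<open>n \<times> n\<close> grid are extended to the whole quadrant by
  the tiles of the bumpless pipe dream of the identity. This is the usual identification of the
  bumpless pipe dreams of \<open>\<pi> \<in> S_n\<close> with those of \<open>\<pi> \<in> S_(n+1)\<close>, and it makes
  insertion defined for all biletters.
\<close>

type_synonym tiling = "nat \<Rightarrow> nat \<Rightarrow> tile"

definition id_bpd :: tiling where
  "id_bpd i j =
     (if i = 0 \<or> j = 0 then blank_tile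
      else if i = j then r_elbow
      else if i < j then horizontal_tile
      else vertical_tile)"

definition joined :: "side \<Rightarrow> tile \<Rightarrow> bool" where
  "joined s T \<longleftrightarrow> (\<exists>d. (s, d) \<in> T \<or> (d, s) \<in> T)"

text \<open>Since row 0 and column 0 are blank, no pipe leaves at the top or enters from the left.\<close>

definition edges_match :: "tiling \<Rightarrow> bool" where
  "edges_match D \<longleftrightarrow>
     (\<forall>i j. joined East (D i j) \<longleftrightarrow> joined West (D i (Suc j))) \<and>
     (\<forall>i j. joined North (D (Suc i) j) \<longleftrightarrow> joined South (D i j))"

text \<open>\<open>(i, j, d)\<close> is the place of a pipe entering cell \<open>(i, j)\<close> from side \<open>d\<close>.\<close>

type_synonym place = "nat \<times> nat \<times> side"

inductive pipe_step :: "tiling \<Rightarrow> place \<Rightarrow> place \<Rightarrow> bool" for D where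
  go_north: "(d, North) \<in> D (Suc i) j \<Longrightarrow> pipe_step D (Suc i, j, d) (i, j, South)"
| go_east: "(d, East) \<in> D i j \<Longrightarrow> pipe_step D (i, j, d) (i, Suc j, West)"

definition same_pipe :: "tiling \<Rightarrow> place \<Rightarrow> place \<Rightarrow> bool" where
  "same_pipe D s t \<longleftrightarrow> (pipe_step D)\<^sup>*\<^sup>* s t \<or> (pipe_step D)\<^sup>*\<^sup>* t s"

text \<open>In the extended grid, leaving the \<open>n \<times> n\<close> grid at the right end of row \<open>r\<close> means
  running along row \<open>r\<close> forever.\<close>

definition exits_from :: "tiling \<Rightarrow> place \<Rightarrow> nat \<Rightarrow> bool" where
  "exits_from D s r \<longleftrightarrow> (\<exists>m. \<forall>j\<ge>m. (pipe_step D)\<^sup>*\<^sup>* s (r, j, West))"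

definition crossings :: "tiling \<Rightarrow> place \<Rightarrow> place \<Rightarrow> (nat \<times> nat) set" where
  "crossings D s t =
     {(i, j). D i j = cross_tile \<and>
        (same_pipe D s (i, j, South) \<and> same_pipe D t (i, j, West) \<or>
         same_pipe D s (i, j, West) \<and> same_pipe D t (i, j, South))}"


section \<open>Bumpless pipe dreams and Schubert polynomials\<close>

definition BPD :: "nat \<Rightarrow> (nat \<Rightarrow> nat) \<Rightarrow> tiling set" where
  "BPD n \<pi> =
     {D. \<pi> permutes {1..n} \<and>
         (\<forall>i j. i \<notin> {1..n} \<or> j \<notin> {1..n} \<longrightarrow> D i j = id_bpd i j) \<and>
         (\<forall>i\<in>{1..n}. \<forall>j\<in>{1..n}. D i j \<in> {blank_tile, horizontal_tile, vertical_tile,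
                                            cross_tile, r_elbow, j_elbow}) \<and>
         edges_match D \<and>
         (\<forall>c\<in>{1..n}. exits_from D (n, c, South) (inv \<pi> c)) \<and>
         (\<forall>c\<in>{1..n}. \<forall>c'\<in>{1..n}. c \<noteq> c' \<longrightarrow>
            (\<forall>p\<in>crossings D (n, c, South) (n, c', South).
             \<forall>q\<in>crossings D (n, c, South) (n, c', South). p = q))}"

definition bpd_perm :: "tiling \<Rightarrow> (nat \<Rightarrow> nat)" where
  "bpd_perm D = (THE \<pi>. \<exists>n. D \<in> BPD n \<pi>)"

text \<open>Polynomials in \<open>x\<^sub>1, x\<^sub>2, \<dots>\<close> with integer coefficients: an exponent vector is a finitely
  supported function \<open>nat \<Rightarrow>\<^sub>0 nat\<close>, a polynomial a finitely supported function from
  exponent vectors to coefficients.\<close>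

type_synonym polynomial = "(nat \<Rightarrow>\<^sub>0 nat) \<Rightarrow>\<^sub>0 int"

definition X :: "nat \<Rightarrow> polynomial" where
  "X i = Poly_Mapping.single (Poly_Mapping.single i 1) 1"

definition bpd_weight :: "tiling \<Rightarrow> polynomial" where
  "bpd_weight D = (\<Prod>(i, j) \<in> {(i, j). 1 \<le> i \<and> 1 \<le> j \<and> D i j = blank_tile}. X i)"

definition schubert :: "nat \<Rightarrow> (nat \<Rightarrow> nat) \<Rightarrow> polynomial" where
  "schubert n \<pi> = (\<Sum>D \<in> BPD n \<pi>. bpd_weight D)"


section \<open>Moves\<close>

text \<open>
  With \<open>x\<close>, \<open>y\<close> as below, the pipe having an r-turn at \<open>(a, b)\<close> is rerouted from the left
  column and top row of the rectangle to its bottom row and right column. At the corner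
  \<open>(a + x, b)\<close> the segment that left north now leaves east, and at \<open>(a, b + y)\<close> the
  segment entered from the west is now entered from the south.
\<close>

definition reroute :: "tiling \<Rightarrow> nat \<Rightarrow> nat \<Rightarrow> nat \<Rightarrow> nat \<Rightarrow> tiling" where
  "reroute D a b x y = (\<lambda>i j.
     if i = a \<and> j = b then D i j - {(South, East)}
     else if i = a + x \<and> j = b
       then (\<lambda>(d, e). (d, if e = North then East else e)) ` D i j
     else if i = a \<and> j = b + y
       then (\<lambda>(d, e). (if d = West then South else d, e)) ` D i j
     else if i = a + x \<and> j = b + y then D i j \<union> {(West, North)}
     else if a < i \<and> i < a + x \<and> j = b then D i j - {(South, North)}
     else if i = a \<and> b < j \<and> j < b + y then D i j - {(West, East)}
     else if i = a + x \<and> b < j \<and> j < b + y then D i j \<union> {(West, East)}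
     else if a < i \<and> i < a + x \<and> j = b + y then D i j \<union> {(South, North)}
     else D i j)"

definition min_droop :: "tiling \<Rightarrow> nat \<Rightarrow> nat \<Rightarrow> tiling \<times> nat \<times> nat" where
  "min_droop D a b =
     (let x = (LEAST x. x > 0 \<and> D (a + x) b \<noteq> cross_tile);
          y = (LEAST y. y > 0 \<and> D a (b + y) \<noteq> cross_tile)
      in (reroute D a b x y, a + x, b + y))"

definition set_tile :: "tiling \<Rightarrow> nat \<Rightarrow> nat \<Rightarrow> tile \<Rightarrow> tiling" where
  "set_tile D i j T = D(i := (D i)(j := T))"

text \<open>The crossings of the two pipes through a bump at \<open>(a, b)\<close>.\<close>

definition bump_crossings :: "tiling \<Rightarrow> nat \<Rightarrow> nat \<Rightarrow> (nat \<times> nat) set" where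
  "bump_crossings D a b = crossings D (a, b, South) (a, b, West)"

definition cross_bump_swap :: "tiling \<Rightarrow> nat \<Rightarrow> nat \<Rightarrow> tiling \<times> nat \<times> nat" where
  "cross_bump_swap D a b =
     (let (a', b') = (THE p. p \<in> bump_crossings D a b)
      in (set_tile (set_tile D a b cross_tile) a' b' bump_tile, a', b'))"


section \<open>Left insertion\<close>

text \<open>\<open>left_insert_loop k D i j\<close> is the algorithm from step (1) on; \<open>None\<close> would stand for a
  run that does not terminate.\<close>

partial_function (option) left_insert_loop ::
  "nat \<Rightarrow> tiling \<Rightarrow> nat \<Rightarrow> nat \<Rightarrow> tiling option" where
  "left_insert_loop k D i j =
     (case min_droop D i j of (D1, i1, j1) \<Rightarrow>
        if D1 i1 j1 = j_elbow then
          (if i1 \<le> k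
           then left_insert_loop k D1 i1 (LEAST j2. j2 > j1 \<and> D1 i1 j2 = r_elbow)
           else left_insert_loop k D1 i1 (GREATEST j0. j0 < j1 \<and> D1 i1 j0 = r_elbow))
        else if \<exists>r\<le>k. exits_from D1 (i1, j1, South) r then left_insert_loop k D1 i1 j1
        else if bump_crossings D1 i1 j1 \<noteq> {} then
          (case cross_bump_swap D1 i1 j1 of (D2, i2, j2) \<Rightarrow> left_insert_loop k D2 i2 j2)
        else Some (set_tile D1 i1 j1 cross_tile))"

definition left_insert :: "nat \<Rightarrow> nat \<Rightarrow> tiling \<Rightarrow> tiling option" where
  "left_insert b k D = left_insert_loop k D b (LEAST j. D b j = r_elbow)"


section \<open>Biwords and recording chains\<close>

text \<open>The biletter \<open>b\<^sub>k\<close> is the pair \<open>(b, k)\<close>.\<close>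

type_synonym biword = "(nat \<times> nat) list"

definition is_biword :: "biword \<Rightarrow> bool" where
  "is_biword Q \<longleftrightarrow> (\<forall>(b, k) \<in> set Q. 1 \<le> b \<and> b \<le> k)"

definition biword_weight :: "biword \<Rightarrow> polynomial" where
  "biword_weight Q = (\<Prod>(b, k) \<leftarrow> Q. X b)"

text \<open>The last letter of a biword is inserted first.\<close>

fun left_record :: "biword \<Rightarrow> (tiling \<times> labelled_chain) option" where
  "left_record [] = Some (id_bpd, [])"
| "left_record ((b, k) # Q) =
     (case left_record Q of
        None \<Rightarrow> None
      | Some (D, c) \<Rightarrow>
          (case left_insert b k D of
             None \<Rightarrow> None
           | Some D' \<Rightarrow> Some (D', c @ [(k, bpd_perm D')])))"

definition biwords_recording :: "labelled_chain \<Rightarrow> biword set" where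
  "biwords_recording c = {Q. is_biword Q \<and> (\<exists>D. left_record Q = Some (D, c))}"


section \<open>The sums in question are finite\<close>

lemma finite_BPD: "finite (BPD n \<pi>)"
proof -
  let ?tiles = "{blank_tile, horizontal_tile, vertical_tile, cross_tile, r_elbow, j_elbow}"
  let ?rows = "{f :: nat \<Rightarrow> tile. \<forall>j. (j \<in> {1..n} \<longrightarrow> f j \<in> ?tiles) \<and>
                                       (j \<notin> {1..n} \<longrightarrow> f j = blank_tile)}"
  let ?grids = "{F :: tiling. \<forall>i. (i \<in> {1..n} \<longrightarrow> F i \<in> ?rows) \<and>
                                   (i \<notin> {1..n} \<longrightarrow> F i = (\<lambda>_. blank_tile))}"
  let ?cut = "\<lambda>D :: tiling. \<lambda>i j. if i \<in> {1..n} \<and> j \<in> {1..n} then D i j else blank_tile"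
  have "finite ?rows" by (rule finite_set_of_finite_funs) auto
  then have "finite ?grids" by (rule finite_set_of_finite_funs[OF finite_atLeastAtMost])
  moreover have "?cut ` BPD n \<pi> \<subseteq> ?grids"
  proof (intro subsetI)
    fix F assume "F \<in> ?cut ` BPD n \<pi>"
    then obtain D where F: "F = ?cut D" and D: "D \<in> BPD n \<pi>" by blast
    have "D i j \<in> ?tiles" if "i \<in> {1..n}" "j \<in> {1..n}" for i j
      using D that unfolding BPD_def by blast
    then show "F \<in> ?grids" unfolding F by (simp add: fun_eq_iff) blast
  qed
  moreover have "inj_on ?cut (BPD n \<pi>)"
  proof (rule inj_onI, intro ext)
    fix D E i j assume *: "D \<in> BPD n \<pi>" "E \<in> BPD n \<pi>" "?cut D = ?cut E"
    show "D i j = E i j"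
    proof (cases "i \<in> {1..n} \<and> j \<in> {1..n}")
      case True then show ?thesis using fun_cong[OF fun_cong[OF *(3), of i], of j] by simp
    next
      case False then show ?thesis using *(1,2) by (auto simp: BPD_def)
    qed
  qed
  ultimately show ?thesis by (meson finite_imageD finite_subset)
qed

lemma left_record_labels: "left_record Q = Some (D, c) \<Longrightarrow> map snd Q = rev (map fst c)"
  by (induction Q arbitrary: D c rule: left_record.induct) (auto split: option.splits)

lemma finite_biwords_recording: "finite (biwords_recording c)"
proof (rule finite_subset)
  let ?A = "{(b, k). b \<le> k \<and> k \<in> fst ` set c}"
  show "biwords_recording c \<subseteq> {Q. set Q \<subseteq> ?A \<and> length Q = length c}"
  proof
    fix Q assume "Q \<in> biwords_recording c"
    then obtain D where Q: "is_biword Q" "left_record Q = Some (D, c)"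
      by (auto simp: biwords_recording_def)
    have le: "b \<le> k" if "(b, k) \<in> set Q" for b k
      using Q(1) that unfolding is_biword_def by blast
    have eq: "map snd Q = rev (map fst c)" by (rule left_record_labels[OF Q(2)])
    have "length Q = length c" using arg_cong[OF eq, of length] by simp
    moreover have "set Q \<subseteq> ?A"
    proof (rule subrelI)
      fix b k assume bk: "(b, k) \<in> set Q"
      have "k \<in> set (map snd Q)" using bk by force
      then have "k \<in> fst ` set c" unfolding eq by simp
      with le[OF bk] show "(b, k) \<in> ?A" by simp
    qed
    ultimately show "Q \<in> {Q. set Q \<subseteq> ?A \<and> length Q = length c}" by simp
  qed
  have "?A \<subseteq> (\<Union>k\<in>fst ` set c. {..k} \<times> {k})" by auto
  then have "finite ?A" by (rule finite_subset) auto
  then show "finite {Q. set Q \<subseteq> ?A \<and> length Q = length c}" by (rule finite_lists_length_eq)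
qed

end

theory Submission
  imports Defs
begin

text \<open>
  For a permutation \<open>\<pi>\<close> and a label \<open>k\<close>, left insertion is a bijection from the pairs of a row
  \<open>b \<le> k\<close> and a bumpless pipe dream of \<open>\<pi>\<close> onto the bumpless pipe dreams of all \<open>k\<close>-covers of
  \<open>\<pi>\<close>, and it multiplies the weight by \<open>x_b\<close>. Hence a bumpless pipe dream at the end of a fixed
  chain can be traced back along the chain, and its biword is unique.

  Each single move of the algorithm is reversible: a min-droop is a bijection from the states
  in which the pipe at an r-turn exits from a row \<open>\<le> k\<close> to the states in which the pipe at a
  j-turn does, and the moves in between are a bijection from the non-terminal states of the
  second kind to the non-initial states of the first kind. As there are finitely many states, a
  run that starts in an initial state terminates, and every terminal state is reached from
  exactly one initial state.

  The states are controlled through the exit row of every place on a pipe. Pipes move one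
  diagonal per step, so two pipes exchange their order exactly at their crossings; therefore two
  pipes cross at most once iff the number of crosses is the length of the permutation, and this
  decides whether a tiling stays reduced when a bump and a cross are exchanged.
\<close>

section \<open>Pipes and their exit rows\<close>

text \<open>The exit row serves as the name of a pipe: together with a diagonal it pins down a
  single place. The exit rows of a modified tiling are found by guessing a labelling and checking it
  one step at a time (\<open>exit_row_unique\<close>), so each move reduces to a finite table of
  local checks. Termination is the obstacle. The loop may droop to the south and may also jump to an
  earlier or a later crossing, and no decreasing quantity is exhibited; finiteness of the state set
  replaces it. The states must therefore stay inside one fixed square. Hence \<open>M\<close> is
  taken with \<open>k < M\<close> and \<open>\<pi> M = M\<close>: the pipe exiting from row
  \<open>M\<close> then occupies the corner \<open>(M, M)\<close> and blocks every droop of a pipe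
  exiting from a row at most \<open>k\<close>. The invariant on states is weak on purpose: it has
  the same shape before and after a droop, so that the inverse moves can be treated like the moves
  themselves.\<close>

lemmas tile_defs = blank_tile_def horizontal_tile_def vertical_tile_def cross_tile_def
  r_elbow_def j_elbow_def bump_tile_def

lemma mem_tile [simp]:
  "x \<notin> blank_tile"
  "(d, e) \<in> horizontal_tile \<longleftrightarrow> d = West \<and> e = East"
  "(d, e) \<in> vertical_tile \<longleftrightarrow> d = South \<and> e = North"
  "(d, e) \<in> cross_tile \<longleftrightarrow> d = West \<and> e = East \<or> d = South \<and> e = North"
  "(d, e) \<in> r_elbow \<longleftrightarrow> d = South \<and> e = East"
  "(d, e) \<in> j_elbow \<longleftrightarrow> d = West \<and> e = North"
  "(d, e) \<in> bump_tile \<longleftrightarrow> d = West \<and> e = North \<or> d = South \<and> e = East"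
  by (auto simp: tile_defs)

lemma joined_tile [simp]:
  "\<not> joined s blank_tile"
  "joined s horizontal_tile \<longleftrightarrow> s = West \<or> s = East"
  "joined s vertical_tile \<longleftrightarrow> s = South \<or> s = North"
  "joined s cross_tile"
  "joined s r_elbow \<longleftrightarrow> s = South \<or> s = East"
  "joined s j_elbow \<longleftrightarrow> s = West \<or> s = North"
  "joined s bump_tile"
  by (cases s; auto simp: joined_def)+

lemma tile_distinct [simp]:
  "blank_tile \<noteq> horizontal_tile" "blank_tile \<noteq> vertical_tile" "blank_tile \<noteq> cross_tile"
  "blank_tile \<noteq> r_elbow" "blank_tile \<noteq> j_elbow" "blank_tile \<noteq> bump_tile"
  "horizontal_tile \<noteq> vertical_tile" "horizontal_tile \<noteq> cross_tile" "horizontal_tile \<noteq> r_elbow"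
  "horizontal_tile \<noteq> j_elbow" "horizontal_tile \<noteq> bump_tile"
  "vertical_tile \<noteq> cross_tile" "vertical_tile \<noteq> r_elbow" "vertical_tile \<noteq> j_elbow"
  "vertical_tile \<noteq> bump_tile"
  "cross_tile \<noteq> r_elbow" "cross_tile \<noteq> j_elbow" "cross_tile \<noteq> bump_tile"
  "r_elbow \<noteq> j_elbow" "r_elbow \<noteq> bump_tile" "j_elbow \<noteq> bump_tile"
  by (auto simp: tile_defs)

lemmas tile_distinct' [simp] = tile_distinct[symmetric]

definition all_tiles :: "tile set" where
  "all_tiles = {blank_tile, horizontal_tile, vertical_tile, cross_tile, r_elbow, j_elbow, bump_tile}"

lemma all_tilesE:
  assumes "T \<in> all_tiles"
  obtains "T = blank_tile" | "T = horizontal_tile" | "T = vertical_tile" | "T = cross_tile"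
    | "T = r_elbow" | "T = j_elbow" | "T = bump_tile"
  using assms unfolding all_tiles_def by blast

lemma id_bpd_simps [simp]:
  "id_bpd 0 j = blank_tile" "id_bpd i 0 = blank_tile"
  "0 < i \<Longrightarrow> id_bpd i i = r_elbow"
  "0 < i \<Longrightarrow> i < j \<Longrightarrow> id_bpd i j = horizontal_tile"
  "0 < j \<Longrightarrow> j < i \<Longrightarrow> id_bpd i j = vertical_tile"
  by (auto simp: id_bpd_def)

lemma id_bpd_neq: "id_bpd i j \<noteq> cross_tile" "id_bpd i j \<noteq> j_elbow" "id_bpd i j \<noteq> bump_tile"
  by (auto simp: id_bpd_def)

section \<open>Pipes as orbits of a successor function\<close>

fun diag :: "place \<Rightarrow> int" where
  "diag (i, j, d) = int j - int i"

text \<open>A place is a mere triple; it lies on a pipe only if the tile has a segment entered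
  there. Both \<open>nxt\<close> and \<open>exit_row\<close> carry information only at such
  places.\<close>

definition live :: "tiling \<Rightarrow> place \<Rightarrow> bool" where
  "live D = (\<lambda>(i, j, d). \<exists>e. (d, e) \<in> D i j)"

definition nxt :: "tiling \<Rightarrow> place \<Rightarrow> place" where
  "nxt D = (\<lambda>(i, j, d). if (d, North) \<in> D i j then (i - 1, j, South) else (i, Suc j, West))"

definition exit_row :: "tiling \<Rightarrow> place \<Rightarrow> nat" where
  "exit_row D s = (THE r. exits_from D s r)"

abbreviation "srow D i j \<equiv> exit_row D (i, j, South)"
abbreviation "wrow D i j \<equiv> exit_row D (i, j, West)"

text \<open>Every step of a pipe leads to the next diagonal, so two pipes can be compared on a common
  diagonal.\<close>

fun above :: "place \<Rightarrow> place \<Rightarrow> bool" where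
  "above (i, j, d) (i', j', d') \<longleftrightarrow>
     int j - int i = int j' - int i' \<and> (i < i' \<or> i = i' \<and> d = West \<and> d' = South)"

definition crosses :: "tiling \<Rightarrow> (nat \<times> nat) set" where
  "crosses D = {(i, j). D i j = cross_tile}"

text \<open>The common setting for bumpless pipe dreams and for intermediate stages: bumps may
  occur, and neither reducedness nor a permutation is prescribed. Agreement with the identity
  outside the square makes every pipe eventually horizontal.\<close>

locale pipe_grid =
  fixes M :: nat and D :: tiling
  assumes outside: "i \<notin> {1..M} \<or> j \<notin> {1..M} \<Longrightarrow> D i j = id_bpd i j"
    and tiles: "D i j \<in> all_tiles"
    and edges: "edges_match D"
begin

lemma outside':
  "D 0 j = blank_tile" "D i 0 = blank_tile"
  "i > M \<Longrightarrow> D i j = id_bpd i j" "j > M \<Longrightarrow> D i j = id_bpd i j"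
  using outside by auto

lemma edge_east: "joined West (D i (Suc j)) \<longleftrightarrow> joined East (D i j)"
  using edges by (auto simp: edges_match_def)

lemma edge_north: "joined South (D i j) \<longleftrightarrow> joined North (D (Suc i) j)"
  using edges by (auto simp: edges_match_def)

lemma live_iff:
  "live D (i, j, South) \<longleftrightarrow> joined South (D i j)"
  "live D (i, j, West) \<longleftrightarrow> joined West (D i j)"
  "\<not> live D (i, j, North)" "\<not> live D (i, j, East)"
  using tiles[of i j] by (cases rule: all_tilesE; simp add: live_def)+

lemma live_cases:
  assumes "live D (i, j, d)"
  obtains "d = South" "(South, North) \<in> D i j" "i > 0" "j > 0"
    | "d = South" "(South, East) \<in> D i j" "(South, North) \<notin> D i j" "i > 0" "j > 0"
    | "d = West" "(West, North) \<in> D i j" "i > 0" "j > 0"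
    | "d = West" "(West, East) \<in> D i j" "(West, North) \<notin> D i j" "i > 0" "j > 0"
proof -
  have "i > 0"
    using assms outside'(1)[of j] by (cases i) (simp_all add: live_def)
  moreover have "j > 0"
    using assms outside'(2)[of i] by (cases j) (simp_all add: live_def)
  moreover have "d = South \<or> d = West"
    using assms live_iff by (cases d) simp_all
  moreover have "(d, North) \<in> D i j \<or> (d, East) \<in> D i j \<and> (d, North) \<notin> D i j"
    using tiles[of i j] assms by (cases rule: all_tilesE) (auto simp: live_def)
  ultimately show ?thesis using that by metis
qed

lemma nxt_dest:
  assumes "live D (i, j, d)"
  shows "(d, North) \<in> D i j \<and> (\<exists>i0. i = Suc i0 \<and> nxt D (i, j, d) = (i0, j, South)) \<or>
    (d, East) \<in> D i j \<and> 0 < i \<and> nxt D (i, j, d) = (i, Suc j, West)"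
  using assms by (cases rule: live_cases; cases i) (simp_all add: nxt_def)

lemma nxt_live:
  assumes "live D s"
  shows "live D (nxt D s)" "diag (nxt D s) = diag s + 1"
proof -
  obtain i j d where s: "s = (i, j, d)" by (cases s)
  from assms have "live D (i, j, d)" by (simp add: s)
  then have "live D (nxt D s) \<and> diag (nxt D s) = diag s + 1"
  proof (cases rule: live_cases)
    case 1
    then have "joined North (D (Suc (i - 1)) j)" by (auto simp: joined_def)
    with 1 show ?thesis by (simp add: s nxt_def live_iff edge_north)
  next
    case 2
    then have "joined East (D i j)" by (auto simp: joined_def)
    with 2 show ?thesis by (simp add: s nxt_def live_iff edge_east)
  next
    case 3
    then have "joined North (D (Suc (i - 1)) j)" by (auto simp: joined_def)
    with 3 show ?thesis by (simp add: s nxt_def live_iff edge_north)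
  next
    case 4
    then have "joined East (D i j)" by (auto simp: joined_def)
    with 4 show ?thesis by (simp add: s nxt_def live_iff edge_east)
  qed
  then show "live D (nxt D s)" "diag (nxt D s) = diag s + 1" by auto
qed

lemma pipe_step_iff: "pipe_step D s t \<longleftrightarrow> live D s \<and> t = nxt D s"
proof
  assume "pipe_step D s t"
  then show "live D s \<and> t = nxt D s"
  proof cases
    case (go_north d i j)
    then show ?thesis by (auto simp: live_def nxt_def)
  next
    case (go_east d i j)
    show ?thesis using tiles[of i j] go_east
      by (cases rule: all_tilesE) (auto simp: live_def nxt_def)
  qed
next
  assume a: "live D s \<and> t = nxt D s"
  obtain i j d where s: "s = (i, j, d)" by (cases s)
  from a have "live D (i, j, d)" by (simp add: s)
  then show "pipe_step D s t"
  proof (cases rule: live_cases)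
    case 1
    then show ?thesis using a go_north[of South D "i - 1" j] by (simp add: s nxt_def)
  next
    case 2
    then show ?thesis using a go_east[of South D i j] by (simp add: s nxt_def)
  next
    case 3
    then show ?thesis using a go_north[of West D "i - 1" j] by (simp add: s nxt_def)
  next
    case 4
    then show ?thesis using a go_east[of West D i j] by (simp add: s nxt_def)
  qed
qed

text \<open>In each of the seven tiles at most one segment leaves through a given side, so pipes can
  be followed backwards.\<close>

lemma nxt_inj:
  assumes "live D s" "live D t" "nxt D s = nxt D t"
  shows "s = t"
proof -
  obtain i j d where s: "s = (i, j, d)" by (cases s)
  obtain i' j' d' where t: "t = (i', j', d')" by (cases t)
  from assms(1) have "live D (i, j, d)" by (simp add: s)
  moreover from assms(2) have "live D (i', j', d')" by (simp add: t)
  moreover have "d = d'" if "(d, e) \<in> D i j" "(d', e) \<in> D i j" for e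
    using tiles[of i j] that by (cases rule: all_tilesE) auto
  ultimately show ?thesis
    using assms(3) nxt_dest[of i j d] nxt_dest[of i' j' d'] by (auto simp: s t)
qed

lemma funpow_live:
  assumes "live D s"
  shows "live D ((nxt D ^^ t) s)" "diag ((nxt D ^^ t) s) = diag s + int t"
  using assms by (induction t) (auto simp: nxt_live)

lemma funpow_inj:
  "live D s \<Longrightarrow> live D s' \<Longrightarrow> (nxt D ^^ t) s = (nxt D ^^ t) s' \<Longrightarrow> s = s'"
  by (induction t) (auto dest!: nxt_inj[rotated 2] simp: funpow_live)

lemma rtranclp_iff:
  assumes "live D s"
  shows "(pipe_step D)\<^sup>*\<^sup>* s t \<longleftrightarrow> (\<exists>n. t = (nxt D ^^ n) s)"
proof
  assume "(pipe_step D)\<^sup>*\<^sup>* s t"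
  then show "\<exists>n. t = (nxt D ^^ n) s"
  proof induction
    case base
    show ?case by (rule exI[of _ 0]) simp
  next
    case (step y z)
    then obtain n where "y = (nxt D ^^ n) s" by blast
    with step show ?case by (intro exI[of _ "Suc n"]) (simp add: pipe_step_iff)
  qed
next
  assume "\<exists>n. t = (nxt D ^^ n) s"
  then obtain n where n: "t = (nxt D ^^ n) s" by blast
  have "(pipe_step D)\<^sup>*\<^sup>* s ((nxt D ^^ n) s)"
  proof (induction n)
    case (Suc n)
    have "pipe_step D ((nxt D ^^ n) s) ((nxt D ^^ Suc n) s)"
      using assms by (simp add: pipe_step_iff funpow_live)
    with Suc show ?case by (rule rtranclp.rtrancl_into_rtrancl)
  qed simp
  with n show "(pipe_step D)\<^sup>*\<^sup>* s t" by simp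
qed

lemma far_east:
  assumes "0 < r" "M < j" "r < j"
  shows "live D (r, j, West)" "nxt D (r, j, West) = (r, Suc j, West)"
    "(nxt D ^^ t) (r, j, West) = (r, j + t, West)"
proof -
  have D: "D r j' = horizontal_tile" if "j' \<ge> j" for j'
    using that assms by (simp add: outside')
  show "live D (r, j, West)" using D[of j] by (simp add: live_iff)
  show "nxt D (r, j, West) = (r, Suc j, West)" using D[of j] by (simp add: nxt_def)
  show "(nxt D ^^ t) (r, j, West) = (r, j + t, West)"
    by (induction t) (auto simp: nxt_def D)
qed

text \<open>Each step lowers the row or raises the column, so \<open>i + (K - j)\<close> decreases
  while \<open>j < K\<close>. The bound \<open>K\<close> exceeds the start row and \<open>M\<close>,
  hence from column \<open>K\<close> on the tiles met are horizontal. The exit row is at most the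
  start row because no step goes south.\<close>

lemma reaches_far_east:
  assumes "live D s"
  shows "\<exists>n r j. (nxt D ^^ n) s = (r, j, West) \<and> 0 < r \<and> r \<le> fst s \<and> M < j \<and> r < j"
proof -
  have main: "\<exists>n r j'. (nxt D ^^ n) (i, j, d) = (r, j', West) \<and> 0 < r \<and> r \<le> i \<and> M < j' \<and> r < j'"
    if "i + (K - j) \<le> m" "i < K" "M < K" "live D (i, j, d)" for K m i j d
    using that
  proof (induction m arbitrary: i j d)
    case 0
    from \<open>live D (i, j, d)\<close> have "0 < i" by (cases rule: live_cases) auto
    with 0 show ?case by simp
  next
    case (Suc m)
    from \<open>live D (i, j, d)\<close> have pos: "0 < i" by (cases rule: live_cases) auto
    show ?case
    proof (cases "j \<ge> K")
      case True
      then have "D i j = horizontal_tile" using Suc.prems pos by (simp add: outside')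
      with \<open>live D (i, j, d)\<close> have "d = West" by (cases rule: live_cases) auto
      with True Suc.prems pos show ?thesis by (intro exI[of _ 0] exI[of _ i] exI[of _ j]) auto
    next
      case False
      obtain i1 j1 d1 where n: "nxt D (i, j, d) = (i1, j1, d1)" by (cases "nxt D (i, j, d)")
      have l: "live D (i1, j1, d1)" using nxt_live(1)[OF Suc.prems(4)] n by simp
      have le: "i1 + (K - j1) \<le> m" "i1 \<le> i"
        using Suc.prems(1) False n pos by (auto simp: nxt_def split: if_splits)
      have "i1 < K" using le Suc.prems by simp
      from Suc.IH[OF le(1) this Suc.prems(3) l] obtain t r j'
        where "(nxt D ^^ t) (i1, j1, d1) = (r, j', West) \<and> 0 < r \<and> r \<le> i1 \<and> M < j' \<and> r < j'"
        by blast
      with le n show ?thesis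
        by (intro exI[of _ "Suc t"] exI[of _ r] exI[of _ j']) (auto simp: funpow_swap1)
    qed
  qed
  obtain i j d where s: "s = (i, j, d)" by (cases s)
  show ?thesis
    using main[where i = i and j = j and d = d and K = "Suc (i + M)", OF order.refl] assms
    by (simp add: s)
qed

section \<open>Exit rows and their uniqueness\<close>

lemma exits_from_ex1:
  assumes "live D s"
  shows "\<exists>!r. exits_from D s r"
proof -
  obtain n r j where n: "(nxt D ^^ n) s = (r, j, West)" "0 < r" "M < j" "r < j"
    using reaches_far_east[OF assms] by blast
  have later: "(nxt D ^^ (n + t)) s = (r, j + t, West)" for t
  proof -
    have "(nxt D ^^ (n + t)) s = (nxt D ^^ t) ((nxt D ^^ n) s)"
      by (simp add: add.commute[of n] funpow_add)
    then show ?thesis using n far_east(3) by simp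
  qed
  have "exits_from D s r"
    unfolding exits_from_def rtranclp_iff[OF assms]
  proof (rule exI[of _ j], intro allI impI)
    fix j' assume "j' \<ge> j"
    then show "\<exists>n. (r, j', West) = (nxt D ^^ n) s"
      using later[of "j' - j"] by (intro exI[of _ "n + (j' - j)"]) simp
  qed
  moreover have "r' = r" if "exits_from D s r'" for r'
  proof -
    from that obtain m where m: "\<And>j. j \<ge> m \<Longrightarrow> \<exists>n. (r', j, West) = (nxt D ^^ n) s"
      unfolding exits_from_def rtranclp_iff[OF assms] by blast
    \<comment> \<open>This column puts the place on diagonal \<open>m + j\<close>, which is not
      before the diagonal of \<open>(r, j)\<close>. Hence the pipe has already settled in row
      \<open>r\<close>.\<close>
    obtain n' where n': "(r', m + j + r', West) = (nxt D ^^ n') s" using m[of "m + j + r'"] by auto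
    have "diag (r', m + j + r', West) = diag s + int n'"
      using funpow_live(2)[OF assms, of n'] n' by simp
    moreover have "diag (r, j, West) = diag s + int n"
      using funpow_live(2)[OF assms, of n] n by simp
    ultimately have "n' \<ge> n" by simp
    then show ?thesis using later[of "n' - n"] n' by simp
  qed
  ultimately show ?thesis by blast
qed

lemma exits_from_iff: "live D s \<Longrightarrow> exits_from D s r \<longleftrightarrow> exit_row D s = r"
  unfolding exit_row_def by (metis exits_from_ex1 the_equality)

lemma exit_rowI:
  assumes "live D s" "(nxt D ^^ n) s = (r, j, West)" "0 < r" "M < j" "r < j"
  shows "exit_row D s = r"
proof -
  have "exits_from D s r"
    unfolding exits_from_def rtranclp_iff[OF assms(1)]
  proof (rule exI[of _ j], intro allI impI)
    fix j' assume "j' \<ge> j"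
    then show "\<exists>n. (r, j', West) = (nxt D ^^ n) s"
      using assms far_east(3)[of r j "j' - j"] funpow_add[of "j' - j" n "nxt D"]
      by (intro exI[of _ "(j' - j) + n"]) simp
  qed
  then show ?thesis using exits_from_iff assms(1) by blast
qed

lemma exit_row_far_east: "0 < r \<Longrightarrow> M < j \<Longrightarrow> r < j \<Longrightarrow> wrow D r j = r"
  by (rule exit_rowI[of _ 0]) (auto simp: far_east)

lemma exit_row_nxt:
  assumes "live D s"
  shows "exit_row D (nxt D s) = exit_row D s"
proof -
  obtain n r j where n: "(nxt D ^^ n) s = (r, j, West)" "0 < r" "M < j" "r < j"
    using reaches_far_east[OF assms] by blast
  have "(nxt D ^^ n) (nxt D s) = nxt D ((nxt D ^^ n) s)" by (simp add: funpow_swap1)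
  also have "\<dots> = (r, Suc j, West)" using n far_east by simp
  finally have "exit_row D (nxt D s) = r"
    using n nxt_live(1)[OF assms] by (intro exit_rowI[of _ n r "Suc j"]) auto
  moreover have "exit_row D s = r" by (rule exit_rowI[OF assms n])
  ultimately show ?thesis by simp
qed

lemma exit_row_funpow: "live D s \<Longrightarrow> exit_row D ((nxt D ^^ n) s) = exit_row D s"
  by (induction n) (auto simp: exit_row_nxt funpow_live)

text \<open>Pipes never move south. For this reason every pipe met in a row at most \<open>k\<close>
  satisfies the invariant of the algorithm automatically.\<close>

lemma exit_row_le: "live D s \<Longrightarrow> 0 < exit_row D s \<and> exit_row D s \<le> fst s"
  using reaches_far_east exit_rowI by metis

lemma exit_row_north: "(d, North) \<in> D (Suc i) j \<Longrightarrow> srow D i j = exit_row D (Suc i, j, d)"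
  using exit_row_nxt[of "(Suc i, j, d)"] by (auto simp: live_def nxt_def)

lemma exit_row_east: "(d, East) \<in> D i j \<Longrightarrow> wrow D i (Suc j) = exit_row D (i, j, d)"
  using tiles[of i j] exit_row_nxt[of "(i, j, d)"]
  by (cases rule: all_tilesE) (auto simp: live_def nxt_def)

text \<open>The tool for computing exit rows after a move: a labelling constant along steps and
  correct far to the east is the exit row. The bound \<open>N\<close> is separate from
  \<open>M\<close>, because a guessed labelling may be irregular somewhat beyond the square.\<close>

lemma exit_row_unique:
  assumes north: "\<And>i j d. (d, North) \<in> D (Suc i) j \<Longrightarrow> L (Suc i, j, d) = L (i, j, South)"
    and east: "\<And>i j d. (d, East) \<in> D i j \<Longrightarrow> L (i, j, d) = L (i, Suc j, West)"
    and far: "\<And>r j. 0 < r \<Longrightarrow> N < j \<Longrightarrow> r < j \<Longrightarrow> L (r, j, West) = r"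
    and s: "live D s"
  shows "exit_row D s = L s"
proof -
  have nx: "L (nxt D s) = L s" if "live D s" for s
  proof -
    obtain i j d where s: "s = (i, j, d)" by (cases s)
    from that have "live D (i, j, d)" by (simp add: s)
    then show ?thesis
      using north[of d "i - 1" j] east[of d i j] by (cases rule: live_cases) (auto simp: s nxt_def)
  qed
  have fp: "L ((nxt D ^^ n) s) = L s" for n
    by (induction n) (auto simp: nx funpow_live s)
  obtain n r j where n: "(nxt D ^^ n) s = (r, j, West)" "0 < r" "M < j" "r < j"
    using reaches_far_east[OF s] by blast
  have "L s = L ((nxt D ^^ (N + n)) s)" using fp by simp
  also have "(nxt D ^^ (N + n)) s = (r, j + N, West)"
    using n by (simp add: funpow_add far_east)
  also have "L \<dots> = r" using n by (intro far) auto
  finally have "L s = r" .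
  moreover have "exit_row D s = r" by (rule exit_rowI[OF s n])
  ultimately show ?thesis by simp
qed

text \<open>After a common number of steps both pipes are in the exit row, on the same diagonal and
  hence at the same place; injectivity of \<open>nxt\<close> carries this back to the start.\<close>

lemma diag_exit_inj:
  assumes "live D s" "live D s'" "diag s = diag s'" "exit_row D s = exit_row D s'"
  shows "s = s'"
proof -
  obtain n r j where n: "(nxt D ^^ n) s = (r, j, West)" "0 < r" "M < j" "r < j"
    using reaches_far_east[OF assms(1)] by blast
  obtain n' r' j' where n': "(nxt D ^^ n') s' = (r', j', West)" "0 < r'" "M < j'" "r' < j'"
    using reaches_far_east[OF assms(2)] by blast
  have r: "r' = r" using n n' assms exit_rowI by metis
  have "(nxt D ^^ (n' + n)) s = (r, j + n', West)" "(nxt D ^^ (n + n')) s' = (r, j' + n, West)"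
    using n n' r by (simp_all add: funpow_add far_east)
  moreover have "int j - int r = diag s + int n" "int j' - int r = diag s' + int n'"
    using funpow_live(2)[OF assms(1), of n] funpow_live(2)[OF assms(2), of n'] n n' r by auto
  ultimately have "(nxt D ^^ (n' + n)) s = (nxt D ^^ (n' + n)) s'"
    using assms(3) by (simp add: add.commute)
  then show ?thesis using funpow_inj assms by blast
qed

lemma funpow_diag:
  assumes "live D s" "live D t" "exit_row D s = exit_row D t" "diag s \<le> diag t"
  shows "(nxt D ^^ nat (diag t - diag s)) s = t"
  using assms by (intro diag_exit_inj) (auto simp: funpow_live exit_row_funpow)

lemma same_pipe_iff:
  assumes "live D s" "live D t"
  shows "same_pipe D s t \<longleftrightarrow> exit_row D s = exit_row D t"
proof
  assume "same_pipe D s t"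
  then show "exit_row D s = exit_row D t"
    using assms by (auto simp: same_pipe_def rtranclp_iff exit_row_funpow)
next
  assume "exit_row D s = exit_row D t"
  then show "same_pipe D s t"
    using assms funpow_diag[of s t] funpow_diag[of t s] unfolding same_pipe_def rtranclp_iff[OF assms(1)] rtranclp_iff[OF assms(2)]
    by (metis linear)
qed

lemma crossings_eq:
  assumes "live D s" "live D t"
  shows "crossings D s t = {(i, j). D i j = cross_tile \<and>
    (srow D i j = exit_row D s \<and> wrow D i j = exit_row D t \<or>
     wrow D i j = exit_row D s \<and> srow D i j = exit_row D t)}"
proof -
  have *: "same_pipe D u (i, j, d) \<longleftrightarrow> exit_row D (i, j, d) = exit_row D u"
    if "D i j = cross_tile" "live D u" "d = South \<or> d = West" for u i j d
  proof -
    have "live D (i, j, d)" using that live_iff by auto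
    then show ?thesis using same_pipe_iff[OF that(2), of "(i, j, d)"] by auto
  qed
  show ?thesis
    unfolding crossings_def using *[OF _ assms(1)] *[OF _ assms(2)] by blast
qed

text \<open>Pipes on a common diagonal can only meet in a cell entered from the west by the upper
  one and from the south by the lower one. A bump sends the upper pipe north and keeps the order;
  only a cross reverses it.\<close>

lemma above_nxt:
  assumes "live D s" "live D s'" "above s s'"
  shows "above (nxt D s) (nxt D s') \<or>
    (\<exists>i j. s = (i, j, West) \<and> s' = (i, j, South) \<and> D i j = cross_tile)"
proof -
  obtain i j d where s: "s = (i, j, d)" by (cases s)
  obtain i' j' d' where s': "s' = (i', j', d')" by (cases s')
  from assms(1) have l: "live D (i, j, d)" by (simp add: s)
  from assms(2) have l': "live D (i', j', d')" by (simp add: s')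
  have pos: "0 < i" "0 < i'" using l l' by (auto elim: live_cases)
  have ab: "int j - int i = int j' - int i'" "i < i' \<or> i = i' \<and> d = West \<and> d' = South"
    using assms(3) by (simp_all add: s s')
  consider "i + 1 < i'" | "i' = i + 1" | "i = i'" "d = West" "d' = South" "j = j'"
    using ab by linarith
  then show ?thesis
  proof cases
    case 3
    show ?thesis
      using tiles[of i j] l l' pos 3
      by (cases rule: all_tilesE) (auto simp: s s' nxt_def live_def)
  qed (use l l' ab pos in \<open>auto simp: s s' nxt_def\<close>)
qed

lemma above_antisym: "above s s' \<Longrightarrow> \<not> above s' s"
  by (cases s; cases s') auto

lemma above_diag: "above s s' \<Longrightarrow> diag s = diag s'"
  by (cases s; cases s') simp

lemma flip_funpow:
  assumes "live D s" "live D s'" "above s s'" "\<not> above ((nxt D ^^ t) s) ((nxt D ^^ t) s')"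
  shows "\<exists>u<t. \<exists>i j. (nxt D ^^ u) s = (i, j, West) \<and> (nxt D ^^ u) s' = (i, j, South) \<and> D i j = cross_tile"
  using assms(4)
proof (induction t)
  case 0
  then show ?case using assms by simp
next
  case (Suc t)
  show ?case
  proof (cases "above ((nxt D ^^ t) s) ((nxt D ^^ t) s')")
    case True
    with Suc.prems above_nxt[OF funpow_live(1)[OF assms(1)] funpow_live(1)[OF assms(2)] True]
    show ?thesis by auto
  next
    case False
    then show ?thesis using Suc.IH by (meson less_Suc_eq)
  qed
qed

lemma flip_cross:
  assumes l: "live D s" "live D s'" "live D u" "live D u'"
    and "above s s'" "above u' u" "exit_row D u = exit_row D s" "exit_row D u' = exit_row D s'"
    and "diag s \<le> diag u"
  shows "\<exists>i j. D i j = cross_tile \<and> wrow D i j = exit_row D s \<and>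
    srow D i j = exit_row D s' \<and> diag s \<le> int j - int i"
proof -
  define t where "t = nat (diag u - diag s)"
  have d: "diag s = diag s'" "diag u = diag u'"
    using assms(5,6) above_diag by auto
  have "(nxt D ^^ t) s = u" "(nxt D ^^ t) s' = u'"
    unfolding t_def using assms d funpow_diag[of s u] funpow_diag[of s' u'] by auto
  then have "\<not> above ((nxt D ^^ t) s) ((nxt D ^^ t) s')"
    using assms above_antisym by simp
  from flip_funpow[OF l(1,2) assms(5) this]
  obtain v i j where v: "(nxt D ^^ v) s = (i, j, West)" "(nxt D ^^ v) s' = (i, j, South)" "D i j = cross_tile"
    by blast
  have "wrow D i j = exit_row D s" "srow D i j = exit_row D s'"
    using v exit_row_funpow l by metis+
  moreover have "diag s \<le> int j - int i" using funpow_live(2)[OF l(1), of v] v by simp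
  ultimately show ?thesis using v by blast
qed

text \<open>Far to the east the order on a diagonal is the order of exit rows. So two pipes whose
  present order disagrees with their exit rows still have to cross.\<close>

lemma flip_exit:
  assumes "live D s" "live D s'" "above s s'" "exit_row D s' < exit_row D s"
  shows "\<exists>i j. D i j = cross_tile \<and> wrow D i j = exit_row D s \<and>
    srow D i j = exit_row D s' \<and> diag s \<le> int j - int i"
proof -
  define r r' where "r = exit_row D s" and "r' = exit_row D s'"
  \<comment> \<open>Both comparison places below lie on diagonal \<open>t\<close>, which is past the
    square and not before the diagonal of \<open>s\<close>.\<close>
  define t where "t = nat (diag s) + M + r + r' + 1"
  have pos: "0 < r" "0 < r'" using exit_row_le assms by (auto simp: r_def r'_def)
  show ?thesis
    using assms pos
    by (intro flip_cross[where u = "(r, t + r, West)" and u' = "(r', t + r', West)"])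
      (auto simp: far_east exit_row_far_east t_def simp flip: r_def r'_def)
qed

lemma inside:
  assumes "D i j = cross_tile \<or> D i j = j_elbow \<or> D i j = bump_tile"
  shows "0 < i" "i \<le> M" "0 < j" "j \<le> M"
proof -
  have "i \<in> {1..M} \<and> j \<in> {1..M}"
    using assms outside[of i j] by (metis id_bpd_neq)
  then show "0 < i" "i \<le> M" "0 < j" "j \<le> M" by auto
qed

lemma finite_crosses: "finite (crosses D)"
proof (rule finite_subset)
  have "p \<in> {1..M} \<times> {1..M}" if "p \<in> crosses D" for p
    using that inside[of "fst p" "snd p"] by (cases p) (auto simp: crosses_def)
  then show "crosses D \<subseteq> {1..M} \<times> {1..M}" by blast
qed simp

text \<open>Pipes entering in different columns of row \<open>M\<close> start on different
  diagonals. Below the square every column is vertical, so a start can be moved down to any earlier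
  diagonal for comparison.\<close>

lemma south_bottom:
  assumes "M \<le> i" "0 < c" "c \<le> M"
  shows "live D (i, c, South) \<and> srow D i c = srow D M c"
  using assms
proof (induction i rule: dec_induct)
  case base
  have "D (Suc M) c = vertical_tile" using base by (simp add: outside')
  then show ?case using edge_north[of M c] by (simp add: live_iff)
next
  case (step i)
  then have *: "D (Suc i) c = vertical_tile" by (simp add: outside')
  then have "srow D i c = srow D (Suc i) c" by (simp add: exit_row_north)
  with step * show ?case by (simp add: live_iff)
qed

end

section \<open>Reduced tilings\<close>

definition inversions :: "(nat \<Rightarrow> nat) \<Rightarrow> (nat \<times> nat) set" where
  "inversions \<pi> = {(i, j). i < j \<and> \<pi> i > \<pi> j}"

lemma perm_length_inversions: "perm_length \<pi> = card (inversions \<pi>)"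
  by (simp add: perm_length_def inversions_def)

lemma inversions_permutes:
  assumes "\<pi> permutes {1..M}" "(i, j) \<in> inversions \<pi>"
  shows "i \<in> {1..M}" "j \<in> {1..M}"
proof -
  have *: "i < j" "\<pi> j < \<pi> i" using assms by (auto simp: inversions_def)
  have out: "\<pi> x = x" if "x \<notin> {1..M}" for x using assms that by (simp add: permutes_def)
  have "\<pi> x \<in> {1..M} \<longleftrightarrow> x \<in> {1..M}" for x using permutes_in_image[OF assms(1)] .
  then show "i \<in> {1..M}" "j \<in> {1..M}"
    using * out[of i] out[of j] by (metis atLeastAtMost_iff less_imp_le order.trans not_le)+
qed

lemma finite_inversions:
  assumes "\<pi> permutes {1..M}"
  shows "finite (inversions \<pi>)"
proof (rule finite_subset)
  show "inversions \<pi> \<subseteq> {1..M} \<times> {1..M}" using inversions_permutes[OF assms] by auto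
qed simp

text \<open>For tilings tracing a permutation this says that two pipes cross at most once. As a local
  condition it is visibly preserved by droops.\<close>

definition reduced :: "tiling \<Rightarrow> bool" where
  "reduced D \<longleftrightarrow>
     (\<forall>i j. D i j = cross_tile \<longrightarrow> srow D i j < wrow D i j)"

text \<open>The pipe from the south comes first, so that at a cross of a reduced tiling the pair is
  literally an inversion.\<close>

definition cross_rows :: "tiling \<Rightarrow> nat \<times> nat \<Rightarrow> nat \<times> nat" where
  "cross_rows D = (\<lambda>(i, j). (srow D i j, wrow D i j))"

context pipe_grid
begin

lemma live_cross:
  assumes "D i j = cross_tile \<or> D i j = bump_tile"
  shows "live D (i, j, South)" "live D (i, j, West)"
  using assms by (auto simp: live_iff)

lemma exit_row_neq:
  assumes "D i j = cross_tile \<or> D i j = bump_tile"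
  shows "srow D i j \<noteq> wrow D i j"
  using diag_exit_inj[OF live_cross[OF assms]] by auto

lemma after_cross:
  assumes "D i j = cross_tile"
  shows "live D (i - 1, j, South)" "live D (i, Suc j, West)" "above (i - 1, j, South) (i, Suc j, West)"
    "srow D (i - 1) j = srow D i j"
    "wrow D i (Suc j) = wrow D i j"
proof -
  have l: "live D (i, j, South)" "live D (i, j, West)" using assms live_cross by auto
  have n: "nxt D (i, j, South) = (i - 1, j, South)" "nxt D (i, j, West) = (i, Suc j, West)"
    using assms by (auto simp: nxt_def)
  show "live D (i - 1, j, South)" "live D (i, Suc j, West)"
    "srow D (i - 1) j = srow D i j"
    "wrow D i (Suc j) = wrow D i j"
    using nxt_live(1)[OF l(1)] nxt_live(1)[OF l(2)] exit_row_nxt[OF l(1)] exit_row_nxt[OF l(2)] n by auto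
  show "above (i - 1, j, South) (i, Suc j, West)" using inside[of i j] assms by simp
qed

lemma after_bump:
  assumes "D i j = bump_tile"
  shows "live D (i - 1, j, South)" "live D (i, Suc j, West)" "above (i - 1, j, South) (i, Suc j, West)"
    "srow D (i - 1) j = wrow D i j"
    "wrow D i (Suc j) = srow D i j"
proof -
  have l: "live D (i, j, South)" "live D (i, j, West)" using assms live_cross by auto
  have n: "nxt D (i, j, West) = (i - 1, j, South)" "nxt D (i, j, South) = (i, Suc j, West)"
    using assms by (auto simp: nxt_def)
  show "live D (i - 1, j, South)" "live D (i, Suc j, West)"
    "srow D (i - 1) j = wrow D i j"
    "wrow D i (Suc j) = srow D i j"
    using nxt_live(1)[OF l(1)] nxt_live(1)[OF l(2)] exit_row_nxt[OF l(1)] exit_row_nxt[OF l(2)] n by auto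
  show "above (i - 1, j, South) (i, Suc j, West)" using inside[of i j] assms by simp
qed

text \<open>A reversal of order happens at a cross where the upper pipe enters from the west, and
  there reducedness compares the exit rows.\<close>

lemma reduced_no_flip:
  assumes "reduced D" and l: "live D s" "live D s'" "live D u" "live D u'"
    and "above s s'" "above u' u" "exit_row D u = exit_row D s" "exit_row D u' = exit_row D s'"
    and "diag s \<le> diag u"
  shows "exit_row D s' < exit_row D s"
  using flip_cross[OF assms(2-)] \<open>reduced D\<close> unfolding reduced_def by metis

text \<open>After its first cross the pipe from the south is the upper one. To enter a later cross
  from the south again it would first have to come below, which is a reversal in the direction
  forbidden by reducedness.\<close>

lemma reduced_cross_once:
  assumes "reduced D" "D i j = cross_tile" "D i' j' = cross_tile"
    "cross_rows D (i, j) = cross_rows D (i', j')"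
  shows "i = i' \<and> j = j'"
proof -
  have gen: "\<not> int j - int i < int j' - int i'"
    if "D i j = cross_tile" "D i' j' = cross_tile" "cross_rows D (i, j) = cross_rows D (i', j')" for i j i' j'
  proof
    assume lt: "int j - int i < int j' - int i'"
    note a = after_cross[OF that(1)]
    have "wrow D i (Suc j) < srow D (i - 1) j"
      using inside[of i j] lt that(2,3) \<open>D i j = cross_tile\<close>
      by (intro reduced_no_flip[OF assms(1) a(1,2) _ _ a(3), of "(i', j', South)" "(i', j', West)"])
        (auto simp: a a[unfolded One_nat_def] live_cross cross_rows_def)
    then show False using assms(1) that(1) unfolding a reduced_def by force
  qed
  have "int j - int i = int j' - int i'"
    using gen[of i j i' j'] gen[of i' j' i j] assms(2-4) by (metis linorder_neqE)
  then have "(i, j, South) = (i', j', South)"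
    using assms(2-4) by (intro diag_exit_inj) (auto simp: live_cross cross_rows_def)
  then show ?thesis by simp
qed

end

locale traced_grid = pipe_grid +
  fixes \<pi> :: "nat \<Rightarrow> nat"
  assumes perm: "\<pi> permutes {1..M}"
    and exits: "c \<in> {1..M} \<Longrightarrow> srow D M c = inv \<pi> c"
begin

lemma perm_in: "\<pi> r \<in> {1..M} \<longleftrightarrow> r \<in> {1..M}"
  using permutes_in_image[OF perm] .

lemma inv_perm [simp]: "inv \<pi> (\<pi> r) = r" "\<pi> (inv \<pi> r) = r"
  using permutes_inverses[OF perm] by auto

lemma start:
  assumes "r \<in> {1..M}" "M \<le> i"
  shows "live D (i, \<pi> r, South)" "srow D i (\<pi> r) = r"
proof -
  have "\<pi> r \<in> {1..M}" using perm_in assms by simp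
  then show "live D (i, \<pi> r, South)" "srow D i (\<pi> r) = r"
    using south_bottom[of i "\<pi> r"] assms exits[of "\<pi> r"] by auto
qed

text \<open>The pipe exiting from \<open>r'\<close> starts further left, hence above on a common
  diagonal, but exits further down; so the two pipes must cross.\<close>

lemma inversion_crosses:
  assumes "(r, r') \<in> inversions \<pi>"
  shows "\<exists>i j. D i j = cross_tile \<and> srow D i j = r \<and> wrow D i j = r'"
proof -
  have r: "r \<in> {1..M}" "r' \<in> {1..M}" using inversions_permutes[OF perm assms] .
  \<comment> \<open>The start in column \<open>\<pi> r\<close> is pushed down so far that it lies on
    the diagonal of \<open>(M, \<pi> r')\<close>.\<close>
  define i where "i = M + (\<pi> r - \<pi> r')"
  have lt: "r < r'" "\<pi> r' < \<pi> r" using assms by (auto simp: inversions_def)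
  have "above (M, \<pi> r', South) (i, \<pi> r, South)" using lt by (simp add: i_def)
  moreover have "M \<le> i" by (simp add: i_def)
  ultimately show ?thesis
    using flip_exit[of "(M, \<pi> r', South)" "(i, \<pi> r, South)"] r lt by (auto simp: start)
qed

lemma inversions_subset: "inversions \<pi> \<subseteq> cross_rows D ` crosses D"
proof
  fix p assume "p \<in> inversions \<pi>"
  then show "p \<in> cross_rows D ` crosses D"
    using inversion_crosses[of "fst p" "snd p"]
    by (cases p) (force simp: cross_rows_def crosses_def image_iff)
qed

lemma perm_length_le: "perm_length \<pi> \<le> card (crosses D)"
proof -
  have "perm_length \<pi> \<le> card (cross_rows D ` crosses D)"
    unfolding perm_length_inversions using inversions_subset finite_crosses by (intro card_mono) auto
  also have "\<dots> \<le> card (crosses D)" using finite_crosses by (rule card_image_le)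
  finally show ?thesis .
qed

lemma cross_rows_range:
  assumes "D i j = cross_tile \<or> D i j = bump_tile"
  shows "srow D i j \<in> {1..M}" "wrow D i j \<in> {1..M}"
  using exit_row_le[OF live_cross(1)[OF assms]] exit_row_le[OF live_cross(2)[OF assms]] inside[of i j] assms
  by auto

lemma reduced_cross_inversion:
  assumes "reduced D" "D i j = cross_tile"
  shows "cross_rows D (i, j) \<in> inversions \<pi>"
proof -
  define u w where "u = srow D i j" and "w = wrow D i j"
  have uw: "u < w" using assms by (simp add: reduced_def u_def w_def)
  have r: "u \<in> {1..M}" "w \<in> {1..M}" using cross_rows_range assms unfolding u_def w_def by blast+
  have "\<not> \<pi> u < \<pi> w"
  proof
    assume lt: "\<pi> u < \<pi> w"
    \<comment> \<open>From row \<open>M + M\<close> the start is on a diagonal not after the cross,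
      wherever the cross is in the square; \<open>m'\<close> puts the second start on the same
      diagonal.\<close>
    define m where "m = M + M"
    define m' where "m' = m + (\<pi> w - \<pi> u)"
    have m: "M \<le> m" "M \<le> m'" by (simp_all add: m_def m'_def)
    have "\<pi> u \<le> M" using perm_in[of u] r by simp
    then have "int (\<pi> u) - int m \<le> int j - int i" using inside[of i j] assms by (simp add: m_def)
    then have "srow D m' (\<pi> w) < srow D m (\<pi> u)"
      using r m lt \<open>D i j = cross_tile\<close>
      by (intro reduced_no_flip[OF assms(1), where u = "(i, j, South)" and u' = "(i, j, West)"])
        (auto simp: start live_cross m'_def simp flip: u_def w_def)
    then show False using r m uw by (simp add: start)
  qed
  moreover have "\<pi> u \<noteq> \<pi> w" using uw by (metis inv_perm(1) less_irrefl)
  ultimately show ?thesis using uw by (simp add: cross_rows_def inversions_def flip: u_def w_def)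
qed

text \<open>The crossing pairs always include all inversions. In a reduced tiling they are pairwise
  different inversions, so the counts agree. Conversely, equal counts leave no room for a pair that
  is not an inversion, and the order of the pair at each cross is then the reduced one.\<close>

lemma reduced_iff_card: "reduced D \<longleftrightarrow> card (crosses D) = perm_length \<pi>"
proof
  assume red: "reduced D"
  have "inj_on (cross_rows D) (crosses D)"
    using reduced_cross_once[OF red] by (auto simp: inj_on_def crosses_def)
  moreover have "cross_rows D ` crosses D \<subseteq> inversions \<pi>"
    using reduced_cross_inversion[OF red] by (auto simp: crosses_def)
  ultimately show "card (crosses D) = perm_length \<pi>"
    using inversions_subset card_image by (metis perm_length_inversions subset_antisym)
next
  assume "card (crosses D) = perm_length \<pi>"
  then have "card (cross_rows D ` crosses D) \<le> card (inversions \<pi>)"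
    using card_image_le[OF finite_crosses, of "cross_rows D"] by (simp add: perm_length_inversions)
  then have "cross_rows D ` crosses D = inversions \<pi>"
    using card_seteq[OF _ inversions_subset] finite_crosses by simp
  then have "cross_rows D (i, j) \<in> inversions \<pi>" if "D i j = cross_tile" for i j
    using that by (auto simp: crosses_def)
  then show "reduced D" unfolding reduced_def by (auto simp: cross_rows_def inversions_def)
qed

lemma pair_crossings:
  assumes "c \<in> {1..M}" "c' \<in> {1..M}"
  shows "crossings D (M, c, South) (M, c', South) = {(i, j). D i j = cross_tile \<and>
    (cross_rows D (i, j) = (inv \<pi> c, inv \<pi> c') \<or> cross_rows D (i, j) = (inv \<pi> c', inv \<pi> c))}"
proof -
  have "live D (M, c, South)" "live D (M, c', South)" using south_bottom[of M] assms by auto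
  then show ?thesis using assms exits by (auto simp: crossings_eq cross_rows_def)
qed

lemma reduced_iff_pairs:
  "reduced D \<longleftrightarrow> (\<forall>c\<in>{1..M}. \<forall>c'\<in>{1..M}. c \<noteq> c' \<longrightarrow>
     (\<forall>p\<in>crossings D (M, c, South) (M, c', South).
      \<forall>q\<in>crossings D (M, c, South) (M, c', South). p = q))" (is "_ \<longleftrightarrow> ?once")
proof
  assume red: "reduced D"
  show ?once
  proof (intro ballI impI)
    fix c c' p q
    assume c: "c \<in> {1..M}" "c' \<in> {1..M}" and "c \<noteq> c'"
      and pq: "p \<in> crossings D (M, c, South) (M, c', South)" "q \<in> crossings D (M, c, South) (M, c', South)"
    obtain i j i' j' where ij: "p = (i, j)" "q = (i', j')" by (cases p; cases q)
    from pq have x: "D i j = cross_tile" "D i' j' = cross_tile"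
      and r: "cross_rows D (i, j) = (inv \<pi> c, inv \<pi> c') \<or> cross_rows D (i, j) = (inv \<pi> c', inv \<pi> c)"
      "cross_rows D (i', j') = (inv \<pi> c, inv \<pi> c') \<or> cross_rows D (i', j') = (inv \<pi> c', inv \<pi> c)"
      by (auto simp: pair_crossings[OF c] ij)
    have "cross_rows D (i, j) = cross_rows D (i', j')"
      using r reduced_cross_inversion[OF red x(1)] reduced_cross_inversion[OF red x(2)]
      by (auto simp: inversions_def)
    then show "p = q" using reduced_cross_once[OF red x] ij by simp
  qed
next
  assume once: ?once
  show "reduced D" unfolding reduced_def
  proof (intro allI impI, rule ccontr)
    fix i j assume x: "D i j = cross_tile"
    define u w where "u = srow D i j" and "w = wrow D i j"
    assume "\<not> srow D i j < wrow D i j"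
    then have wu: "w < u" using exit_row_neq[of i j] x by (auto simp: u_def w_def)
    have r: "u \<in> {1..M}" "w \<in> {1..M}" using cross_rows_range x unfolding u_def w_def by blast+
    note a = after_cross[OF x]
    \<comment> \<open>At a cross in the wrong order the pipe that is above afterwards has the larger
      exit row, so the two pipes have to cross again on a later diagonal.\<close>
    have "wrow D i (Suc j) < srow D (i - 1) j"
      using a wu by (simp add: u_def w_def)
    from flip_exit[OF a(1-3) this] obtain i' j' where
      x': "D i' j' = cross_tile" "wrow D i' j' = u" "srow D i' j' = w"
      and d: "int j - int (i - 1) \<le> int j' - int i'"
      using a by (auto simp: u_def w_def)
    have c: "\<pi> u \<in> {1..M}" "\<pi> w \<in> {1..M}" using r perm_in by auto
    have "(i, j) \<in> crossings D (M, \<pi> u, South) (M, \<pi> w, South)"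
      "(i', j') \<in> crossings D (M, \<pi> u, South) (M, \<pi> w, South)"
      unfolding pair_crossings[OF c] using x x' by (simp_all add: cross_rows_def u_def w_def)
    moreover have "\<pi> u \<noteq> \<pi> w" using wu by (metis inv_perm(1) less_irrefl)
    ultimately have "(i, j) = (i', j')" using once c by blast
    then show False using d inside[of i j] x by simp
  qed
qed

end

lemma BPD_iff:
  "D \<in> BPD M \<pi> \<longleftrightarrow> traced_grid M D \<pi> \<and> reduced D \<and> (\<forall>i j. D i j \<noteq> bump_tile)"
proof
  assume D: "D \<in> BPD M \<pi>"
  then have out: "D i j = id_bpd i j" if "i \<notin> {1..M} \<or> j \<notin> {1..M}" for i j
    using that by (auto simp: BPD_def)
  have six: "D i j \<in> {blank_tile, horizontal_tile, vertical_tile, cross_tile, r_elbow, j_elbow}" for i j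
    using D out[of i j] by (cases "i \<in> {1..M} \<and> j \<in> {1..M}") (auto simp: BPD_def id_bpd_def)
  interpret pipe_grid M D
  proof
    show "D i j \<in> all_tiles" for i j using six[of i j] unfolding all_tiles_def by blast
    show "edges_match D" using D by (simp add: BPD_def)
  qed (use out in blast)
  have tr: "traced_grid M D \<pi>"
  proof
    show "\<pi> permutes {1..M}" using D by (simp add: BPD_def)
    fix c assume c: "c \<in> {1..M}"
    then have "exits_from D (M, c, South) (inv \<pi> c)" using D by (simp add: BPD_def)
    then show "srow D M c = inv \<pi> c"
      using c south_bottom[of M c] exits_from_iff by auto
  qed
  then interpret traced_grid M D \<pi> .
  have "reduced D" unfolding reduced_iff_pairs using D unfolding BPD_def by blast
  moreover have "D i j \<noteq> bump_tile" for i j using six[of i j] by auto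
  ultimately show "traced_grid M D \<pi> \<and> reduced D \<and> (\<forall>i j. D i j \<noteq> bump_tile)" using tr by blast
next
  assume a: "traced_grid M D \<pi> \<and> reduced D \<and> (\<forall>i j. D i j \<noteq> bump_tile)"
  then interpret traced_grid M D \<pi> by blast
  have "D i j \<in> {blank_tile, horizontal_tile, vertical_tile, cross_tile, r_elbow, j_elbow}" for i j
    using tiles[of i j] a unfolding all_tiles_def by blast
  moreover have "exits_from D (M, c, South) (inv \<pi> c)" if "c \<in> {1..M}" for c
    using exits[OF that] south_bottom[of M c] exits_from_iff that by auto
  moreover have "reduced D" using a by blast
  ultimately show "D \<in> BPD M \<pi>"
    unfolding BPD_def using perm outside edges reduced_iff_pairs by blast
qed

section \<open>Exchanging a bump and a cross\<close>

text \<open>Tiles are sets: automation would expand equations between tiles into memberships and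
  fail to terminate.\<close>

declare equalityI [rule del] equalityCE [rule del]

text \<open>Inversions are injected into those of the longer permutation, missing the new inversion
  \<open>(\<alpha>, \<beta>)\<close>.\<close>

lemma perm_length_transpose:
  assumes perm: "\<pi> permutes {1..M}" and \<alpha>\<beta>: "\<alpha> \<in> {1..M}" "\<beta> \<in> {1..M}" "\<alpha> < \<beta>" "\<pi> \<alpha> < \<pi> \<beta>"
  shows "perm_length \<pi> < perm_length (\<pi> \<circ> transpose \<alpha> \<beta>)"
proof -
  define t where "t = transpose \<alpha> \<beta>"
  have t: "t \<alpha> = \<beta>" "t \<beta> = \<alpha>" "\<And>x. x \<noteq> \<alpha> \<Longrightarrow> x \<noteq> \<beta> \<Longrightarrow> t x = x" "\<And>x. t (t x) = x"
    by (auto simp: t_def)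
  \<comment> \<open>Relabelling both positions by \<open>t\<close> would reverse some pairs between
    \<open>\<alpha>\<close> and \<open>\<beta>\<close>, such as \<open>(\<alpha>, j)\<close>; those
    pairs stay inversions as they are, since \<open>\<pi> \<alpha> < \<pi> \<beta>\<close>, and are
    left alone.\<close>
  define f where "f = (\<lambda>(i, j). if \<alpha> \<le> i \<and> j \<le> \<beta> then (i, j) else (t i, t j))"
  have perm': "(\<pi> \<circ> t) permutes {1..M}"
    unfolding t_def using perm \<alpha>\<beta> by (intro permutes_compose permutes_swap_id) auto
  have f_inv: "f (f p) = p" if "fst p < snd p" for p
    using that \<open>\<alpha> < \<beta>\<close> t unfolding f_def by (cases p) (auto simp: t_def transpose_def)
  have into: "f p \<in> inversions (\<pi> \<circ> t) - {(\<alpha>, \<beta>)}" if "p \<in> inversions \<pi>" for p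
    using that \<alpha>\<beta>(3,4) unfolding f_def inversions_def
    by (cases p) (auto simp: t_def transpose_def split: if_splits)
  have "inj_on f (inversions \<pi>)"
  proof (rule inj_on_inverseI)
    show "f (f p) = p" if "p \<in> inversions \<pi>" for p
      using that f_inv[of p] by (auto simp: inversions_def)
  qed
  then have "card (inversions \<pi>) \<le> card (inversions (\<pi> \<circ> t) - {(\<alpha>, \<beta>)})"
    using finite_inversions[OF perm'] by (intro card_inj_on_le[of f] image_subsetI into) auto
  also have "\<dots> < card (inversions (\<pi> \<circ> t))"
    using finite_inversions[OF perm'] \<alpha>\<beta> t
    by (intro card_Diff1_less) (auto simp: inversions_def)
  finally show ?thesis by (simp add: perm_length_inversions t_def)
qed

section \<open>Toggling one cell between bump and cross\<close>

definition toggle :: "tiling \<Rightarrow> nat \<Rightarrow> nat \<Rightarrow> tiling" where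
  "toggle D a b = set_tile D a b (if D a b = bump_tile then cross_tile else bump_tile)"

lemma set_tile_apply [simp]:
  "set_tile D a b T i j = (if i = a \<and> j = b then T else D i j)"
  by (simp add: set_tile_def)

lemma toggle_apply:
  "toggle D a b i j = (if i = a \<and> j = b then (if D a b = bump_tile then cross_tile else bump_tile) else D i j)"
  by (simp add: toggle_def)

lemma toggle_toggle:
  assumes "D a b = bump_tile \<or> D a b = cross_tile"
  shows "toggle (toggle D a b) a b = D"
  using assms by (intro ext) (auto simp: toggle_apply)

context pipe_grid
begin

text \<open>Bump and cross use the same four sides, so no neighbouring cell notices the
  change.\<close>

lemma toggle_grid:
  assumes ab: "D a b = bump_tile \<or> D a b = cross_tile"
  shows "pipe_grid M (toggle D a b)"
proof
  have j: "joined d (toggle D a b i j) \<longleftrightarrow> joined d (D i j)" for d i j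
    using ab by (elim disjE) (simp_all add: toggle_apply)
  show "edges_match (toggle D a b)"
    using edges by (simp add: edges_match_def j)
  show "toggle D a b i j = id_bpd i j" if "i \<notin> {1..M} \<or> j \<notin> {1..M}" for i j
  proof -
    have "D i j = id_bpd i j" by (rule outside[OF that])
    moreover have "\<not> (i = a \<and> j = b)" using calculation ab id_bpd_neq by metis
    ultimately show ?thesis by (auto simp: toggle_apply)
  qed
  show "toggle D a b i j \<in> all_tiles" for i j
    using tiles[of i j] by (simp add: toggle_apply all_tiles_def)
qed

lemma toggle_live:
  assumes ab: "D a b = bump_tile \<or> D a b = cross_tile"
  shows "live (toggle D a b) s \<longleftrightarrow> live D s"
proof -
  interpret T: pipe_grid M "toggle D a b" by (rule toggle_grid[OF ab])
  obtain i j d where s: "s = (i, j, d)" by (cases s)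
  have "joined e (toggle D a b i j) \<longleftrightarrow> joined e (D i j)" for e
    using ab by (elim disjE) (simp_all add: toggle_apply)
  then show ?thesis unfolding s by (cases d) (simp_all add: T.live_iff live_iff)
qed

text \<open>Places on later diagonals are downstream of the toggled cell on their pipe; on earlier
  diagonals the ends of the two pipes are exchanged.\<close>

lemma toggle_exit:
  assumes ab: "D a b = bump_tile \<or> D a b = cross_tile" and s: "live D s"
  shows "exit_row (toggle D a b) s =
    (if diag s \<le> int b - int a
     then transpose (wrow D a b) (srow D a b) (exit_row D s)
     else exit_row D s)"
proof -
  interpret T: pipe_grid M "toggle D a b" by (rule toggle_grid[OF ab])
  define p q where "p = wrow D a b" and "q = srow D a b"
  define L where "L = (\<lambda>s. if diag s \<le> int b - int a then transpose p q (exit_row D s) else exit_row D s)"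
  have lab: "live D (a, b, South)" "live D (a, b, West)" using ab live_cross by auto
  have pq: "p \<le> a" "q \<le> a" using exit_row_le lab by (fastforce simp: p_def q_def)+
  have Lab: "L (a, b, West) = q" "L (a, b, South) = p" by (simp_all add: L_def flip: p_def q_def)
  have step: "L t' = L t"
    if "live D t" "diag t' = diag t + 1" "exit_row D t' = exit_row D t" "t \<noteq> (a, b, West)" "t \<noteq> (a, b, South)" for t t'
  proof (cases "diag t = int b - int a")
    case True
    \<comment> \<open>On the diagonal of the toggled cell the pipes \<open>p\<close> and
      \<open>q\<close> are only at the two places entering that cell, so the transposition fixes the
      label of every other place there.\<close>
    then have "exit_row D t \<noteq> p" "exit_row D t \<noteq> q"
      using that diag_exit_inj[OF that(1) lab(1)] diag_exit_inj[OF that(1) lab(2)] unfolding p_def q_def by auto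
    with True show ?thesis using that by (simp add: L_def)
  qed (use that in \<open>simp add: L_def\<close>)
  have pos: "0 < a" using inside[of a b] ab by auto
  have north: "L (Suc i, j, d) = L (i, j, South)" if n: "(d, North) \<in> toggle D a b (Suc i) j" for i j d
  proof (cases "Suc i = a \<and> j = b")
    case True
    have "L (i, j, South) = srow D i j" using True by (auto simp: L_def)
    moreover have "srow D i j = (if D a b = bump_tile then p else q)"
      using True ab exit_row_north[of West i j] exit_row_north[of South i j] by (auto simp: p_def q_def)
    ultimately show ?thesis using n True ab Lab by (auto simp: toggle_apply split: if_splits)
  next
    case False
    then have "(d, North) \<in> D (Suc i) j" using n by (auto simp: toggle_apply split: if_splits)
    then show ?thesis using False
      by (intro step[symmetric]) (auto simp: live_def exit_row_north)
  qed
  have east: "L (i, j, d) = L (i, Suc j, West)" if n: "(d, East) \<in> toggle D a b i j" for i j d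
  proof (cases "i = a \<and> j = b")
    case True
    have "L (i, Suc j, West) = wrow D i (Suc j)" using True by (auto simp: L_def)
    moreover have "wrow D i (Suc j) = (if D a b = bump_tile then q else p)"
      using True ab exit_row_east[of West i j] exit_row_east[of South i j] by (auto simp: p_def q_def)
    ultimately show ?thesis using n True ab Lab by (auto simp: toggle_apply split: if_splits)
  next
    case False
    then have "(d, East) \<in> D i j" using n by (auto simp: toggle_apply split: if_splits)
    then show ?thesis using False
      by (intro step[symmetric]) (auto simp: live_def exit_row_east)
  qed
  \<comment> \<open>Only labels \<open>p\<close> and \<open>q\<close>, both at most
    \<open>a\<close>, can be altered, and beyond column \<open>M + a + b\<close> these rows are on
    diagonals after the toggled cell.\<close>
  have far: "L (r, j, West) = r" if "0 < r" "M + a + b < j" "r < j" for r j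
  proof -
    have "wrow D r j = r" using that by (intro exit_row_far_east) auto
    moreover have "r \<noteq> p \<and> r \<noteq> q \<or> \<not> diag (r, j, West) \<le> int b - int a"
      using that pq by auto
    ultimately show ?thesis by (auto simp: L_def)
  qed
  have "exit_row (toggle D a b) s = L s"
    by (rule T.exit_row_unique[OF north east far]) (use s toggle_live[OF ab] in auto)
  then show ?thesis by (simp add: L_def p_def q_def)
qed

lemma card_crosses_toggle:
  "D a b = bump_tile \<Longrightarrow> card (crosses (toggle D a b)) = card (crosses D) + 1"
  "D a b = cross_tile \<Longrightarrow> card (crosses (toggle D a b)) + 1 = card (crosses D)"
proof -
  assume "D a b = bump_tile"
  then have "crosses (toggle D a b) = insert (a, b) (crosses D)" "(a, b) \<notin> crosses D"
    by (auto simp: crosses_def toggle_apply set_eq_iff)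
  then show "card (crosses (toggle D a b)) = card (crosses D) + 1"
    using finite_crosses by simp
next
  assume "D a b = cross_tile"
  then have "crosses (toggle D a b) = crosses D - {(a, b)}" "(a, b) \<in> crosses D"
    by (auto simp: crosses_def toggle_apply set_eq_iff)
  then show "card (crosses (toggle D a b)) + 1 = card (crosses D)"
    using card_Suc_Diff1[OF finite_crosses, of "(a, b)"] by simp
qed

end

context traced_grid
begin

lemma toggle_traced:
  assumes ab: "D a b = bump_tile \<or> D a b = cross_tile"
  shows "traced_grid M (toggle D a b)
    (\<pi> \<circ> transpose (wrow D a b) (srow D a b))"
proof -
  interpret T: pipe_grid M "toggle D a b" by (rule toggle_grid[OF ab])
  let ?t = "transpose (wrow D a b) (srow D a b)"
  have in_range: "wrow D a b \<in> {1..M}" "srow D a b \<in> {1..M}"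
    using cross_rows_range ab by blast+
  show ?thesis
  proof
    show "(\<pi> \<circ> ?t) permutes {1..M}"
      using perm in_range by (intro permutes_compose permutes_swap_id) auto
    fix c assume c: "c \<in> {1..M}"
    \<comment> \<open>The starts are read off in row \<open>M + M\<close>, where all of them lie on
      diagonals not after the toggled cell, so that \<open>toggle_exit\<close> transposes every
      label.\<close>
    have "srow (toggle D a b) M c = srow (toggle D a b) (M + M) c"
      using c T.south_bottom[of "M + M" c] by simp
    also have "\<dots> = ?t (srow D (M + M) c)"
      using c south_bottom[of "M + M" c] inside[of a b] ab by (subst toggle_exit[OF ab]) auto
    also have "srow D (M + M) c = inv \<pi> c"
      using c south_bottom[of "M + M" c] exits[of c] by simp
    also have "?t (inv \<pi> c) = inv (\<pi> \<circ> ?t) c"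
      using permutes_bij[OF perm] by (simp add: o_inv_distrib)
    finally show "srow (toggle D a b) M c = inv (\<pi> \<circ> ?t) c" .
  qed
qed

end

text \<open>The position \<open>(a, b)\<close> is arbitrary if there is no bump.\<close>

definition bumped :: "nat \<Rightarrow> (nat \<Rightarrow> nat) \<Rightarrow> tiling \<Rightarrow> nat \<Rightarrow> nat \<Rightarrow> bool" where
  "bumped M \<pi> D a b \<longleftrightarrow> traced_grid M D \<pi> \<and> reduced D \<and>
     (\<forall>i j. D i j = bump_tile \<longrightarrow> i = a \<and> j = b)"

lemma BPD_bumped: "D \<in> BPD M \<pi> \<longleftrightarrow> bumped M \<pi> D a b \<and> D a b \<noteq> bump_tile"
  unfolding BPD_iff bumped_def by metis

section \<open>Moving, resolving and creating the bump\<close>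

lemma bump_crossings_eq:
  assumes B: "bumped M \<pi> D a b" and ab: "D a b = bump_tile"
  shows "bump_crossings D a b = {(i, j). D i j = cross_tile \<and>
    {srow D i j, wrow D i j} = {srow D a b, wrow D a b}}"
proof -
  interpret traced_grid M D \<pi> using B by (simp add: bumped_def)
  show ?thesis unfolding bump_crossings_def using ab
    by (subst crossings_eq) (auto simp: live_cross doubleton_eq_iff intro!: Collect_cong)
qed

text \<open>A bump keeps the pipe from the west above. A cross of a reduced tiling brings the pipe
  with the smaller exit row on top. So if the west pipe of the bump has the smaller exit row, the
  crossing lies behind, and otherwise ahead. This dichotomy decides how the two toggles of a swap
  act on labels.\<close>

lemma crossing_position:
  assumes B: "bumped M \<pi> D a b" and ab: "D a b = bump_tile" and cr: "(a', b') \<in> bump_crossings D a b"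
  shows "wrow D a b < srow D a b \<and> int b' - int a' < int b - int a \<and>
      srow D a' b' = wrow D a b \<and>
      wrow D a' b' = srow D a b \<or>
    srow D a b < wrow D a b \<and> int b - int a < int b' - int a' \<and>
      srow D a' b' = srow D a b \<and>
      wrow D a' b' = wrow D a b"
proof -
  have x: "D a' b' = cross_tile" and rows: "{srow D a' b', wrow D a' b'} =
      {srow D a b, wrow D a b}"
    using cr by (simp_all add: bump_crossings_eq[OF B ab])
  interpret traced_grid M D \<pi> using B by (simp add: bumped_def)
  have red: "reduced D" using B by (simp add: bumped_def)
  have lt: "srow D a' b' < wrow D a' b'"
    using red x by (simp add: reduced_def)
  have l: "live D (a, b, South)" "live D (a, b, West)" "live D (a', b', South)" "live D (a', b', West)"
    using live_cross ab x by auto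
  have ne: "int b' - int a' \<noteq> int b - int a"
  proof
    assume eq: "int b' - int a' = int b - int a"
    have "srow D a' b' = srow D a b \<or> srow D a' b' = wrow D a b"
      using rows by (auto simp: doubleton_eq_iff)
    then have "(a', b', South) = (a, b, South) \<or> (a', b', South) = (a, b, West)"
      using diag_exit_inj[OF l(3) l(1)] diag_exit_inj[OF l(3) l(2)] eq by auto
    then show False using ab x by auto
  qed
  consider "srow D a' b' = wrow D a b" "wrow D a' b' = srow D a b"
    | "srow D a' b' = srow D a b" "wrow D a' b' = wrow D a b"
    using rows by (auto simp: doubleton_eq_iff)
  then show ?thesis
  proof cases
    case 1
    note e = after_bump[OF ab]
    have "\<not> int b - int a < int b' - int a'"
    proof
      assume "int b - int a < int b' - int a'"
      then have "wrow D a (Suc b) < srow D (a - 1) b"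
        using l 1 e inside[of a b] ab
        by (intro reduced_no_flip[OF red e(1,2) l(3,4) e(3)]) auto
      then show False using e lt 1 by simp
    qed
    with ne lt 1 show ?thesis by simp
  next
    case 2
    note e = after_cross[OF x]
    have "\<not> int b' - int a' < int b - int a"
    proof
      assume "int b' - int a' < int b - int a"
      then have "wrow D a' (Suc b') < srow D (a' - 1) b'"
        using l 2 e inside[of a' b'] x
        by (intro reduced_no_flip[OF red e(1,2) l(1,2) e(3)]) auto
      then show False using e lt 2 by simp
    qed
    with ne lt 2 show ?thesis by simp
  qed
qed

definition swap_bump :: "tiling \<Rightarrow> nat \<Rightarrow> nat \<Rightarrow> nat \<Rightarrow> nat \<Rightarrow> tiling" where
  "swap_bump D a b a' b' = toggle (toggle D a b) a' b'"

text \<open>The two toggles transpose the same pair of exit rows and cancel in the permutation, and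
  the number of crosses does not change, so the tiling stays reduced. The pipe entering the old bump
  from the west enters the new one from the south: it can be drooped again without changing pipes.
  The last two claims make the swap an involution.\<close>

lemma swap_bump_bumped:
  assumes B: "bumped M \<pi> D a b" and ab: "D a b = bump_tile" and cr: "(a', b') \<in> bump_crossings D a b"
  defines "E \<equiv> swap_bump D a b a' b'"
  shows "bumped M \<pi> E a' b'" "E a' b' = bump_tile" "E a b = cross_tile"
    "srow E a' b' = wrow D a b"
    "wrow E a' b' = srow D a b"
    "(a, b) \<in> bump_crossings E a' b'"
    "swap_bump E a' b' a b = D"
proof -
  have x: "D a' b' = cross_tile" and rows: "{srow D a' b', wrow D a' b'} =
      {srow D a b, wrow D a b}"
    using cr by (simp_all add: bump_crossings_eq[OF B ab])
  define p q where "p = wrow D a b" and "q = srow D a b"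
  define D1 where "D1 = toggle D a b"
  have E: "E = toggle D1 a' b'" by (simp add: E_def D1_def swap_bump_def)
  interpret traced_grid M D \<pi> using B by (simp add: bumped_def)
  have red: "reduced D" using B by (simp add: bumped_def)
  have ne: "(a, b) \<noteq> (a', b')" using ab x by auto
  have ab': "D a b = bump_tile \<or> D a b = cross_tile" using ab by simp
  interpret D1: traced_grid M D1 "\<pi> \<circ> transpose p q"
    unfolding D1_def p_def q_def by (rule toggle_traced[OF ab'])
  have x1: "D1 a' b' = cross_tile" "D1 a b = cross_tile" using ne x ab by (auto simp: D1_def toggle_apply)
  have x1': "D1 a' b' = bump_tile \<or> D1 a' b' = cross_tile" using x1 by simp
  have l: "live D (a, b, South)" "live D (a, b, West)" "live D (a', b', South)" "live D (a', b', West)"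
    using live_cross ab x by auto
  have rows': "{srow D a' b', wrow D a' b'} = {p, q}"
    using rows by (simp add: p_def q_def insert_commute)
  have L1: "exit_row D1 s = (if diag s \<le> int b - int a then transpose p q (exit_row D s) else exit_row D s)"
    if "live D s" for s
    using toggle_exit[OF ab' that] by (simp add: D1_def p_def q_def)
  \<comment> \<open>The first toggle either exchanges both labels at \<open>(a', b')\<close> or
    neither, so the unordered pair there is still \<open>{p, q}\<close>.\<close>
  have t1: "transpose (wrow D1 a' b') (srow D1 a' b') = transpose p q"
    using rows' l by (auto simp: L1 doubleton_eq_iff transpose_commute)
  interpret E: traced_grid M E "\<pi> \<circ> transpose p q \<circ> transpose p q"
    using D1.toggle_traced[OF x1'] unfolding t1 E .
  have "\<pi> \<circ> transpose p q \<circ> transpose p q = \<pi>" by (auto simp: fun_eq_iff)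
  then have trE: "traced_grid M E \<pi>" using E.traced_grid_axioms by simp
  have "card (crosses E) = card (crosses D)"
    using card_crosses_toggle(1)[OF ab] D1.card_crosses_toggle(2)[OF x1(1)] by (simp add: E D1_def)
  then have "reduced E"
    using red reduced_iff_card traced_grid.reduced_iff_card[OF trE] by simp
  moreover have "i = a' \<and> j = b'" if bump: "E i j = bump_tile" for i j
  proof (rule ccontr)
    assume "\<not> (i = a' \<and> j = b')"
    then have "D1 i j = bump_tile" using bump by (auto simp: E toggle_apply split: if_splits)
    then have "D i j = bump_tile" "\<not> (i = a \<and> j = b)"
      using ab by (auto simp: D1_def toggle_apply split: if_splits)
    then show False using B by (simp add: bumped_def)
  qed
  ultimately show BE: "bumped M \<pi> E a' b'" using trE by (simp add: bumped_def)
  show E': "E a' b' = bump_tile" "E a b = cross_tile" using ne x1 by (auto simp: E toggle_apply)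
  have L2: "exit_row E s = (if diag s \<le> int b' - int a' then transpose p q (exit_row D1 s) else exit_row D1 s)"
    if "live D s" for s
    using D1.toggle_exit[OF x1', of s] that toggle_live[OF ab'] by (simp add: E t1 flip: D1_def)
  have pq: "p \<noteq> q" using exit_row_neq[of a b] ab by (auto simp: p_def q_def)
  show new: "srow E a' b' = wrow D a b"
    "wrow E a' b' = srow D a b"
    using crossing_position[OF B ab cr] l by (auto simp: L2 L1 simp flip: p_def q_def)
  have "{srow E a b, wrow E a b} = {q, p}"
    using l by (auto simp: L2 L1 insert_commute simp flip: p_def q_def)
  then show "(a, b) \<in> bump_crossings E a' b'"
    by (simp add: bump_crossings_eq[OF BE E'(1)] E' new p_def q_def insert_commute)
  show "swap_bump E a' b' a b = D"
    using ne ab x by (auto simp: swap_bump_def E D1_def toggle_apply fun_eq_iff)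
qed

lemma bump_crossings_unique:
  assumes B: "bumped M \<pi> D a b" and ab: "D a b = bump_tile"
    and "(i, j) \<in> bump_crossings D a b" "(i', j') \<in> bump_crossings D a b"
  shows "i = i' \<and> j = j'"
proof -
  interpret traced_grid M D \<pi> using B by (simp add: bumped_def)
  show ?thesis
  proof (rule reduced_cross_once)
    show "reduced D" using B by (simp add: bumped_def)
    show x: "D i j = cross_tile" "D i' j' = cross_tile"
      using assms(3,4) by (auto simp: bump_crossings_eq[OF B ab])
    show "cross_rows D (i, j) = cross_rows D (i', j')"
      using crossing_position[OF B ab assms(3)] crossing_position[OF B ab assms(4)]
      by (auto simp: cross_rows_def)
  qed
qed

lemma cross_bump_swap_eq:
  assumes B: "bumped M \<pi> D a b" and ab: "D a b = bump_tile" and x: "(a', b') \<in> bump_crossings D a b"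
  shows "cross_bump_swap D a b = (swap_bump D a b a' b', a', b')"
proof -
  have "(THE p. p \<in> bump_crossings D a b) = (a', b')"
    using x bump_crossings_unique[OF B ab] by (intro the_equality) auto
  moreover have "D a' b' = cross_tile" using x by (simp add: bump_crossings_eq[OF B ab])
  moreover have "(a', b') \<noteq> (a, b)" using calculation(2) ab by auto
  ultimately show ?thesis
    using ab by (auto simp: cross_bump_swap_def swap_bump_def toggle_apply fun_eq_iff)
qed

text \<open>The pipe from the west leaves the bump as the upper one but has the larger exit row, so
  the pipes still have to cross.\<close>

lemma bump_crossings_ex:
  assumes B: "bumped M \<pi> D a b" and ab: "D a b = bump_tile"
    and "srow D a b < wrow D a b"
  shows "bump_crossings D a b \<noteq> {}"
proof -
  interpret traced_grid M D \<pi> using B by (simp add: bumped_def)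
  note e = after_bump[OF ab]
  have "wrow D a (Suc b) < srow D (a - 1) b" using e assms(3) by simp
  from flip_exit[OF e(1-3) this] e show ?thesis
    unfolding bump_crossings_eq[OF B ab] by (auto simp: doubleton_eq_iff)
qed

text \<open>Pipes that do not cross form no inversion, so the transposition raises the length. Only
  one cross is added, and a tiling has at least as many crosses as the length; hence the length
  grows by exactly one and the result is reduced.\<close>

lemma resolve_bump:
  assumes B: "bumped M \<pi> D a b" and ab: "D a b = bump_tile" and nox: "bump_crossings D a b = {}"
    and k: "wrow D a b \<le> k" "k < srow D a b"
  defines "\<sigma> \<equiv> \<pi> \<circ> transpose (wrow D a b) (srow D a b)"
  shows "k_cover k \<pi> \<sigma>" "toggle D a b \<in> BPD M \<sigma>"
proof -
  define p q where "p = wrow D a b" and "q = srow D a b"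
  interpret traced_grid M D \<pi> using B by (simp add: bumped_def)
  have red: "reduced D" using B by (simp add: bumped_def)
  have ab': "D a b = bump_tile \<or> D a b = cross_tile" using ab by simp
  interpret D1: traced_grid M "toggle D a b" "\<sigma>"
    unfolding \<sigma>_def by (rule toggle_traced[OF ab'])
  have pq: "p \<in> {1..M}" "q \<in> {1..M}" "p < q"
    using cross_rows_range[OF ab'[THEN disj_commute[THEN iffD1]]] k by (auto simp: p_def q_def)
  have "(p, q) \<notin> inversions \<pi>"
  proof
    assume "(p, q) \<in> inversions \<pi>"
    from inversion_crosses[OF this] nox show False
      unfolding bump_crossings_eq[OF B ab] p_def q_def by (auto simp: doubleton_eq_iff)
  qed
  moreover have "\<pi> p \<noteq> \<pi> q" using pq by (metis inv_perm(1) less_irrefl)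
  ultimately have "\<pi> p < \<pi> q" using pq by (auto simp: inversions_def)
  then have "perm_length \<pi> < perm_length \<sigma>"
    unfolding \<sigma>_def p_def[symmetric] q_def[symmetric] using perm_length_transpose[OF perm pq] by simp
  moreover have "card (crosses (toggle D a b)) = perm_length \<pi> + 1"
    using card_crosses_toggle(1)[OF ab] red reduced_iff_card by simp
  ultimately have len: "perm_length \<sigma> = perm_length \<pi> + 1" "card (crosses (toggle D a b)) = perm_length \<sigma>"
    using D1.perm_length_le by auto
  show "k_cover k \<pi> \<sigma>"
    unfolding k_cover_def using pq k len
    by (intro exI[of _ p] exI[of _ q]) (auto simp: p_def q_def \<sigma>_def)
  have "toggle D a b i j \<noteq> bump_tile" for i j
  proof (cases "i = a \<and> j = b")
    case False
    then have "D i j \<noteq> bump_tile" using B unfolding bumped_def by blast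
    with False show ?thesis by (auto simp: toggle_apply)
  qed (simp add: toggle_apply ab)
  then show "toggle D a b \<in> BPD M \<sigma>"
    unfolding BPD_iff using D1.reduced_iff_card len D1.traced_grid_axioms by blast
qed

text \<open>The transposed pair is an inversion of \<open>\<sigma>\<close>, so its pipes cross in
  \<open>E\<close>; that cross becomes the bump. Counting crosses gives reducedness. No further
  crossing remains, since in a reduced tiling it would make the pair an inversion of
  \<open>\<pi>\<close> as well. The position \<open>\<beta>\<close> lies in the square because both
  permutations fix everything beyond it.\<close>

lemma unresolve_bump:
  assumes perm_\<pi>: "\<pi> permutes {1..M}" and cover: "k_cover k \<pi> \<sigma>" and E: "E \<in> BPD M \<sigma>"
  shows "\<exists>D a b. bumped M \<pi> D a b \<and> D a b = bump_tile \<and> bump_crossings D a b = {} \<and>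
    wrow D a b \<le> k \<and> k < srow D a b \<and> E = toggle D a b"
proof -
  obtain \<alpha> \<beta> where c: "1 \<le> \<alpha>" "\<alpha> \<le> k" "k < \<beta>" "\<sigma> = \<pi> \<circ> transpose \<alpha> \<beta>" "perm_length \<sigma> = perm_length \<pi> + 1"
    using cover by (auto simp: k_cover_def)
  interpret traced_grid M E \<sigma> using E by (simp add: BPD_iff)
  have perm_\<sigma>: "\<sigma> permutes {1..M}" using traced_grid.perm[OF traced_grid_axioms] .
  have red: "reduced E" and nob: "\<And>i j. E i j \<noteq> bump_tile" using E by (simp_all add: BPD_iff)
  have \<pi>: "\<pi> = \<sigma> \<circ> transpose \<alpha> \<beta>" using c by (auto simp: fun_eq_iff)
  have "\<beta> \<in> {1..M}"
  proof (rule ccontr)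
    assume "\<beta> \<notin> {1..M}"
    then have "\<beta> > M" using c by auto
    then have "\<sigma> \<beta> = \<beta>" "\<pi> \<beta> = \<beta>"
      using perm_\<sigma> perm_\<pi> by (auto simp: permutes_def)
    moreover have "\<sigma> \<beta> = \<pi> \<alpha>" using c by simp
    ultimately have "\<pi> \<alpha> = \<pi> \<beta>" by simp
    then have "\<alpha> = \<beta>" using permutes_inj[OF perm_\<pi>] by (simp add: inj_eq)
    then show False using c by simp
  qed
  then have ab: "\<alpha> \<in> {1..M}" "\<beta> \<in> {1..M}" "\<alpha> < \<beta>" using c by auto
  have "\<not> \<sigma> \<alpha> < \<sigma> \<beta>"
    using perm_length_transpose[OF perm_\<sigma> ab] c(5) unfolding \<pi>[symmetric] by linarith
  moreover have "\<sigma> \<alpha> \<noteq> \<sigma> \<beta>" using ab by (metis inv_perm(1) less_irrefl)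
  ultimately have "(\<alpha>, \<beta>) \<in> inversions \<sigma>" using ab by (auto simp: inversions_def)
  from inversion_crosses[OF this] obtain a b where
    x: "E a b = cross_tile" "srow E a b = \<alpha>" "wrow E a b = \<beta>" by blast
  define D where "D = toggle E a b"
  have x': "E a b = bump_tile \<or> E a b = cross_tile" using x by simp
  have "\<pi> = \<sigma> \<circ> transpose \<beta> \<alpha>" using \<pi> by (simp add: transpose_commute)
  then interpret D: traced_grid M D \<pi>
    using toggle_traced[OF x'] by (simp add: D_def x)
  have "card (crosses D) = perm_length \<pi>"
    using card_crosses_toggle(2)[OF x(1)] red reduced_iff_card c by (simp add: D_def)
  then have redD: "reduced D" by (simp add: D.reduced_iff_card)
  have Dab: "D a b = bump_tile" using x by (simp add: D_def toggle_apply)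
  have B: "bumped M \<pi> D a b"
    unfolding bumped_def using D.traced_grid_axioms redD nob by (simp add: D_def toggle_apply)
  have rows: "srow D a b = \<beta>" "wrow D a b = \<alpha>"
    unfolding D_def using x live_cross[of a b] by (simp_all add: toggle_exit[OF x'])
  have "bump_crossings D a b = {}"
  proof (rule ccontr)
    assume "bump_crossings D a b \<noteq> {}"
    then obtain i j where ij: "D i j = cross_tile"
      "{srow D i j, wrow D i j} = {\<beta>, \<alpha>}"
      by (auto simp: bump_crossings_eq[OF B Dab] rows)
    have "cross_rows D (i, j) \<in> inversions \<pi>" by (rule D.reduced_cross_inversion[OF redD ij(1)])
    then have "(\<alpha>, \<beta>) \<in> inversions \<pi>"
      using ij(2) ab by (auto simp: cross_rows_def inversions_def doubleton_eq_iff)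
    then show False using \<open>(\<alpha>, \<beta>) \<in> inversions \<sigma>\<close> c by (auto simp: inversions_def)
  qed
  moreover have "E = toggle D a b" using toggle_toggle[of E a b] x' by (simp add: D_def)
  ultimately show ?thesis using B Dab rows c by (intro exI[of _ D] exI[of _ a] exI[of _ b]) simp
qed

section \<open>Min-droops\<close>

lemma reroute_tiles:
  "r_elbow - {(South, East)} = blank_tile" "bump_tile - {(South, East)} = j_elbow"
  "(\<lambda>(d, e). (d, if e = North then East else e)) ` vertical_tile = r_elbow"
  "(\<lambda>(d, e). (d, if e = North then East else e)) ` j_elbow = horizontal_tile"
  "(\<lambda>(d, e). (if d = West then South else d, e)) ` horizontal_tile = r_elbow"
  "(\<lambda>(d, e). (if d = West then South else d, e)) ` j_elbow = vertical_tile"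
  "insert (West, North) blank_tile = j_elbow" "insert (West, North) r_elbow = bump_tile"
  "cross_tile - {(South, North)} = horizontal_tile" "cross_tile - {(West, East)} = vertical_tile"
  "insert (West, East) vertical_tile = cross_tile" "insert (South, North) horizontal_tile = cross_tile"
  by (auto simp: tile_defs intro!: equalityI)

text \<open>The droop as a relation listing old and new tiles cell by cell, instead of through
  \<open>reroute\<close>: it can be read in both directions. That the tiles of the rectangle do have
  this shape is not automatic; it is the content of \<open>droop_ex\<close> and
  \<open>undroop_ex\<close>.\<close>

definition drooped :: "tiling \<Rightarrow> tiling \<Rightarrow> nat \<Rightarrow> nat \<Rightarrow> nat \<Rightarrow> nat \<Rightarrow> bool" where
  "drooped D D' a b x y \<longleftrightarrow> 0 < x \<and> 0 < y \<and>
    (D a b = r_elbow \<and> D' a b = blank_tile \<or> D a b = bump_tile \<and> D' a b = j_elbow) \<and>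
    (D (a + x) b = vertical_tile \<and> D' (a + x) b = r_elbow \<or>
      D (a + x) b = j_elbow \<and> D' (a + x) b = horizontal_tile) \<and>
    (D a (b + y) = horizontal_tile \<and> D' a (b + y) = r_elbow \<or>
      D a (b + y) = j_elbow \<and> D' a (b + y) = vertical_tile) \<and>
    (D (a + x) (b + y) = blank_tile \<and> D' (a + x) (b + y) = j_elbow \<or>
      D (a + x) (b + y) = r_elbow \<and> D' (a + x) (b + y) = bump_tile) \<and>
    (\<forall>i. a < i \<and> i < a + x \<longrightarrow> D i b = cross_tile \<and> D' i b = horizontal_tile \<and>
      D i (b + y) = horizontal_tile \<and> D' i (b + y) = cross_tile) \<and>
    (\<forall>j. b < j \<and> j < b + y \<longrightarrow> D a j = cross_tile \<and> D' a j = vertical_tile \<and>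
      D (a + x) j = vertical_tile \<and> D' (a + x) j = cross_tile) \<and>
    (\<forall>i j. a < i \<and> i < a + x \<and> b < j \<and> j < b + y \<longrightarrow> D i j = cross_tile \<and> D' i j = cross_tile) \<and>
    (\<forall>i j. \<not> (a \<le> i \<and> i \<le> a + x \<and> b \<le> j \<and> j \<le> b + y) \<longrightarrow> D' i j = D i j)"

lemma drooped_cases [consumes 1]:
  assumes dr: "drooped D D' a b x y"
  obtains
    (NW1) "i = a" "j = b" "D i j = r_elbow" "D' i j = blank_tile"
  | (NW2) "i = a" "j = b" "D i j = bump_tile" "D' i j = j_elbow"
  | (SW1) "i = a + x" "j = b" "D i j = vertical_tile" "D' i j = r_elbow"
  | (SW2) "i = a + x" "j = b" "D i j = j_elbow" "D' i j = horizontal_tile"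
  | (NE1) "i = a" "j = b + y" "D i j = horizontal_tile" "D' i j = r_elbow"
  | (NE2) "i = a" "j = b + y" "D i j = j_elbow" "D' i j = vertical_tile"
  | (SE1) "i = a + x" "j = b + y" "D i j = blank_tile" "D' i j = j_elbow"
  | (SE2) "i = a + x" "j = b + y" "D i j = r_elbow" "D' i j = bump_tile"
  | (W) "a < i" "i < a + x" "j = b" "D i j = cross_tile" "D' i j = horizontal_tile"
  | (E) "a < i" "i < a + x" "j = b + y" "D i j = horizontal_tile" "D' i j = cross_tile"
  | (N) "i = a" "b < j" "j < b + y" "D i j = cross_tile" "D' i j = vertical_tile"
  | (S) "i = a + x" "b < j" "j < b + y" "D i j = vertical_tile" "D' i j = cross_tile"
  | (inner) "a < i" "i < a + x" "b < j" "j < b + y" "D i j = cross_tile" "D' i j = cross_tile"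
  | (outer) "\<not> (a \<le> i \<and> i \<le> a + x \<and> b \<le> j \<and> j \<le> b + y)" "D' i j = D i j"
proof -
  have "i = a \<or> i = a + x \<or> a < i \<and> i < a + x \<or> \<not> (a \<le> i \<and> i \<le> a + x)"
    "j = b \<or> j = b + y \<or> b < j \<and> j < b + y \<or> \<not> (b \<le> j \<and> j \<le> b + y)"
    by linarith+
  then consider "i = a" "j = b" | "i = a + x" "j = b" | "i = a" "j = b + y" | "i = a + x" "j = b + y"
    | "a < i" "i < a + x" "j = b" | "a < i" "i < a + x" "j = b + y"
    | "i = a" "b < j" "j < b + y" | "i = a + x" "b < j" "j < b + y"
    | "a < i" "i < a + x" "b < j" "j < b + y"
    | "\<not> (a \<le> i \<and> i \<le> a + x \<and> b \<le> j \<and> j \<le> b + y)"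
    by blast
  then show thesis
  proof cases
    case 1
    then have "D i j = r_elbow \<and> D' i j = blank_tile \<or> D i j = bump_tile \<and> D' i j = j_elbow"
      using dr by (simp add: drooped_def)
    with 1 show thesis using that(1,2) by metis
  next
    case 2
    then have "D i j = vertical_tile \<and> D' i j = r_elbow \<or> D i j = j_elbow \<and> D' i j = horizontal_tile"
      using dr by (simp add: drooped_def)
    with 2 show thesis using that(3,4) by metis
  next
    case 3
    then have "D i j = horizontal_tile \<and> D' i j = r_elbow \<or> D i j = j_elbow \<and> D' i j = vertical_tile"
      using dr by (simp add: drooped_def)
    with 3 show thesis using that(5,6) by metis
  next
    case 4
    then have "D i j = blank_tile \<and> D' i j = j_elbow \<or> D i j = r_elbow \<and> D' i j = bump_tile"
      using dr by (simp add: drooped_def)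
    with 4 show thesis using that(7,8) by metis
  next
    case 5
    then show thesis using that(9) dr unfolding drooped_def by simp
  next
    case 6
    then show thesis using that(10) dr unfolding drooped_def by simp
  next
    case 7
    then show thesis using that(11) dr unfolding drooped_def by simp
  next
    case 8
    then show thesis using that(12) dr unfolding drooped_def by simp
  next
    case 9
    then show thesis using that(13) dr unfolding drooped_def by simp
  next
    case 10
    then show thesis using that(14) dr unfolding drooped_def by simp
  qed
qed

lemma drooped_pos: "drooped D D' a b x y \<Longrightarrow> 0 < x \<and> 0 < y"
  by (simp add: drooped_def)

text \<open>The pipe leaves the left and top sides of the rectangle and occupies the bottom and
  right ones, so precisely the unit edges along the boundary change, and both cells at such an edge
  see the change.\<close>

lemma drooped_joined:
  assumes dr: "drooped D D' a b x y"
  shows "joined East (D' i j) = joined East (D i j) \<longleftrightarrow> \<not> ((i = a \<or> i = a + x) \<and> b \<le> j \<and> j < b + y)"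
    "joined West (D' i j) = joined West (D i j) \<longleftrightarrow> \<not> ((i = a \<or> i = a + x) \<and> b < j \<and> j \<le> b + y)"
    "joined South (D' i j) = joined South (D i j) \<longleftrightarrow> \<not> ((j = b \<or> j = b + y) \<and> a \<le> i \<and> i < a + x)"
    "joined North (D' i j) = joined North (D i j) \<longleftrightarrow> \<not> ((j = b \<or> j = b + y) \<and> a < i \<and> i \<le> a + x)"
  using drooped_pos[OF dr] by (cases rule: drooped_cases[OF dr, of i j]; auto)+

lemma drooped_edges:
  assumes dr: "drooped D D' a b x y"
  shows "edges_match D' \<longleftrightarrow> edges_match D"
proof -
  note j = drooped_joined[OF dr]
  have "joined East (D' i j) = joined West (D' i (Suc j)) \<longleftrightarrow> joined East (D i j) = joined West (D i (Suc j))" for i j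
    using j(1)[of i j] j(2)[of i "Suc j"] by (auto simp: Suc_le_eq less_Suc_eq_le)
  moreover have "joined North (D' (Suc i) j) = joined South (D' i j) \<longleftrightarrow> joined North (D (Suc i) j) = joined South (D i j)" for i j
    using j(3)[of i j] j(4)[of "Suc i" j] by (auto simp: Suc_le_eq less_Suc_eq_le)
  ultimately show ?thesis by (simp add: edges_match_def)
qed

lemma drooped_all_tiles:
  assumes dr: "drooped D D' a b x y"
  shows "D' i j \<in> all_tiles \<longleftrightarrow> D i j \<in> all_tiles"
  by (cases rule: drooped_cases[OF dr, of i j]) (simp_all add: all_tiles_def)

lemma drooped_grid:
  assumes dr: "drooped D D' a b x y" and in_grid: "0 < a" "a + x \<le> M" "0 < b" "b + y \<le> M"
  shows "pipe_grid M D' \<longleftrightarrow> pipe_grid M D"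
proof -
  have "D' i j = D i j" if "i \<notin> {1..M} \<or> j \<notin> {1..M}" for i j
    by (cases rule: drooped_cases[OF dr, of i j]) (use that in_grid in auto)
  then show ?thesis
    unfolding pipe_grid_def drooped_edges[OF dr] drooped_all_tiles[OF dr] by metis
qed

context pipe_grid
begin

lemma row_chain:
  assumes "j0 \<le> j1" "\<And>j. j0 \<le> j \<Longrightarrow> j < j1 \<Longrightarrow> (West, East) \<in> D i j"
  shows "wrow D i j1 = wrow D i j0"
  using assms by (induction j1 rule: dec_induct) (auto simp: exit_row_east[of West])

lemma col_chain:
  assumes "i0 \<le> i1" "\<And>i. i0 < i \<Longrightarrow> i \<le> i1 \<Longrightarrow> (South, North) \<in> D i j"
  shows "srow D i1 j = srow D i0 j"
  using assms by (induction i1 rule: dec_induct) (auto simp: exit_row_north[of South, symmetric])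

section \<open>Effect of a droop on exit rows and crosses\<close>

lemma drooped_corner:
  assumes dr: "drooped D D' a b x y"
  shows "a \<le> i \<Longrightarrow> i < a + x \<Longrightarrow> srow D i b = srow D a b"
    "b < j \<Longrightarrow> j \<le> b + y \<Longrightarrow> wrow D a j = srow D a b"
proof -
  show "srow D i b = srow D a b" if "a \<le> i" "i < a + x"
    using that dr by (intro col_chain) (auto simp: drooped_def)
  have "(South, East) \<in> D a b" using dr by (auto simp: drooped_def)
  then have "wrow D a (Suc b) = srow D a b" by (rule exit_row_east)
  moreover have "wrow D a j = wrow D a (Suc b)" if "b < j" "j \<le> b + y"
    using that dr by (intro row_chain) (auto simp: drooped_def)
  ultimately show "wrow D a j = srow D a b" if "b < j" "j \<le> b + y"
    using that by simp
qed

end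

text \<open>The guess for \<open>exit_row_unique\<close>: the new route carries the drooped pipe,
  and every other place keeps its label.\<close>

lemma drooped_exit:
  assumes dr: "drooped D D' a b x y" and "pipe_grid M D" "pipe_grid M D'" and lv: "live D' (i, j, d)"
  shows "exit_row D' (i, j, d) =
    (if i = a + x \<and> b < j \<and> j \<le> b + y \<and> d = West \<or> j = b + y \<and> a \<le> i \<and> i < a + x \<and> d = South
     then srow D a b else exit_row D (i, j, d))"
proof -
  interpret pipe_grid M D by fact
  interpret D': pipe_grid M D' by fact
  have xy: "0 < x" "0 < y" using drooped_pos[OF dr] by auto
  define p where "p = srow D a b"
  define L where "L = (\<lambda>(i, j, d). if i = a + x \<and> b < j \<and> j \<le> b + y \<and> d = West \<or> j = b + y \<and> a \<le> i \<and> i < a + x \<and> d = South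
     then p else exit_row D (i, j, d))"
  note left = drooped_corner(1)[OF dr, folded p_def] and top = drooped_corner(2)[OF dr, folded p_def]
  have north: "L (Suc i, j, d) = L (i, j, South)" if n: "(d, North) \<in> D' (Suc i) j" for i j d
  using dr
  proof (cases rule: drooped_cases[where i = "Suc i" and j = j])
    case SW1
    with n show ?thesis by simp
  next
    case W
    with n show ?thesis by simp
  next
    case outer
    with n have "srow D i j = exit_row D (Suc i, j, d)" by (simp add: exit_row_north)
    with outer show ?thesis by (auto simp: L_def)
  next
    case NE2
    then have "srow D i j = wrow D (Suc i) j" by (simp add: exit_row_north)
    with NE2 n top[of j] xy show ?thesis by (simp add: L_def)
  next
    case N
    then have "srow D i j = srow D (Suc i) j" by (simp add: exit_row_north)
    with N n xy show ?thesis by (simp add: L_def)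
  next
    case S
    then have "srow D i j = srow D (Suc i) j" by (simp add: exit_row_north)
    with S n xy show ?thesis by (auto simp: L_def)
  next
    case inner
    then have "srow D i j = srow D (Suc i) j" by (simp add: exit_row_north)
    with inner n xy show ?thesis by (auto simp: L_def)
  next
    case NW2
    then have "srow D i j = wrow D (Suc i) j" by (simp add: exit_row_north)
    with NW2 n xy show ?thesis by (auto simp: L_def)
  qed (use n xy in \<open>auto simp: L_def\<close>)
  have east: "L (i, j, d) = L (i, Suc j, West)" if n: "(d, East) \<in> D' i j" for i j d
  using dr
  proof (cases rule: drooped_cases[where i = i and j = j])
    case outer
    with n have "wrow D i (Suc j) = exit_row D (i, j, d)" by (simp add: exit_row_east)
    with outer show ?thesis by (auto simp: L_def)
  next
    case W
    then have "wrow D i (Suc j) = wrow D i j" by (simp add: exit_row_east)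
    with W n xy show ?thesis by (auto simp: L_def)
  next
    case E
    then have "wrow D i (Suc j) = wrow D i j" by (simp add: exit_row_east)
    with E n xy show ?thesis by (auto simp: L_def)
  next
    case inner
    then have "wrow D i (Suc j) = wrow D i j" by (simp add: exit_row_east)
    with inner n xy show ?thesis by (auto simp: L_def)
  next
    case SE2
    then have "wrow D i (Suc j) = srow D i j" by (simp add: exit_row_east)
    with SE2 n xy show ?thesis by (auto simp: L_def)
  next
    case SW1
    then have "srow D (i - 1) j = srow D i j"
      using exit_row_north[of South "i - 1" j] xy by simp
    with SW1 n xy left[of "i - 1"] show ?thesis by (auto simp: L_def)
  next
    case SW2
    then have "srow D (i - 1) j = wrow D i j"
      using exit_row_north[of West "i - 1" j] xy by simp
    with SW2 n xy left[of "i - 1"] show ?thesis by (auto simp: L_def)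
  next
    case NE1
    then have "wrow D i (Suc j) = wrow D i j" by (simp add: exit_row_east)
    with NE1 n xy top[of j] show ?thesis by (auto simp: L_def)
  qed (use n xy in \<open>auto simp: L_def\<close>)
  have far: "L (r, j, West) = r" if "0 < r" "M + b + y < j" "r < j" for r j
    using that exit_row_far_east[of r j] by (simp add: L_def)
  have "exit_row D' (i, j, d) = L (i, j, d)"
    by (rule D'.exit_row_unique[OF north east far lv])
  then show ?thesis by (simp add: L_def p_def)
qed

lemma drooped_traced:
  assumes dr: "drooped D D' a b x y" and in_grid: "0 < a" "a + x \<le> M" "0 < b" "b + y \<le> M"
  shows "traced_grid M D' \<pi> \<longleftrightarrow> traced_grid M D \<pi>"
proof (cases "pipe_grid M D")
  case True
  then have D': "pipe_grid M D'" using drooped_grid[OF dr in_grid] by simp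
  interpret pipe_grid M D by fact
  interpret D': pipe_grid M D' by fact
  have "srow D' M c = srow D M c" if "c \<in> {1..M}" for c
    using D'.south_bottom[of M c] that in_grid by (subst drooped_exit[OF dr True D']) auto
  then show ?thesis using True D' unfolding traced_grid_def traced_grid_axioms_def by auto
next
  case False
  then show ?thesis using drooped_grid[OF dr in_grid] by (auto simp: traced_grid_def)
qed

text \<open>The crosses of the drooping pipe on the left side move straight across the rectangle to
  the right side, those on the top side to the bottom side. The pipe crossed and the side from which
  each of the two enters remain the same.\<close>

lemma drooped_reduced:
  assumes dr: "drooped D D' a b x y" and D: "pipe_grid M D" "pipe_grid M D'"
  shows "reduced D' \<longleftrightarrow> reduced D"
proof -
  interpret pipe_grid M D by fact
  interpret D': pipe_grid M D' by fact
  have xy: "0 < x" "0 < y" using drooped_pos[OF dr] by auto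
  note ex = drooped_exit[OF dr D]
  note left = drooped_corner(1)[OF dr] and top = drooped_corner(2)[OF dr]
  have we: "wrow D i (b + y) = wrow D i b" if "a < i" "i < a + x" for i
  proof (rule row_chain)
    fix j assume "b \<le> j" "j < b + y"
    then show "(West, East) \<in> D i j" using that dr by (cases "j = b") (auto simp: drooped_def)
  qed simp
  have sn: "srow D (a + x) j = srow D a j" if "b < j" "j < b + y" for j
  proof (rule col_chain)
    fix i assume "a < i" "i \<le> a + x"
    then show "(South, North) \<in> D i j" using that dr by (cases "i = a + x") (auto simp: drooped_def)
  qed simp
  let ?ok = "\<lambda>D i j. srow D i j < wrow D i j"
  have same: "?ok D' i j \<longleftrightarrow> ?ok D i j" if "D' i j = cross_tile" "D i j = cross_tile" for i j
  using dr
  proof (cases rule: drooped_cases[where i = i and j = j])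
    case inner
    then show ?thesis using that D'.live_cross by (simp add: ex)
  next
    case outer
    have "srow D' i j = srow D i j" "wrow D' i j = wrow D i j"
      using that D'.live_cross[of i j] outer by (auto simp: ex)
    then show ?thesis by simp
  qed (use that in auto)
  have E: "?ok D' i (b + y) \<longleftrightarrow> ?ok D i b" if "a < i" "i < a + x" for i
  proof -
    have "D' i (b + y) = cross_tile" using dr that by (auto simp: drooped_def)
    then show ?thesis using that D'.live_cross[of i "b + y"] xy by (simp add: ex we left[of i])
  qed
  have S: "?ok D' (a + x) j \<longleftrightarrow> ?ok D a j" if "b < j" "j < b + y" for j
  proof -
    have "D' (a + x) j = cross_tile" using dr that by (auto simp: drooped_def)
    then show ?thesis using that D'.live_cross[of "a + x" j] xy by (simp add: ex sn top)
  qed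
  show ?thesis
  proof
    assume r: "reduced D'"
    show "reduced D" unfolding reduced_def
    proof (intro allI impI)
      fix i j assume x: "D i j = cross_tile"
      show "?ok D i j"
      using dr
      proof (cases rule: drooped_cases[where i = i and j = j])
        case W
        then have "D' i (b + y) = cross_tile" using dr by (auto simp: drooped_def)
        with r W E[of i] show ?thesis by (auto simp: reduced_def)
      next
        case N
        then have "D' (a + x) j = cross_tile" using dr by (auto simp: drooped_def)
        with r N S[of j] show ?thesis by (auto simp: reduced_def)
      qed (use x r same[of i j] in \<open>auto simp: reduced_def\<close>)
    qed
  next
    assume r: "reduced D"
    show "reduced D'" unfolding reduced_def
    proof (intro allI impI)
      fix i j assume x: "D' i j = cross_tile"
      show "?ok D' i j"
      using dr
      proof (cases rule: drooped_cases[where i = i and j = j])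
        case E
        then have "D i b = cross_tile" using dr by (auto simp: drooped_def)
        with r E \<open>\<And>i. a < i \<Longrightarrow> i < a + x \<Longrightarrow> ?ok D' i (b + y) \<longleftrightarrow> ?ok D i b\<close>
        show ?thesis by (simp add: reduced_def)
      next
        case S
        then have "D a j = cross_tile" using dr by (auto simp: drooped_def)
        with r S \<open>\<And>j. b < j \<Longrightarrow> j < b + y \<Longrightarrow> ?ok D' (a + x) j \<longleftrightarrow> ?ok D a j\<close>
        show ?thesis by (simp add: reduced_def)
      qed (use x r same[of i j] in \<open>auto simp: reduced_def\<close>)
    qed
  qed
qed

lemma drooped_bumped:
  assumes dr: "drooped D D' a b x y" and in_grid: "0 < a" "a + x \<le> M" "0 < b" "b + y \<le> M"
  shows "bumped M \<pi> D' (a + x) (b + y) \<longleftrightarrow> bumped M \<pi> D a b"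
proof -
  have "(\<forall>i j. D' i j = bump_tile \<longrightarrow> i = a + x \<and> j = b + y) \<longleftrightarrow> (\<forall>i j. D i j = bump_tile \<longrightarrow> i = a \<and> j = b)"
  proof (intro iffI allI impI)
    fix i j assume *: "\<forall>i j. D' i j = bump_tile \<longrightarrow> i = a + x \<and> j = b + y" "D i j = bump_tile"
    have "D' i j = bump_tile \<Longrightarrow> i = a + x \<and> j = b + y" using * by blast
    then show "i = a \<and> j = b"
      using *(2) by (cases rule: drooped_cases[OF dr, of i j]) auto
  next
    fix i j assume *: "\<forall>i j. D i j = bump_tile \<longrightarrow> i = a \<and> j = b" "D' i j = bump_tile"
    have "D i j = bump_tile \<Longrightarrow> i = a \<and> j = b" using * by blast
    then show "i = a + x \<and> j = b + y"
      using *(2) by (cases rule: drooped_cases[OF dr, of i j]) auto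
  qed
  then show ?thesis
    unfolding bumped_def using drooped_traced[OF dr in_grid] drooped_grid[OF dr in_grid] drooped_reduced[OF dr]
    by (auto simp: traced_grid_def)
qed

lemma drooped_exit_corner:
  assumes dr: "drooped D D' a b x y" and D: "pipe_grid M D" "pipe_grid M D'"
  shows "wrow D' (a + x) (b + y) = srow D a b"
proof -
  have "live D' (a + x, b + y, West)"
    unfolding pipe_grid.live_iff[OF D(2)] using dr by (auto simp: drooped_def)
  then show ?thesis using drooped_pos[OF dr] by (simp add: drooped_exit[OF dr D])
qed

lemma drooped_min_droop:
  assumes dr: "drooped D D' a b x y"
  shows "min_droop D a b = (D', a + x, b + y)"
proof -
  have xy: "0 < x" "0 < y" using drooped_pos[OF dr] by auto
  have "(LEAST x. x > 0 \<and> D (a + x) b \<noteq> cross_tile) = x"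
  proof (rule Least_equality)
    show "0 < x \<and> D (a + x) b \<noteq> cross_tile" using dr by (auto simp: drooped_def)
    show "x \<le> t" if "0 < t \<and> D (a + t) b \<noteq> cross_tile" for t
      using dr that by (auto simp: drooped_def not_less[symmetric])
  qed
  moreover have "(LEAST y. y > 0 \<and> D a (b + y) \<noteq> cross_tile) = y"
  proof (rule Least_equality)
    show "0 < y \<and> D a (b + y) \<noteq> cross_tile" using dr by (auto simp: drooped_def)
    show "y \<le> t" if "0 < t \<and> D a (b + t) \<noteq> cross_tile" for t
      using dr that by (auto simp: drooped_def not_less[symmetric])
  qed
  moreover have "reroute D a b x y i j = D' i j" for i j
    using dr
  proof (cases rule: drooped_cases[where i = i and j = j])
    case outer
    then consider "i < a" | "a + x < i" | "j < b" | "b + y < j" by linarith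
    then show ?thesis by cases (use outer in \<open>simp_all add: reroute_def\<close>)
  qed (use xy in \<open>simp_all add: reroute_def reroute_tiles\<close>)
  then have "reroute D a b x y = D'" by (intro ext)
  ultimately show ?thesis by (simp add: min_droop_def)
qed

text \<open>In \<open>D'\<close> the right and bottom sides consist of crosses strictly between the
  corners, and the corners at their far ends are not crosses. So the rectangle is recovered from its
  south-east corner.\<close>

lemma drooped_inj:
  assumes "drooped D1 D' a1 b1 x1 y1" "drooped D2 D' a2 b2 x2 y2" "a1 + x1 = a2 + x2" "b1 + y1 = b2 + y2"
  shows "D1 = D2 \<and> a1 = a2 \<and> b1 = b2"
proof -
  have ge: "\<not> a1 < a2" "\<not> b1 < b2"
    if "drooped D1 D' a1 b1 x1 y1" "drooped D2 D' a2 b2 x2 y2" "a1 + x1 = a2 + x2" "b1 + y1 = b2 + y2"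
    for D1 D2 a1 b1 x1 y1 a2 b2 x2 y2
  proof -
    show "\<not> a1 < a2"
    proof
      assume "a1 < a2"
      then have "D' a2 (b1 + y1) = cross_tile"
        using that(1,3) drooped_pos[OF that(2)] by (auto simp: drooped_def)
      moreover have "D' a2 (b1 + y1) \<noteq> cross_tile" using that(2,4) by (auto simp: drooped_def)
      ultimately show False by simp
    qed
    show "\<not> b1 < b2"
    proof
      assume "b1 < b2"
      then have "D' (a1 + x1) b2 = cross_tile"
        using that(1,4) drooped_pos[OF that(2)] by (auto simp: drooped_def)
      moreover have "D' (a1 + x1) b2 \<noteq> cross_tile" using that(2,3) by (auto simp: drooped_def)
      ultimately show False by simp
    qed
  qed
  have eq: "a1 = a2" "b1 = b2"
    using ge[OF assms] ge[OF assms(2,1) assms(3,4)[symmetric]] by auto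
  then have eq': "x1 = x2" "y1 = y2" using assms(3,4) by auto
  have "D1 i j = D2 i j" for i j
    using drooped_pos[OF assms(2)] eq eq'
    by (cases rule: drooped_cases[OF assms(1), of i j]; cases rule: drooped_cases[OF assms(2), of i j]) simp_all
  then show ?thesis using eq by auto
qed

text \<open>Offsets are taken from the turn at one corner of the rectangle, so that the lemma covers
  both droops and their inverses.\<close>

lemma rectangle_shape:
  fixes inV outV inH outH C :: "nat \<Rightarrow> nat \<Rightarrow> bool"
  assumes match: "\<And>s t. s < x \<Longrightarrow> t \<le> y \<Longrightarrow> outV s t \<longleftrightarrow> inV (Suc s) t"
      "\<And>s t. s \<le> x \<Longrightarrow> t < y \<Longrightarrow> outH s t \<longleftrightarrow> inH s (Suc t)"
    and cross: "\<And>s t. C s t \<Longrightarrow> outV s t \<and> outH s t"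
    and left: "\<And>s. 0 < s \<Longrightarrow> s < x \<Longrightarrow> C s 0"
    and top: "\<And>t. 0 < t \<Longrightarrow> t < y \<Longrightarrow> C 0 t"
    and ends: "\<not> outH x 0" "\<not> outV 0 y"
    and inner: "\<And>s t. 0 < s \<Longrightarrow> s < x \<Longrightarrow> 0 < t \<Longrightarrow> t < y \<Longrightarrow> inV s t \<Longrightarrow> inH s t \<Longrightarrow>
      (\<And>t'. t' < t \<Longrightarrow> C s t') \<Longrightarrow> (\<And>s'. s' < s \<Longrightarrow> C s' t) \<Longrightarrow> C s t"
    and far: "\<And>t. 0 < t \<Longrightarrow> t < y \<Longrightarrow> inV x t \<Longrightarrow> \<not> inH x t \<Longrightarrow> \<not> outH x t"
      "\<And>s. 0 < s \<Longrightarrow> s < x \<Longrightarrow> inH s y \<Longrightarrow> \<not> inV s y \<Longrightarrow> \<not> outV s y"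
    and pos: "0 < x" "0 < y"
  shows "(\<forall>s t. 0 < s \<longrightarrow> s < x \<longrightarrow> 0 < t \<longrightarrow> t < y \<longrightarrow> C s t) \<and>
    (\<forall>t. 0 < t \<longrightarrow> t < y \<longrightarrow> inV x t \<and> \<not> inH x t) \<and>
    (\<forall>s. 0 < s \<longrightarrow> s < x \<longrightarrow> inH s y \<and> \<not> inV s y) \<and> \<not> inH x y \<and> \<not> inV x y"
proof -
  \<comment> \<open>By induction on \<open>s + t\<close> all cells before \<open>(s, t)\<close> in
    its row and column are crosses. They pass pipes on in both directions, and \<open>inner\<close>
    applies.\<close>
  have C: "0 < s \<Longrightarrow> s < x \<Longrightarrow> 0 < t \<Longrightarrow> t < y \<Longrightarrow> C s t" for s t
  proof (induction "s + t" arbitrary: s t rule: less_induct)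
    case less
    have row: "C s t'" if "t' < t" for t'
      using that less left by (cases "t' = 0") auto
    have col: "C s' t" if "s' < s" for s'
      using that less top by (cases "s' = 0") auto
    have "inV s t" using match(1)[of "s - 1" t] col[of "s - 1"] cross less.prems by auto
    moreover have "inH s t" using match(2)[of s "t - 1"] row[of "t - 1"] cross less.prems by auto
    ultimately show ?case using inner less.prems row col by blast
  qed
  have V: "inV x t" if "0 < t" "t < y" for t
  proof -
    have "C (x - 1) t" using C[of "x - 1" t] top[of t] that pos by (cases "x = 1") auto
    then show ?thesis using match(1)[of "x - 1" t] cross that pos by auto
  qed
  have H: "inH s y" if "0 < s" "s < x" for s
  proof -
    have "C s (y - 1)" using C[of s "y - 1"] left[of s] that pos by (cases "y = 1") auto
    then show ?thesis using match(2)[of s "y - 1"] cross that pos by auto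
  qed
  \<comment> \<open>No segment goes sideways out of the near corner, and by \<open>far\<close> none
    is created along the way, so the whole far side is free of sideways segments.\<close>
  have nH: "t < y \<Longrightarrow> \<not> outH x t" for t
  proof (induction t)
    case (Suc t)
    then show ?case using match(2)[of x t] V[of "Suc t"] far(1)[of "Suc t"] by auto
  qed (use ends in simp)
  have nV: "s < x \<Longrightarrow> \<not> outV s y" for s
  proof (induction s)
    case (Suc s)
    then show ?case using match(1)[of s y] H[of "Suc s"] far(2)[of "Suc s"] by auto
  qed (use ends in simp)
  have "inV x t \<and> \<not> inH x t" if "0 < t" "t < y" for t
    using V[OF that] nH[of "t - 1"] match(2)[of x "t - 1"] that by auto
  moreover have "inH s y \<and> \<not> inV s y" if "0 < s" "s < x" for s
    using H[OF that] nV[of "s - 1"] match(1)[of "s - 1" y] that by auto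
  moreover have "\<not> inH x y" using nH[of "y - 1"] match(2)[of x "y - 1"] pos by auto
  moreover have "\<not> inV x y" using nV[of "x - 1"] match(1)[of "x - 1" y] pos by auto
  ultimately show ?thesis using C by blast
qed

context pipe_grid
begin

section \<open>Existence of droops and of inverse droops\<close>

lemma tile_by_sides:
  assumes "D i j \<noteq> cross_tile" "D i j \<noteq> bump_tile"
  shows "joined North (D i j) \<and> \<not> joined West (D i j) \<longleftrightarrow> D i j = vertical_tile"
    "joined South (D i j) \<and> \<not> joined East (D i j) \<longleftrightarrow> D i j = vertical_tile"
    "joined West (D i j) \<and> \<not> joined North (D i j) \<longleftrightarrow> D i j = horizontal_tile"
    "joined East (D i j) \<and> \<not> joined South (D i j) \<longleftrightarrow> D i j = horizontal_tile"
    "joined North (D i j) \<and> joined West (D i j) \<longleftrightarrow> D i j = j_elbow"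
    "joined South (D i j) \<and> joined East (D i j) \<longleftrightarrow> D i j = r_elbow"
    "\<not> joined North (D i j) \<and> \<not> joined West (D i j) \<longleftrightarrow> D i j = blank_tile \<or> D i j = r_elbow"
    "\<not> joined South (D i j) \<and> \<not> joined East (D i j) \<longleftrightarrow> D i j = blank_tile \<or> D i j = j_elbow"
  using tiles[of i j] assms by (cases rule: all_tilesE; simp)+

end

text \<open>Only reducedness keeps elbows out of the rectangle: a pipe turning inside would cross
  the drooping pipe once on the left side and once on the top side.\<close>

lemma droop_ex:
  assumes B: "bumped M \<pi> D a b" and turn: "(South, East) \<in> D a b"
  shows "\<exists>D' x y. drooped D D' a b x y"
proof -
  interpret traced_grid M D \<pi> using B by (simp add: bumped_def)
  have red: "reduced D" using B by (simp add: bumped_def)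
  have nb: "D i j \<noteq> bump_tile" if "i \<noteq> a \<or> j \<noteq> b" for i j
    using B that unfolding bumped_def by blast
  have ex: "\<exists>x. x > 0 \<and> D (a + x) b \<noteq> cross_tile" "\<exists>y. y > 0 \<and> D a (b + y) \<noteq> cross_tile"
    using id_bpd_neq by (intro exI[of _ "Suc M"]; simp add: outside')+
  define x where "x = (LEAST x. x > 0 \<and> D (a + x) b \<noteq> cross_tile)"
  define y where "y = (LEAST y. y > 0 \<and> D a (b + y) \<noteq> cross_tile)"
  have x: "0 < x" "D (a + x) b \<noteq> cross_tile" "\<And>s. 0 < s \<Longrightarrow> s < x \<Longrightarrow> D (a + s) b = cross_tile"
    using LeastI_ex[OF ex(1)] not_less_Least[of _ "\<lambda>x. x > 0 \<and> D (a + x) b \<noteq> cross_tile"]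
    unfolding x_def by auto
  have y: "0 < y" "D a (b + y) \<noteq> cross_tile" "\<And>t. 0 < t \<Longrightarrow> t < y \<Longrightarrow> D a (b + t) = cross_tile"
    using LeastI_ex[OF ex(2)] not_less_Least[of _ "\<lambda>y. y > 0 \<and> D a (b + y) \<noteq> cross_tile"]
    unfolding y_def by auto
  define p where "p = srow D a b"
  have turn': "joined South (D a b)" "joined East (D a b)" using turn by (auto simp: joined_def)
  have left: "srow D (a + s) b = p" if "s < x" for s
    unfolding p_def
  proof (rule col_chain)
    fix i assume "a < i" "i \<le> a + s"
    then show "(South, North) \<in> D i b" using x(3)[of "i - a"] that by simp
  qed simp
  have top: "wrow D a (b + t) = p" if "0 < t" "t \<le> y" for t
  proof -
    have "wrow D a (b + t) = wrow D a (Suc b)"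
    proof (rule row_chain)
      fix j assume "Suc b \<le> j" "j < b + t"
      then show "(West, East) \<in> D a j" using y(3)[of "j - b"] that by simp
    qed (use that in simp)
    then show ?thesis using exit_row_east[OF turn] by (simp add: p_def)
  qed
  have "joined North (D (a + x) b)"
    using edge_north[of "a + (x - 1)" b] x(1) x(3)[of "x - 1"] turn' by (cases "x = 1") auto
  then have SW: "D (a + x) b = vertical_tile \<or> D (a + x) b = j_elbow"
    using tile_by_sides(1,5)[OF x(2) nb] x(1) by auto
  have "joined West (D a (b + y))"
    using edge_east[of a "b + (y - 1)"] y(1) y(3)[of "y - 1"] turn' by (cases "y = 1") auto
  then have NE: "D a (b + y) = horizontal_tile \<or> D a (b + y) = j_elbow"
    using tile_by_sides(3,5)[OF y(2) nb] y(1) by auto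
  have inner: "D (a + s) (b + t) = cross_tile"
    if st: "0 < s" "s < x" "0 < t" "t < y"
      and j: "joined North (D (a + s) (b + t))" "joined West (D (a + s) (b + t))"
      and row: "\<And>t'. t' < t \<Longrightarrow> D (a + s) (b + t') = cross_tile"
      and col: "\<And>s'. s' < s \<Longrightarrow> D (a + s') (b + t) = cross_tile" for s t
  proof (rule ccontr)
    assume nc: "D (a + s) (b + t) \<noteq> cross_tile"
    \<comment> \<open>This elbow joins the row coming from a cross on the left side to the column
      leading to a cross on the top side. Reducedness puts the exit row of the turning pipe above
      \<open>p\<close> at the first cross and below \<open>p\<close> at the second.\<close>
    then have "D (a + s) (b + t) = j_elbow" using tile_by_sides(5)[OF nc nb] st j by auto
    then have "srow D (a + (s - 1)) (b + t) = wrow D (a + s) (b + t)"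
      using exit_row_north[of West "a + (s - 1)" "b + t"] st by simp
    moreover have "srow D (a + (s - 1)) (b + t) = srow D a (b + t)"
    proof (rule col_chain)
      fix i assume "a < i" "i \<le> a + (s - 1)"
      then show "(South, North) \<in> D i (b + t)" using col[of "i - a"] st by simp
    qed simp
    moreover have "wrow D (a + s) (b + t) = wrow D (a + s) b"
    proof (rule row_chain)
      fix j assume "b \<le> j" "j < b + t"
      then show "(West, East) \<in> D (a + s) j" using row[of "j - b"] by simp
    qed simp
    moreover have "srow D a (b + t) < p"
      using red y(3)[of t] st top[of t] unfolding reduced_def by fastforce
    moreover have "p < wrow D (a + s) b"
      using red x(3)[of s] st left[of s] unfolding reduced_def by fastforce
    ultimately show False by simp
  qed
  note shape = rectangle_shape[where x = x and y = y and C = "\<lambda>s t. D (a + s) (b + t) = cross_tile"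
      and inV = "\<lambda>s t. joined North (D (a + s) (b + t))" and outV = "\<lambda>s t. joined South (D (a + s) (b + t))"
      and inH = "\<lambda>s t. joined West (D (a + s) (b + t))" and outH = "\<lambda>s t. joined East (D (a + s) (b + t))"]
  have "(\<forall>s t. 0 < s \<longrightarrow> s < x \<longrightarrow> 0 < t \<longrightarrow> t < y \<longrightarrow> D (a + s) (b + t) = cross_tile) \<and>
    (\<forall>t. 0 < t \<longrightarrow> t < y \<longrightarrow> joined North (D (a + x) (b + t)) \<and> \<not> joined West (D (a + x) (b + t))) \<and>
    (\<forall>s. 0 < s \<longrightarrow> s < x \<longrightarrow> joined West (D (a + s) (b + y)) \<and> \<not> joined North (D (a + s) (b + y))) \<and>
    \<not> joined West (D (a + x) (b + y)) \<and> \<not> joined North (D (a + x) (b + y))"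
  proof (rule shape)
    show "\<not> joined East (D (a + x) (b + 0))" "\<not> joined South (D (a + 0) (b + y))" using SW NE by auto
    show "\<not> joined East (D (a + x) (b + t))"
      if "0 < t" "joined North (D (a + x) (b + t))" "\<not> joined West (D (a + x) (b + t))" for t
    proof -
      have "D (a + x) (b + t) \<noteq> cross_tile" using that by auto
      then have "D (a + x) (b + t) = vertical_tile" using
        tile_by_sides(1)[of "a + x" "b + t"] nb[of "a + x" "b + t"] that x(1) by auto
      then show ?thesis by simp
    qed
    show "\<not> joined South (D (a + s) (b + y))"
      if "0 < s" "joined West (D (a + s) (b + y))" "\<not> joined North (D (a + s) (b + y))" for s
    proof -
      have "D (a + s) (b + y) \<noteq> cross_tile" using that by auto
      then have "D (a + s) (b + y) = horizontal_tile" using tile_by_sides(3)[of "a + s" "b + y"] nb[of "a + s" "b + y"] that y(1) by auto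
      then show ?thesis by simp
    qed
  qed (use x y inner edge_north edge_east in simp_all)
  note shape = this[THEN conjunct1, rule_format] this[THEN conjunct2, THEN conjunct1, rule_format]
    this[THEN conjunct2, THEN conjunct2, THEN conjunct1, rule_format]
    this[THEN conjunct2, THEN conjunct2, THEN conjunct2, THEN conjunct1]
    this[THEN conjunct2, THEN conjunct2, THEN conjunct2, THEN conjunct2]
  have bottom: "D (a + x) j = vertical_tile" if "b < j" "j < b + y" for j
  proof -
    have "joined North (D (a + x) j)" "\<not> joined West (D (a + x) j)" using shape(2)[of "j - b"] that by auto
    moreover from this have "D (a + x) j \<noteq> cross_tile" by auto
    ultimately show ?thesis using tile_by_sides(1)[of "a + x" "j"] nb[of "a + x" "j"] x(1) by auto
  qed
  have right: "D i (b + y) = horizontal_tile" if "a < i" "i < a + x" for i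
  proof -
    have "joined West (D i (b + y))" "\<not> joined North (D i (b + y))" using shape(3)[of "i - a"] that by auto
    moreover from this have "D i (b + y) \<noteq> cross_tile" by auto
    ultimately show ?thesis using tile_by_sides(3)[of "i" "b + y"] nb[of "i" "b + y"] y(1) by auto
  qed
  have "D (a + x) (b + y) \<noteq> cross_tile" using shape(4) by auto
  then have SE: "D (a + x) (b + y) = blank_tile \<or> D (a + x) (b + y) = r_elbow"
    using tile_by_sides(7)[of "a + x" "b + y"] nb[of "a + x" "b + y"] shape(4,5) x(1) by auto
  have NW: "D a b = r_elbow \<or> D a b = bump_tile"
    using tiles[of a b] turn by (cases rule: all_tilesE) auto
  have left': "D i b = cross_tile" if "a < i" "i < a + x" for i using x(3)[of "i - a"] that by auto
  have top': "D a j = cross_tile" if "b < j" "j < b + y" for j using y(3)[of "j - b"] that by auto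
  have inner': "D i j = cross_tile" if "a < i" "i < a + x" "b < j" "j < b + y" for i j
    using shape(1)[of "i - a" "j - b"] that by auto
  define D' where "D' = (\<lambda>i j.
     if i = a \<and> j = b then (if D a b = r_elbow then blank_tile else j_elbow)
     else if i = a + x \<and> j = b then (if D i j = vertical_tile then r_elbow else horizontal_tile)
     else if i = a \<and> j = b + y then (if D i j = horizontal_tile then r_elbow else vertical_tile)
     else if i = a + x \<and> j = b + y then (if D i j = blank_tile then j_elbow else bump_tile)
     else if a < i \<and> i < a + x \<and> j = b then horizontal_tile
     else if i = a \<and> b < j \<and> j < b + y then vertical_tile
     else if i = a + x \<and> b < j \<and> j < b + y then cross_tile
     else if a < i \<and> i < a + x \<and> j = b + y then cross_tile
     else D i j)"
  have "drooped D D' a b x y"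
    unfolding drooped_def
  proof (intro conjI allI impI)
    show "D a b = r_elbow \<and> D' a b = blank_tile \<or> D a b = bump_tile \<and> D' a b = j_elbow"
      using NW by (auto simp: D'_def)
    show "D (a + x) b = vertical_tile \<and> D' (a + x) b = r_elbow \<or>
        D (a + x) b = j_elbow \<and> D' (a + x) b = horizontal_tile"
      using SW x(1) by (auto simp: D'_def)
    show "D a (b + y) = horizontal_tile \<and> D' a (b + y) = r_elbow \<or>
        D a (b + y) = j_elbow \<and> D' a (b + y) = vertical_tile"
      using NE y(1) by (auto simp: D'_def)
    show "D (a + x) (b + y) = blank_tile \<and> D' (a + x) (b + y) = j_elbow \<or>
        D (a + x) (b + y) = r_elbow \<and> D' (a + x) (b + y) = bump_tile"
      using SE x(1) y(1) by (auto simp: D'_def)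
    show "D' i j = D i j" if out: "\<not> (a \<le> i \<and> i \<le> a + x \<and> b \<le> j \<and> j \<le> b + y)" for i j
    proof -
      consider "i < a" | "a + x < i" | "j < b" | "b + y < j" using out by linarith
      then show ?thesis by cases (simp_all add: D'_def)
    qed
  qed (use x(1) y(1) left' top' inner' bottom right in \<open>auto simp: D'_def\<close>)
  then show ?thesis by blast
qed

text \<open>The mirror image of \<open>droop_ex\<close>, with offsets measured from the south-east
  corner: an r-elbow inside would now cross the pipe on the bottom and on the right side.\<close>

lemma undroop_ex:
  assumes B: "bumped M \<pi> D a' b'" and turn: "(West, North) \<in> D a' b'"
  shows "\<exists>D0 a b x y. drooped D0 D a b x y \<and> a' = a + x \<and> b' = b + y \<and> 0 < a \<and> 0 < b"
proof -
  interpret traced_grid M D \<pi> using B by (simp add: bumped_def)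
  have red: "reduced D" using B by (simp add: bumped_def)
  have nb: "D i j \<noteq> bump_tile" if "i \<noteq> a' \<or> j \<noteq> b'" for i j
    using B that unfolding bumped_def by blast
  have turn': "joined West (D a' b')" "joined North (D a' b')" using turn by (auto simp: joined_def)
  have pos': "0 < a'" "0 < b'" using turn' outside'(1)[of b'] outside'(2)[of a'] by (auto intro!: gr0I)
  have ex: "\<exists>x. x > 0 \<and> D (a' - x) b' \<noteq> cross_tile" "\<exists>y. y > 0 \<and> D a' (b' - y) \<noteq> cross_tile"
    by (intro exI[of _ a'] exI[of _ b']; simp add: outside' pos')+
  define x where "x = (LEAST x. x > 0 \<and> D (a' - x) b' \<noteq> cross_tile)"
  define y where "y = (LEAST y. y > 0 \<and> D a' (b' - y) \<noteq> cross_tile)"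
  have x: "0 < x" "D (a' - x) b' \<noteq> cross_tile" "\<And>s. 0 < s \<Longrightarrow> s < x \<Longrightarrow> D (a' - s) b' = cross_tile"
    using LeastI_ex[OF ex(1)] not_less_Least[of _ "\<lambda>x. x > 0 \<and> D (a' - x) b' \<noteq> cross_tile"]
    unfolding x_def by auto
  have y: "0 < y" "D a' (b' - y) \<noteq> cross_tile" "\<And>t. 0 < t \<Longrightarrow> t < y \<Longrightarrow> D a' (b' - t) = cross_tile"
    using LeastI_ex[OF ex(2)] not_less_Least[of _ "\<lambda>y. y > 0 \<and> D a' (b' - y) \<noteq> cross_tile"]
    unfolding y_def by auto
  have le: "x \<le> a'" "y \<le> b'"
    unfolding x_def y_def by (intro Least_le; simp add: outside' pos')+
  have "joined South (D (a' - x) b')"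
    using edge_north[of "a' - x" b'] x(1) x(3)[of "x - 1"] turn' le by (cases "x = 1") (auto simp: Suc_diff_le)
  then have NE: "D (a' - x) b' = vertical_tile \<or> D (a' - x) b' = r_elbow"
    using tile_by_sides(2,6)[OF x(2) nb] x(1) pos' by auto
  \<comment> \<open>The search could only stop in row 0 at a blank tile, but the tile found has a
    segment on its south side.\<close>
  then have ax: "x < a'" using le(1) outside'(1)[of b'] by (cases "x = a'") auto
  have "joined East (D a' (b' - y))"
    using edge_east[of a' "b' - y"] y(1) y(3)[of "y - 1"] turn' le by (cases "y = 1") (auto simp: Suc_diff_le)
  then have SW: "D a' (b' - y) = horizontal_tile \<or> D a' (b' - y) = r_elbow"
    using tile_by_sides(4,6)[OF y(2) nb] y(1) pos' by auto
  then have "by": "y < b'" using le(2) outside'(2)[of a'] by (cases "y = b'") auto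
  define a b where "a = a' - x" and "b = b' - y"
  have a': "a' = a + x" "b' = b + y" "0 < a" "0 < b" using ax "by" by (auto simp: a_def b_def)
  have x3: "D i b' = cross_tile" if "a < i" "i < a + x" for i
    using x(3)[of "a' - i"] that a' by auto
  have y3: "D a' j = cross_tile" if "b < j" "j < b + y" for j
    using y(3)[of "b' - j"] that a' by auto
  define p where "p = wrow D a' b'"
  have right: "srow D i b' = p" if "a \<le> i" "i < a + x" for i
  proof -
    have "srow D (a' - 1) b' = srow D i b'"
    proof (rule col_chain)
      fix i' assume "i < i'" "i' \<le> a' - 1"
      then show "(South, North) \<in> D i' b'" using x3[of i'] that a' x(1) by simp
    qed (use that a' in simp)
    moreover have "srow D (a' - 1) b' = p"
      using exit_row_north[of West "a' - 1" b'] turn pos' by (simp add: p_def)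
    ultimately show ?thesis by simp
  qed
  have bottom: "wrow D a' j = p" if "b < j" "j \<le> b + y" for j
  proof -
    have "wrow D a' b' = wrow D a' j"
    proof (rule row_chain)
      fix j' assume "j \<le> j'" "j' < b'"
      then show "(West, East) \<in> D a' j'" using y3[of j'] that a' by simp
    qed (use that a' in simp)
    then show ?thesis by (simp add: p_def)
  qed
  have inner: "D (a' - s) (b' - t) = cross_tile"
    if st: "0 < s" "s < x" "0 < t" "t < y"
      and js: "joined South (D (a' - s) (b' - t))" "joined East (D (a' - s) (b' - t))"
      and row: "\<And>t'. t' < t \<Longrightarrow> D (a' - s) (b' - t') = cross_tile"
      and col: "\<And>s'. s' < s \<Longrightarrow> D (a' - s') (b' - t) = cross_tile" for s t
  proof (rule ccontr)
    define i j where "i = a' - s" and "j = b' - t"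
    have ij: "a < i" "i < a'" "b < j" "j < b'" using st a' by (auto simp: i_def j_def)
    assume nc: "D (a' - s) (b' - t) \<noteq> cross_tile"
    then have "D (a' - s) (b' - t) = r_elbow" using tile_by_sides(6)[OF nc nb] ij js by (auto simp: i_def)
    then have "wrow D i (Suc j) = srow D i j"
      using exit_row_east[of South i j] by (simp add: i_def j_def)
    moreover have "srow D a' j = srow D i j"
    proof (rule col_chain)
      fix i' assume "i < i'" "i' \<le> a'"
      then show "(South, North) \<in> D i' j" using col[of "a' - i'"] st by (simp add: i_def j_def)
    qed (use ij in simp)
    moreover have "wrow D i b' = wrow D i (Suc j)"
    proof (rule row_chain)
      fix j' assume "Suc j \<le> j'" "j' < b'"
      then show "(West, East) \<in> D i j'" using row[of "b' - j'"] st by (simp add: i_def j_def)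
    qed (use ij in simp)
    moreover have "srow D a' j < p"
      using red y3[of j] ij a' bottom[of j] unfolding reduced_def by fastforce
    moreover have "p < wrow D i b'"
      using red x3[of i] ij a' right[of i] unfolding reduced_def by fastforce
    ultimately show False by simp
  qed
  note shape = rectangle_shape[where x = x and y = y and C = "\<lambda>s t. D (a' - s) (b' - t) = cross_tile"
      and inV = "\<lambda>s t. joined South (D (a' - s) (b' - t))" and outV = "\<lambda>s t. joined North (D (a' - s) (b' - t))"
      and inH = "\<lambda>s t. joined East (D (a' - s) (b' - t))" and outH = "\<lambda>s t. joined West (D (a' - s) (b' - t))"]
  have "(\<forall>s t. 0 < s \<longrightarrow> s < x \<longrightarrow> 0 < t \<longrightarrow> t < y \<longrightarrow> D (a' - s) (b' - t) = cross_tile) \<and>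
    (\<forall>t. 0 < t \<longrightarrow> t < y \<longrightarrow> joined South (D (a' - x) (b' - t)) \<and> \<not> joined East (D (a' - x) (b' - t))) \<and>
    (\<forall>s. 0 < s \<longrightarrow> s < x \<longrightarrow> joined East (D (a' - s) (b' - y)) \<and> \<not> joined South (D (a' - s) (b' - y))) \<and>
    \<not> joined East (D (a' - x) (b' - y)) \<and> \<not> joined South (D (a' - x) (b' - y))"
  proof (rule shape)
    show "\<not> joined West (D (a' - x) (b' - 0))" "\<not> joined North (D (a' - 0) (b' - y))" using SW NE by auto
    show "joined North (D (a' - s) (b' - t)) = joined South (D (a' - Suc s) (b' - t))" if "s < x" for s t
      using edge_north[of "a' - Suc s" "b' - t"] that ax by (simp add: Suc_diff_Suc)
    show "joined West (D (a' - s) (b' - t)) = joined East (D (a' - s) (b' - Suc t))" if "t < y" for s t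
      using edge_east[of "a' - s" "b' - Suc t"] that "by" by (simp add: Suc_diff_Suc)
    show "\<not> joined West (D (a' - x) (b' - t))"
      if "0 < t" "t < y" "joined South (D (a' - x) (b' - t))" "\<not> joined East (D (a' - x) (b' - t))" for t
    proof -
      have "D (a' - x) (b' - t) \<noteq> cross_tile" using that by auto
      then have "D (a' - x) (b' - t) = vertical_tile" using tile_by_sides(2)[of "a' - x" "b' - t"] nb[of "a' - x" "b' - t"] that x(1) pos' by auto
      then show ?thesis by simp
    qed
    show "\<not> joined North (D (a' - s) (b' - y))"
      if "0 < s" "s < x" "joined East (D (a' - s) (b' - y))" "\<not> joined South (D (a' - s) (b' - y))" for s
    proof -
      have "D (a' - s) (b' - y) \<noteq> cross_tile" using that by auto
      then have "D (a' - s) (b' - y) = horizontal_tile" using tile_by_sides(4)[of "a' - s" "b' - y"] nb[of "a' - s" "b' - y"] that y(1) pos' by auto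
      then show ?thesis by simp
    qed
  qed (use x y inner in simp_all)
  note shape = this[THEN conjunct1, rule_format] this[THEN conjunct2, THEN conjunct1, rule_format]
    this[THEN conjunct2, THEN conjunct2, THEN conjunct1, rule_format]
    this[THEN conjunct2, THEN conjunct2, THEN conjunct2, THEN conjunct1]
    this[THEN conjunct2, THEN conjunct2, THEN conjunct2, THEN conjunct2]
  have top: "D a j = vertical_tile" if "b < j" "j < b + y" for j
  proof -
    have "joined South (D a j)" "\<not> joined East (D a j)" using shape(2)[of "b' - j"] that a' by auto
    moreover from this have "D a j \<noteq> cross_tile" by auto
    ultimately show ?thesis using tile_by_sides(2)[of "a" "j"] nb[of "a" "j"] x(1) a' by auto
  qed
  have left: "D i b = horizontal_tile" if "a < i" "i < a + x" for i
  proof -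
    have "joined East (D i b)" "\<not> joined South (D i b)" using shape(3)[of "a' - i"] that a' by auto
    moreover from this have "D i b \<noteq> cross_tile" by auto
    ultimately show ?thesis using tile_by_sides(4)[of "i" "b"] nb[of "i" "b"] y(1) a' by auto
  qed
  have inner': "D i j = cross_tile" if "a < i" "i < a + x" "b < j" "j < b + y" for i j
    using shape(1)[of "a' - i" "b' - j"] that a' by auto
  have nj: "\<not> joined East (D a b)" "\<not> joined South (D a b)"
    using shape(4,5) by (simp_all add: a_def b_def)
  have "a \<noteq> a'" using a' x(1) by simp
  moreover have "D a b \<noteq> cross_tile" using nj(1) by auto
  ultimately have NW: "D a b = blank_tile \<or> D a b = j_elbow"
    using tile_by_sides(8)[of a b] nb[of a b] nj by auto
  have SE: "D (a + x) (b + y) = j_elbow \<or> D (a + x) (b + y) = bump_tile"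
    using tiles[of "a + x" "b + y"] turn unfolding a'(1,2) by (cases rule: all_tilesE) auto
  have NE': "D a (b + y) = vertical_tile \<or> D a (b + y) = r_elbow"
    and SW': "D (a + x) b = horizontal_tile \<or> D (a + x) b = r_elbow"
    using NE SW unfolding a'(1,2)[symmetric] by (simp_all add: a_def b_def)
  have x3': "D i (b + y) = cross_tile" if "a < i" "i < a + x" for i using x3 that a' by simp
  have y3': "D (a + x) j = cross_tile" if "b < j" "j < b + y" for j using y3 that a' by simp
  define D0 where "D0 = (\<lambda>i j.
     if i = a \<and> j = b then (if D a b = blank_tile then r_elbow else bump_tile)
     else if i = a + x \<and> j = b then (if D i j = r_elbow then vertical_tile else j_elbow)
     else if i = a \<and> j = b + y then (if D i j = r_elbow then horizontal_tile else j_elbow)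
     else if i = a + x \<and> j = b + y then (if D i j = j_elbow then blank_tile else r_elbow)
     else if a < i \<and> i < a + x \<and> j = b then cross_tile
     else if i = a \<and> b < j \<and> j < b + y then cross_tile
     else if i = a + x \<and> b < j \<and> j < b + y then vertical_tile
     else if a < i \<and> i < a + x \<and> j = b + y then horizontal_tile
     else D i j)"
  have "drooped D0 D a b x y"
    unfolding drooped_def
  proof (intro conjI allI impI)
    show "D0 a b = r_elbow \<and> D a b = blank_tile \<or> D0 a b = bump_tile \<and> D a b = j_elbow"
      using NW by (auto simp: D0_def)
    show "D0 (a + x) b = vertical_tile \<and> D (a + x) b = r_elbow \<or>
        D0 (a + x) b = j_elbow \<and> D (a + x) b = horizontal_tile"
      using SW' x(1) by (auto simp: D0_def)
    show "D0 a (b + y) = horizontal_tile \<and> D a (b + y) = r_elbow \<or>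
        D0 a (b + y) = j_elbow \<and> D a (b + y) = vertical_tile"
      using NE' y(1) by (auto simp: D0_def)
    show "D0 (a + x) (b + y) = blank_tile \<and> D (a + x) (b + y) = j_elbow \<or>
        D0 (a + x) (b + y) = r_elbow \<and> D (a + x) (b + y) = bump_tile"
      using SE x(1) y(1) by (auto simp: D0_def)
    show "D i j = D0 i j" if out: "\<not> (a \<le> i \<and> i \<le> a + x \<and> b \<le> j \<and> j \<le> b + y)" for i j
    proof -
      consider "i < a" | "a + x < i" | "j < b" | "b + y < j" using out by linarith
      then show ?thesis by cases (simp_all add: D0_def)
    qed
  qed (use x(1) y(1) left top inner' x3' y3' in \<open>auto simp: D0_def\<close>)
  with a' show ?thesis by blast
qed

section \<open>The insertion as a bijection\<close>

definition blanks :: "tiling \<Rightarrow> (nat \<times> nat) set" where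
  "blanks D = {(i, j). 1 \<le> i \<and> 1 \<le> j \<and> D i j = blank_tile}"

lemma bpd_weight_blanks: "bpd_weight D = (\<Prod>(i, j)\<in>blanks D. X i)"
  by (simp add: bpd_weight_def blanks_def)

lemma (in pipe_grid) finite_blanks: "finite (blanks D)"
proof (rule finite_subset)
  have "i \<in> {1..M} \<and> j \<in> {1..M}" if "1 \<le> i" "1 \<le> j" "D i j = blank_tile" for i j
  proof (rule ccontr)
    assume "\<not> (i \<in> {1..M} \<and> j \<in> {1..M})"
    then have "D i j = id_bpd i j" by (intro outside) blast
    with that show False by (auto simp: id_bpd_def split: if_splits)
  qed
  then show "blanks D \<subseteq> {1..M} \<times> {1..M}" unfolding blanks_def by blast
qed simp

text \<open>An r-elbow at the start becomes a blank, and a blank at the far corner becomes a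
  j-elbow. Counting each of these corners as blank whenever it is not a bump makes the two sides
  equal.\<close>

lemma drooped_weight:
  assumes dr: "drooped D D' a b x y" and D: "pipe_grid M D" "pipe_grid M D'" and pos: "0 < a" "0 < b"
  shows "bpd_weight D * (if D a b = bump_tile then 1 else X a) =
    bpd_weight D' * (if D' (a + x) (b + y) = bump_tile then 1 else X (a + x))"
proof -
  define A where "A = (if D a b = bump_tile then {} else {(a, b)})"
  define B where "B = (if D' (a + x) (b + y) = bump_tile then {} else {(a + x, b + y)})"
  have xy: "0 < x" "0 < y" using drooped_pos[OF dr] by auto
  have NW: "D a b = r_elbow \<and> D' a b = blank_tile \<or> D a b = bump_tile \<and> D' a b = j_elbow"
    and SE: "D (a + x) (b + y) = blank_tile \<and> D' (a + x) (b + y) = j_elbow \<or>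
      D (a + x) (b + y) = r_elbow \<and> D' (a + x) (b + y) = bump_tile"
    using dr by (auto simp: drooped_def)
  have "p \<in> blanks D \<union> A \<longleftrightarrow> p \<in> blanks D' \<union> B" for p
  proof -
    obtain i j where p: "p = (i, j)" by (cases p)
    show ?thesis
      unfolding p by (cases rule: drooped_cases[OF dr, of i j]) (use xy pos in \<open>auto simp: blanks_def A_def B_def\<close>)
  qed
  then have eq: "blanks D \<union> A = blanks D' \<union> B" by (intro set_eqI)
  have disj: "blanks D \<inter> A = {}" "blanks D' \<inter> B = {}"
    using NW SE by (auto simp: blanks_def A_def B_def)
  have fin: "finite (blanks D)" "finite (blanks D')" "finite A" "finite B"
    using pipe_grid.finite_blanks D by (auto simp: A_def B_def)
  have "bpd_weight D * (\<Prod>(i, j)\<in>A. X i) = bpd_weight D' * (\<Prod>(i, j)\<in>B. X i)"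
    unfolding bpd_weight_blanks using prod.union_disjoint[OF fin(1,3) disj(1)] prod.union_disjoint[OF fin(2,4) disj(2)]
    by (metis eq)
  then show ?thesis by (simp add: A_def B_def split: if_splits)
qed

lemma swap_bump_weight:
  assumes "D a b = bump_tile" "D a' b' = cross_tile"
  shows "bpd_weight (swap_bump D a b a' b') = bpd_weight D"
proof -
  have "blanks (swap_bump D a b a' b') = blanks D"
    using assms by (intro set_eqI) (auto simp: blanks_def swap_bump_def toggle_apply)
  then show ?thesis by (simp add: bpd_weight_blanks)
qed

lemma toggle_weight:
  assumes "D a b = bump_tile"
  shows "bpd_weight (toggle D a b) = bpd_weight D"
proof -
  have "blanks (toggle D a b) = blanks D"
    using assms by (intro set_eqI) (auto simp: blanks_def toggle_apply)
  then show ?thesis by (simp add: bpd_weight_blanks)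
qed

text \<open>Applied to the west edges of a row. The east edge of cell \<open>n\<close> is the west
  edge of cell \<open>n + 1\<close>, so a run of occupied edges goes from an r-elbow at
  \<open>m\<close> to a j-elbow at \<open>n\<close>, and a run of free edges from a j-elbow at
  \<open>m\<close> to the next r-elbow at \<open>n\<close>.\<close>

definition run :: "(nat \<Rightarrow> bool) \<Rightarrow> nat \<Rightarrow> nat \<Rightarrow> bool" where
  "run P m n \<longleftrightarrow> m < n \<and> \<not> P m \<and> \<not> P (Suc n) \<and> (\<forall>l. m < l \<and> l \<le> n \<longrightarrow> P l)"

lemma run_unique:
  "run P m n \<Longrightarrow> run P m n' \<Longrightarrow> n = n'"
  "run P m n \<Longrightarrow> run P m' n \<Longrightarrow> m = m'"
proof -
  have "\<not> n < n'" if "run P m n" "run P m n'" for n n'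
    using that unfolding run_def by (metis Suc_leI less_SucI)
  then show "run P m n \<Longrightarrow> run P m n' \<Longrightarrow> n = n'" by (meson linorder_neqE_nat)
  have "\<not> m < m'" if "run P m n" "run P m' n" for m m'
    using that unfolding run_def by (metis less_imp_le)
  then show "run P m n \<Longrightarrow> run P m' n \<Longrightarrow> m = m'" by (meson linorder_neqE_nat)
qed

lemma run_forward:
  assumes "\<not> P m" "P (Suc m)" "m < l" "\<not> P l"
  shows "\<exists>n. run P m n"
proof -
  define n where "n = (LEAST n. m < n \<and> \<not> P (Suc n))"
  have "m < l - 1 \<and> \<not> P (Suc (l - 1))"
    using assms by (cases "l = Suc m") auto
  then have n: "m < n" "\<not> P (Suc n)" unfolding n_def by (metis (mono_tags, lifting) LeastI)+
  have "P i" if "m < i" "i \<le> n" for i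
  proof (cases "i = Suc m")
    case False
    then have "m < i - 1" "i - 1 < n" using that by auto
    then have "\<not> (m < i - 1 \<and> \<not> P (Suc (i - 1)))" using not_less_Least unfolding n_def by blast
    with \<open>m < i - 1\<close> show ?thesis by simp
  qed (use assms in simp)
  with n assms show ?thesis unfolding run_def by blast
qed

lemma run_backward:
  assumes "P n" "\<not> P (Suc n)" "l < n" "\<not> P l"
  shows "\<exists>m. run P m n"
proof -
  define m where "m = (GREATEST m. m < n \<and> \<not> P m)"
  have "l < n \<and> \<not> P l" using assms by simp
  then have m: "m < n \<and> \<not> P m" unfolding m_def by (rule GreatestI_nat[where b = n]) simp
  have "P i" if "m < i" "i \<le> n" for i
  proof (rule ccontr)
    assume "\<not> P i"
    then have "i < n \<and> \<not> P i" using that assms(1) by (cases "i = n") auto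
    then have "i \<le> m" unfolding m_def by (rule Greatest_le_nat[where b = n]) simp
    with that show False by simp
  qed
  with m assms show ?thesis unfolding run_def by blast
qed

context pipe_grid
begin

lemma elbow_iff:
  assumes "D i j \<noteq> bump_tile"
  shows "D i j = r_elbow \<longleftrightarrow> \<not> joined West (D i j) \<and> joined West (D i (Suc j))"
    "D i j = j_elbow \<longleftrightarrow> joined West (D i j) \<and> \<not> joined West (D i (Suc j))"
    "(West, East) \<in> D i j \<longleftrightarrow> joined West (D i j) \<and> joined West (D i (Suc j))"
  unfolding edge_east using tiles[of i j] assms by (cases rule: all_tilesE; simp)+

lemma west_border: "\<not> joined West (D i 0)"
  by (simp add: outside')

lemma east_border: "0 < i \<Longrightarrow> i < j \<Longrightarrow> M < j \<Longrightarrow> joined West (D i j)"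
  by (simp add: outside')

lemma run_exit:
  assumes nb: "\<And>j. D i j \<noteq> bump_tile" and r: "run (\<lambda>j. joined West (D i j)) m n"
  shows "wrow D i n = srow D i m"
proof -
  have "(South, East) \<in> D i m"
    using elbow_iff(1)[OF nb, of m] r unfolding run_def by (auto simp: Suc_le_eq)
  then have "wrow D i (Suc m) = srow D i m" by (rule exit_row_east)
  moreover have "wrow D i n = wrow D i (Suc m)"
  proof (rule row_chain)
    show "Suc m \<le> n" using r by (simp add: run_def Suc_le_eq)
    show "(West, East) \<in> D i j" if "Suc m \<le> j" "j < n" for j
      using elbow_iff(3)[OF nb, of j] that r unfolding run_def by (auto simp: Suc_le_eq)
  qed
  ultimately show ?thesis by simp
qed

lemma r_elbow_ex:
  assumes "\<And>j. D i j \<noteq> bump_tile" "joined West (D i l)"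
  shows "\<exists>j<l. D i j = r_elbow"
proof -
  obtain n where "joined West (D i n)" "n \<le> l" "\<And>j. j < n \<Longrightarrow> \<not> joined West (D i j)"
    using exists_least_iff[of "\<lambda>j. joined West (D i j)"] assms(2) by (metis not_le)
  moreover have "n \<noteq> 0" using calculation west_border by metis
  ultimately have "D i (n - 1) = r_elbow" "n - 1 < l" using elbow_iff(1)[OF assms(1), of "n - 1"] by auto
  then show ?thesis by blast
qed

end

type_synonym state = "tiling \<times> nat \<times> nat"

text \<open>The states before and after a min-droop. The algorithm maintains no more than that the
  pipe to be drooped exits from one of the first \<open>k\<close> rows.\<close>

definition Pre :: "nat \<Rightarrow> (nat \<Rightarrow> nat) \<Rightarrow> nat \<Rightarrow> state set" where
  "Pre M \<pi> k = {(D, a, b). bumped M \<pi> D a b \<and> (South, East) \<in> D a b \<and> srow D a b \<le> k}"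

definition Post :: "nat \<Rightarrow> (nat \<Rightarrow> nat) \<Rightarrow> nat \<Rightarrow> state set" where
  "Post M \<pi> k = {(D, a, b). bumped M \<pi> D a b \<and> (West, North) \<in> D a b \<and> wrow D a b \<le> k}"

definition Init :: "nat \<Rightarrow> (nat \<Rightarrow> nat) \<Rightarrow> nat \<Rightarrow> state set" where
  "Init M \<pi> k = {(D, a, b). (D, a, b) \<in> Pre M \<pi> k \<and> D a b = r_elbow \<and> a \<le> k \<and> b = (LEAST j. D a j = r_elbow)}"

definition Term :: "nat \<Rightarrow> (nat \<Rightarrow> nat) \<Rightarrow> nat \<Rightarrow> state set" where
  "Term M \<pi> k = {(D, a, b). (D, a, b) \<in> Post M \<pi> k \<and> D a b = bump_tile \<and> k < srow D a b \<and>
     bump_crossings D a b = {}}"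

section \<open>Droops as a bijection between states\<close>

fun droop :: "state \<Rightarrow> state" where
  "droop (D, a, b) = min_droop D a b"

fun advance :: "nat \<Rightarrow> state \<Rightarrow> state" where
  "advance k (D, a, b) =
     (if D a b = j_elbow then
        (if a \<le> k then (D, a, LEAST j. j > b \<and> D a j = r_elbow)
         else (D, a, GREATEST j. j < b \<and> D a j = r_elbow))
      else if srow D a b \<le> k then (D, a, b)
      else cross_bump_swap D a b)"

text \<open>Unless it is a bump, the current cell counts as one more blank: an r-elbow is about to
  become one, a j-elbow has just replaced one. Steps along a row keep this factor, the initial state
  contributes \<open>X b\<close>, and a terminal state, being a bump, has no extra factor.\<close>

fun state_weight :: "state \<Rightarrow> polynomial" where
  "state_weight (D, a, b) = bpd_weight D * (if D a b = bump_tile then 1 else X a)"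

text \<open>The point beyond \<open>droop_ex\<close> is that the rectangle stays inside the square.
  This rests on the pipe that starts in column \<open>M\<close> and exits from row \<open>M\<close>,
  which is not among those to be drooped.\<close>

lemma droop_step:
  assumes s: "(D, a, b) \<in> Pre M \<pi> k" and M: "\<pi> M = M" "k < M"
  obtains D' x y where "drooped D D' a b x y" "(D', a + x, b + y) \<in> Post M \<pi> k"
    "state_weight (D', a + x, b + y) = state_weight (D, a, b)"
proof -
  have B: "bumped M \<pi> D a b" and turn: "(South, East) \<in> D a b" and k: "srow D a b \<le> k"
    using s by (auto simp: Pre_def)
  interpret traced_grid M D \<pi> using B by (simp add: bumped_def)
  obtain D' x y where dr: "drooped D D' a b x y" using droop_ex[OF B turn] by blast
  have "live D (a, b, South)" using turn by (auto simp: live_def)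
  then have pos: "0 < a" "0 < b" by (auto elim: live_cases)
  \<comment> \<open>Outside the square r-turns are on the main diagonal and exit from their own row,
    which exceeds \<open>M\<close> and thus \<open>k\<close>.\<close>
  have ab: "a \<le> M" "b \<le> M"
  proof -
    have "a \<le> M \<and> b \<le> M"
    proof (rule ccontr)
      assume n: "\<not> (a \<le> M \<and> b \<le> M)"
      then have "D a b = id_bpd a b" by (intro outside) auto
      then have "a = b" using turn pos by (auto simp: id_bpd_def split: if_splits)
      then have "wrow D a (Suc b) = a" using n pos by (intro exit_row_far_east) auto
      then have "srow D a b = a" using exit_row_east[OF turn] by simp
      then show False using k M(2) n \<open>a = b\<close> by simp
    qed
    then show "a \<le> M" "b \<le> M" by auto
  qed
  have LM: "live D (M, M, South)" "srow D M M = M"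
    using start[of M M] M by auto
  \<comment> \<open>A cross would carry pipe \<open>M\<close> into row \<open>M - 1\<close>, from
    where it can no longer exit from row \<open>M\<close>.\<close>
  have MM: "D M M \<noteq> cross_tile"
  proof
    assume "D M M = cross_tile"
    then have "srow D (M - 1) M = M" "live D (M - 1, M, South)"
      using after_cross[of M M] LM by auto
    then show False using exit_row_le[of "(M - 1, M, South)"] M(2) by auto
  qed
  have "a + x \<le> M \<and> b + y \<le> M"
  proof (rule ccontr)
    assume n: "\<not> (a + x \<le> M \<and> b + y \<le> M)"
    then have id: "D (a + x) (b + y) = id_bpd (a + x) (b + y)" by (intro outside) auto
    have "D (a + x) (b + y) = blank_tile \<or> D (a + x) (b + y) = r_elbow"
      using dr by (auto simp: drooped_def)
    \<comment> \<open>A corner outside the square has an identity tile and so is an elbow on the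
      diagonal. Then \<open>(M, M)\<close> lies in the rectangle before its last row and column,
      where it would be a cross or the drooping turn itself; both are impossible.\<close>
    then have "a + x = b + y" using id pos by (auto simp: id_bpd_def split: if_splits)
    with n have gt: "M < a + x" "M < b + y" by auto
    show False
      using dr
    proof (cases rule: drooped_cases[where i = M and j = M])
      case NW1
      then show False using LM k M by auto
    next
      case NW2
      then show False using LM k M by auto
    qed (use MM gt ab in auto)
  qed
  then have in_grid: "0 < a" "a + x \<le> M" "0 < b" "b + y \<le> M" using pos by auto
  have D': "pipe_grid M D'" using drooped_grid[OF dr in_grid] pipe_grid_axioms by simp
  have "bumped M \<pi> D' (a + x) (b + y)" using drooped_bumped[OF dr in_grid] B by simp
  moreover have "(West, North) \<in> D' (a + x) (b + y)" using dr by (auto simp: drooped_def)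
  moreover have "wrow D' (a + x) (b + y) \<le> k"
    using drooped_exit_corner[OF dr pipe_grid_axioms D'] k by simp
  ultimately have "(D', a + x, b + y) \<in> Post M \<pi> k" by (simp add: Post_def)
  moreover have "state_weight (D', a + x, b + y) = state_weight (D, a, b)"
    using drooped_weight[OF dr pipe_grid_axioms D' pos] by simp
  ultimately show thesis using that dr by blast
qed

text \<open>The rectangle extends to the north-west from a j-elbow or bump, tiles that occur only
  inside the square, so it lies inside as well.\<close>

lemma undroop_step:
  assumes q: "(D', a', b') \<in> Post M \<pi> k"
  obtains D a b x y where "drooped D D' a b x y" "a' = a + x" "b' = b + y" "(D, a, b) \<in> Pre M \<pi> k"
proof -
  have B: "bumped M \<pi> D' a' b'" and turn: "(West, North) \<in> D' a' b'" and k: "wrow D' a' b' \<le> k"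
    using q by (auto simp: Post_def)
  interpret traced_grid M D' \<pi> using B by (simp add: bumped_def)
  obtain D a b x y where dr: "drooped D D' a b x y" "a' = a + x" "b' = b + y" "0 < a" "0 < b"
    using undroop_ex[OF B turn] by blast
  have "D' a' b' = j_elbow \<or> D' a' b' = bump_tile"
    using tiles[of a' b'] turn by (cases rule: all_tilesE) auto
  then have in_grid: "0 < a" "a + x \<le> M" "0 < b" "b + y \<le> M" using inside[of a' b'] dr by auto
  have D: "pipe_grid M D" using drooped_grid[OF dr(1) in_grid] pipe_grid_axioms by simp
  have "bumped M \<pi> D a b" using drooped_bumped[OF dr(1) in_grid] B dr by simp
  moreover have "(South, East) \<in> D a b" using dr(1) by (auto simp: drooped_def)
  moreover have "srow D a b \<le> k"
    using drooped_exit_corner[OF dr(1) D pipe_grid_axioms] k dr by simp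
  ultimately have "(D, a, b) \<in> Pre M \<pi> k" by (simp add: Pre_def)
  then show thesis using that dr by blast
qed

lemma droop_bij:
  assumes M: "\<pi> M = M" "k < M"
  shows "bij_betw droop (Pre M \<pi> k) (Post M \<pi> k)"
proof (rule bij_betwI')
  fix s t assume s: "s \<in> Pre M \<pi> k" and t: "t \<in> Pre M \<pi> k"
  obtain D a b E c d where st: "s = (D, a, b)" "t = (E, c, d)" by (cases s; cases t)
  obtain D' x y where D': "drooped D D' a b x y" using droop_step[OF s[unfolded st] M] by blast
  obtain E' x' y' where E': "drooped E E' c d x' y'" using droop_step[OF t[unfolded st] M] by blast
  show "droop s = droop t \<longleftrightarrow> s = t"
    using drooped_min_droop[OF D'] drooped_min_droop[OF E'] drooped_inj[OF D', of E c d x' y'] E'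
    by (auto simp: st)
next
  fix s assume s: "s \<in> Pre M \<pi> k"
  obtain D a b where st: "s = (D, a, b)" by (cases s)
  obtain D' x y where "drooped D D' a b x y" "(D', a + x, b + y) \<in> Post M \<pi> k"
    using droop_step[OF s[unfolded st] M] by blast
  then show "droop s \<in> Post M \<pi> k" by (simp add: st drooped_min_droop)
next
  fix q assume q: "q \<in> Post M \<pi> k"
  obtain D' a' b' where qt: "q = (D', a', b')" by (cases q)
  from q[unfolded qt] show "\<exists>s\<in>Pre M \<pi> k. q = droop s"
  proof (rule undroop_step)
    fix D a b x y assume "drooped D D' a b x y" "a' = a + x" "b' = b + y" "(D, a, b) \<in> Pre M \<pi> k"
    then show ?thesis by (intro bexI[of _ "(D, a, b)"]) (simp_all add: qt drooped_min_droop)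
  qed
qed

lemma droop_weight:
  assumes "\<pi> M = M" "k < M" "s \<in> Pre M \<pi> k"
  shows "state_weight (droop s) = state_weight s"
proof -
  obtain D a b where st: "s = (D, a, b)" by (cases s)
  obtain D' x y where "drooped D D' a b x y"
    "state_weight (D', a + x, b + y) = state_weight (D, a, b)"
    using droop_step[OF assms(3)[unfolded st] assms(1,2)] by blast
  then show ?thesis by (simp add: st drooped_min_droop)
qed

text \<open>The rules are the steps (2a), (2b), (3a), (3b) of the insertion, in a form that is
  manifestly deterministic in both directions.\<close>

inductive link :: "nat \<Rightarrow> state \<Rightarrow> state \<Rightarrow> bool" for k where
  right: "D i j = j_elbow \<Longrightarrow> i \<le> k \<Longrightarrow> run (\<lambda>l. \<not> joined West (D i l)) j j' \<Longrightarrow> link k (D, i, j) (D, i, j')"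
| left: "D i j = j_elbow \<Longrightarrow> k < i \<Longrightarrow> run (\<lambda>l. joined West (D i l)) j' j \<Longrightarrow> link k (D, i, j) (D, i, j')"
| stay: "D i j = bump_tile \<Longrightarrow> srow D i j \<le> k \<Longrightarrow> link k (D, i, j) (D, i, j)"
| swap: "D i j = bump_tile \<Longrightarrow> k < srow D i j \<Longrightarrow> (i', j') \<in> bump_crossings D i j \<Longrightarrow>
    link k (D, i, j) (swap_bump D i j i' j', i', j')"

section \<open>The moves between droops as a bijection\<close>

lemma bumped_no_bump:
  assumes "bumped M \<pi> D a b" "D a b \<noteq> bump_tile"
  shows "D i j \<noteq> bump_tile" "bumped M \<pi> D a' b'"
  using assms unfolding bumped_def by metis+

lemma (in pipe_grid) run_elbows:
  assumes nb: "\<And>j. D i j \<noteq> bump_tile"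
  shows "run (\<lambda>l. \<not> joined West (D i l)) j j' \<Longrightarrow> D i j = j_elbow \<and> D i j' = r_elbow"
    "run (\<lambda>l. joined West (D i l)) j' j \<Longrightarrow> D i j' = r_elbow \<and> D i j = j_elbow"
  unfolding run_def using elbow_iff[OF nb] by (simp_all add: Suc_le_eq)

text \<open>In a row at most \<open>k\<close> the next r-elbow satisfies the invariant since its
  pipe cannot exit further down. In a later row the move stays on the drooped pipe, and so does a
  swap. A result in the first case is not initial, because the pipe just drooped has an r-elbow
  further left.\<close>

lemma post_link:
  assumes q: "q \<in> Post M \<pi> k" "q \<notin> Term M \<pi> k"
  shows "\<exists>s. s \<in> Pre M \<pi> k \<and> s \<notin> Init M \<pi> k \<and> link k q s"
proof -
  obtain D i j where qt: "q = (D, i, j)" by (cases q)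
  have B: "bumped M \<pi> D i j" and turn: "(West, North) \<in> D i j" and k: "wrow D i j \<le> k"
    using q by (auto simp: qt Post_def)
  interpret traced_grid M D \<pi> using B by (simp add: bumped_def)
  have cases: "D i j = j_elbow \<or> D i j = bump_tile"
    using tiles[of i j] turn by (cases rule: all_tilesE) auto
  then have pos: "0 < i" "0 < j" using inside[of i j] by auto
  have wj: "joined West (D i j)" using turn by (auto simp: joined_def)
  show ?thesis
  proof (cases "D i j = j_elbow")
    case True
    note nb = bumped_no_bump(1)[OF B, unfolded True, simplified]
    note Bany = bumped_no_bump(2)[OF B, unfolded True, simplified]
    have Sj: "\<not> joined West (D i (Suc j))" using elbow_iff(2)[OF nb, of i j] True by simp
    show ?thesis
    proof (cases "i \<le> k")
      case i: True
      have "joined West (D i (Suc (i + j + M)))" using east_border[of i "Suc (i + j + M)"] pos by simp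
      then obtain j' where r: "run (\<lambda>l. \<not> joined West (D i l)) j j'"
        using run_forward[of "\<lambda>l. \<not> joined West (D i l)" j "Suc (i + j + M)"] wj Sj by auto
      have D': "D i j' = r_elbow" using run_elbows(1)[OF nb r] by simp
      have "live D (i, j', South)" using D' by (simp add: live_iff)
      then have "(D, i, j') \<in> Pre M \<pi> k"
        using Bany D' i exit_row_le[of "(i, j', South)"] by (simp add: Pre_def)
      moreover have "(LEAST l. D i l = r_elbow) \<noteq> j'"
      proof -
        obtain l where "l < j" "D i l = r_elbow" using r_elbow_ex[OF nb wj] by blast
        moreover have "j < j'" using r by (simp add: run_def)
        ultimately show ?thesis using Least_le[of "\<lambda>l. D i l = r_elbow" l] by simp
      qed
      ultimately show ?thesis
        using link.right[of D i j k j'] True i r by (intro exI[of _ "(D, i, j')"]) (auto simp: qt Init_def)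
    next
      case i: False
      obtain j' where r: "run (\<lambda>l. joined West (D i l)) j' j"
        using run_backward[of "\<lambda>l. joined West (D i l)" j 0] wj Sj west_border pos by auto
      have D': "D i j' = r_elbow" using run_elbows(2)[OF nb r] by simp
      have "(D, i, j') \<in> Pre M \<pi> k"
        using Bany D' run_exit[OF nb r] k by (simp add: Pre_def)
      then show ?thesis
        using link.left[of D i j k j'] True i r by (intro exI[of _ "(D, i, j')"]) (auto simp: qt Init_def)
    qed
  next
    case False
    then have bump: "D i j = bump_tile" using cases by simp
    show ?thesis
    proof (cases "srow D i j \<le> k")
      case True
      then show ?thesis
        using B bump link.stay[of D i j k] by (intro exI[of _ q]) (auto simp: qt Pre_def Init_def)
    next
      case S: False
      then have "bump_crossings D i j \<noteq> {}" using q bump by (auto simp: qt Term_def)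
      then obtain i' j' where x: "(i', j') \<in> bump_crossings D i j" by (metis ex_in_conv surj_pair)
      note sw = swap_bump_bumped[OF B bump x]
      have "(swap_bump D i j i' j', i', j') \<in> Pre M \<pi> k" using sw k by (simp add: Pre_def)
      then show ?thesis
        using link.swap[OF bump _ x, of k] S sw(2)
        by (intro exI[of _ "(swap_bump D i j i' j', i', j')"]) (auto simp: qt Init_def)
    qed
  qed
qed

text \<open>A bump with south exit row at most \<open>k\<close> and west exit row beyond
  \<open>k\<close> always has a crossing, so among bumps every state has a predecessor. With the two
  rows interchanged a crossing may be missing, and this is what terminal states are. An r-elbow
  lacks a predecessor only if it is the leftmost in a row at most \<open>k\<close>.\<close>

lemma pre_link:
  assumes s: "s \<in> Pre M \<pi> k" "s \<notin> Init M \<pi> k"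
  shows "\<exists>q. q \<in> Post M \<pi> k \<and> q \<notin> Term M \<pi> k \<and> link k q s"
proof -
  obtain D i j where st: "s = (D, i, j)" by (cases s)
  have B: "bumped M \<pi> D i j" and turn: "(South, East) \<in> D i j" and k: "srow D i j \<le> k"
    using s by (auto simp: st Pre_def)
  interpret traced_grid M D \<pi> using B by (simp add: bumped_def)
  have cases: "D i j = r_elbow \<or> D i j = bump_tile"
    using tiles[of i j] turn by (cases rule: all_tilesE) auto
  show ?thesis
  proof (cases "D i j = r_elbow")
    case True
    note nb = bumped_no_bump(1)[OF B, unfolded True, simplified]
    note Bany = bumped_no_bump(2)[OF B, unfolded True, simplified]
    have wj: "\<not> joined West (D i j)" "joined West (D i (Suc j))" using elbow_iff(1)[OF nb, of i j] True by simp_all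
    have "0 < i" using True outside'(1)[of j] by (cases i) auto
    show ?thesis
    proof (cases "i \<le> k")
      case i: True
      define l where "l = (LEAST l. D i l = r_elbow)"
      have l: "D i l = r_elbow" "l \<le> j"
        unfolding l_def using True by (rule LeastI, intro Least_le)
      moreover have "l \<noteq> j" using s True i by (auto simp: st Init_def l_def)
      ultimately have "l < j" by simp
      have wl: "joined West (D i (Suc l))" using elbow_iff(1)[OF nb, of i l] l by simp
      then have "Suc l \<noteq> j" using wj by auto
      then obtain j' where r: "run (\<lambda>l. \<not> joined West (D i l)) j' j"
        using run_backward[of "\<lambda>l. \<not> joined West (D i l)" j "Suc l"] wj wl \<open>l < j\<close> by auto
      have D': "D i j' = j_elbow" using run_elbows(1)[OF nb r] by simp
      have "live D (i, j', West)" using D' by (simp add: live_iff)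
      then have "(D, i, j') \<in> Post M \<pi> k"
        using Bany D' i exit_row_le[of "(i, j', West)"] by (simp add: Post_def)
      then show ?thesis
        using link.right[of D i j' k j] D' i r by (intro exI[of _ "(D, i, j')"]) (auto simp: st Term_def)
    next
      case i: False
      \<comment> \<open>The pipe exits from a row at most \<open>k < i\<close>, so it cannot follow
        row \<open>i\<close> forever and must turn north in it.\<close>
      have "\<exists>l>j. \<not> joined West (D i l)"
      proof (rule ccontr)
        assume "\<not> (\<exists>l>j. \<not> joined West (D i l))"
        then have w: "joined West (D i l)" if "j < l" for l using that by blast
        have "wrow D i (Suc (i + j + M)) = wrow D i (Suc j)"
        proof (rule row_chain)
          show "(West, East) \<in> D i l" if "Suc j \<le> l" for l
            using elbow_iff(3)[OF nb, of i l] w[of l] w[of "Suc l"] that by simp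
        qed simp
        moreover have "wrow D i (Suc (i + j + M)) = i"
          using \<open>0 < i\<close> by (intro exit_row_far_east) auto
        ultimately show False using exit_row_east[OF turn] k i by simp
      qed
      then obtain j' where r: "run (\<lambda>l. joined West (D i l)) j j'"
        using run_forward[of "\<lambda>l. joined West (D i l)" j] wj by blast
      have D': "D i j' = j_elbow" using run_elbows(2)[OF nb r] by simp
      have "(D, i, j') \<in> Post M \<pi> k"
        using Bany D' run_exit[OF nb r] k by (simp add: Post_def)
      then show ?thesis
        using link.left[of D i j' k j] D' i r by (intro exI[of _ "(D, i, j')"]) (auto simp: st Term_def)
    qed
  next
    case False
    then have bump: "D i j = bump_tile" using cases by simp
    show ?thesis
    proof (cases "wrow D i j \<le> k")
      case True
      then show ?thesis
        using B bump k link.stay[of D i j k] by (intro exI[of _ s]) (auto simp: st Post_def Term_def)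
    next
      case W: False
      then have "bump_crossings D i j \<noteq> {}" using k by (intro bump_crossings_ex[OF B bump]) simp
      then obtain i' j' where x: "(i', j') \<in> bump_crossings D i j" by (metis ex_in_conv surj_pair)
      define E where "E = swap_bump D i j i' j'"
      note sw = swap_bump_bumped[OF B bump x, folded E_def]
      have "(E, i', j') \<in> Post M \<pi> k" using sw k by (simp add: Post_def)
      moreover have "link k (E, i', j') (D, i, j)"
        using link.swap[OF sw(2) _ sw(6), of k] W by (simp add: sw)
      ultimately show ?thesis
        using sw(6) by (intro exI[of _ "(E, i', j')"]) (auto simp: st Term_def)
    qed
  qed
qed

text \<open>Tile, row and west exit row at the target tell which rule was applied; this case
  distinction yields injectivity.\<close>

lemma link_source:
  assumes "link k q (E, i, j)" "q \<in> Post M \<pi> k"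
  shows "E i j = r_elbow \<and> i \<le> k \<and> (\<exists>j'. q = (E, i, j') \<and> run (\<lambda>l. \<not> joined West (E i l)) j' j) \<or>
    E i j = r_elbow \<and> k < i \<and> (\<exists>j'. q = (E, i, j') \<and> run (\<lambda>l. joined West (E i l)) j j') \<or>
    E i j = bump_tile \<and> wrow E i j \<le> k \<and> q = (E, i, j) \<or>
    E i j = bump_tile \<and> k < wrow E i j \<and> bumped M \<pi> E i j \<and>
      (\<exists>a b. (a, b) \<in> bump_crossings E i j \<and> q = (swap_bump E i j a b, a, b))"
proof -
  have elbow: "E i j = r_elbow"
    if "(E, i, j') \<in> Post M \<pi> k" "E i j' = j_elbow"
      "run (\<lambda>l. \<not> joined West (E i l)) j' j \<or> run (\<lambda>l. joined West (E i l)) j j'" for j'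
  proof -
    have B: "bumped M \<pi> E i j'" using that by (simp add: Post_def)
    interpret traced_grid M E \<pi> using B by (simp add: bumped_def)
    note nb = bumped_no_bump(1)[OF B, unfolded that(2), simplified]
    show ?thesis using run_elbows[OF nb] that(3) by blast
  qed
  from assms(1) show ?thesis
  proof cases
    case (right j')
    then show ?thesis using assms(2) elbow[of j'] by simp
  next
    case (left j')
    then show ?thesis using assms(2) elbow[of j'] by simp
  next
    case stay
    then show ?thesis using assms(2) by (simp add: Post_def)
  next
    case (swap D a b)
    have B: "bumped M \<pi> D a b" using assms(2) swap(1) by (simp add: Post_def)
    note sw = swap_bump_bumped[OF B swap(3,5), folded swap(2)]
    show ?thesis using sw swap(1,4) by metis
  qed
qed

lemma link_inj:
  assumes "link k q s" "link k q' s" "q \<in> Post M \<pi> k" "q' \<in> Post M \<pi> k"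
  shows "q = q'"
proof -
  obtain E i j where s: "s = (E, i, j)" by (cases s)
  note src = link_source[OF assms(1)[unfolded s] assms(3)] link_source[OF assms(2)[unfolded s] assms(4)]
  consider "E i j = r_elbow" "i \<le> k" | "E i j = r_elbow" "k < i"
    | "E i j = bump_tile" "wrow E i j \<le> k" | "E i j = bump_tile" "k < wrow E i j"
    using src(1) by blast
  then show ?thesis
  proof cases
    case 1
    then show ?thesis using src run_unique(2) by fastforce
  next
    case 2
    then show ?thesis using src run_unique(1) by fastforce
  next
    case 3
    then show ?thesis using src by simp
  next
    case 4
    then have "bumped M \<pi> E i j" using src(1) by simp
    with 4 show ?thesis using src bump_crossings_unique by fastforce
  qed
qed

text \<open>Between the ends of a run there is no r-elbow, so the searches by \<open>LEAST\<close>
  and \<open>GREATEST\<close> in the algorithm stop exactly at the other end of the run.\<close>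

lemma link_advance:
  assumes "link k q s" "q \<in> Post M \<pi> k"
  shows "advance k q = s" "state_weight s = state_weight q"
proof -
  from assms(1) have "advance k q = s \<and> state_weight s = state_weight q"
  proof cases
    case (right D i j j')
    have B: "bumped M \<pi> D i j" using assms(2) right by (simp add: Post_def)
    interpret traced_grid M D \<pi> using B by (simp add: bumped_def)
    note nb = bumped_no_bump(1)[OF B, unfolded right(3), simplified]
    have "(LEAST l. l > j \<and> D i l = r_elbow) = j'"
    proof (rule Least_equality)
      show "j' > j \<and> D i j' = r_elbow"
        using run_elbows(1)[OF nb right(5)] right(5) by (simp add: run_def)
      show "j' \<le> l" if "l > j \<and> D i l = r_elbow" for l
      proof (rule ccontr)
        assume "\<not> j' \<le> l"
        then have "\<not> joined West (D i (Suc l))" using right(5) that by (simp add: run_def)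
        then show False using elbow_iff(1)[OF nb, of i l] that by simp
      qed
    qed
    then show ?thesis using right nb by simp
  next
    case (left D i j j')
    have B: "bumped M \<pi> D i j" using assms(2) left by (simp add: Post_def)
    interpret traced_grid M D \<pi> using B by (simp add: bumped_def)
    note nb = bumped_no_bump(1)[OF B, unfolded left(3), simplified]
    have "(GREATEST l. l < j \<and> D i l = r_elbow) = j'"
    proof (rule Greatest_equality)
      show "j' < j \<and> D i j' = r_elbow"
        using run_elbows(2)[OF nb left(5)] left(5) by (simp add: run_def)
      show "l \<le> j'" if "l < j \<and> D i l = r_elbow" for l
      proof (rule ccontr)
        assume "\<not> l \<le> j'"
        then have "joined West (D i l)" using left(5) that unfolding run_def by (metis less_imp_le not_le)
        then show False using elbow_iff(1)[OF nb, of i l] that by simp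
      qed
    qed
    then show ?thesis using left nb by simp
  next
    case (stay D i j)
    then show ?thesis by simp
  next
    case (swap D i j i' j')
    have B: "bumped M \<pi> D i j" using assms(2) swap by (simp add: Post_def)
    have "D i' j' = cross_tile" using swap(5) by (simp add: bump_crossings_eq[OF B swap(3)])
    then show ?thesis
      using swap cross_bump_swap_eq[OF B swap(3,5)] swap_bump_weight[of D i j i' j']
        swap_bump_bumped(2)[OF B swap(3,5)] by simp
  qed
  then show "advance k q = s" "state_weight s = state_weight q" by auto
qed

lemma advance_bij: "bij_betw (advance k) (Post M \<pi> k - Term M \<pi> k) (Pre M \<pi> k - Init M \<pi> k)"
proof (rule bij_betwI')
  fix q q' assume q: "q \<in> Post M \<pi> k - Term M \<pi> k" "q' \<in> Post M \<pi> k - Term M \<pi> k"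
  obtain s s' where s: "link k q s" "link k q' s'" using post_link q by (metis DiffE)
  show "advance k q = advance k q' \<longleftrightarrow> q = q'"
    using link_advance(1)[OF s(1)] link_advance(1)[OF s(2)] link_inj[OF s(1)] s q by (metis DiffD1)
next
  fix q assume "q \<in> Post M \<pi> k - Term M \<pi> k"
  then show "advance k q \<in> Pre M \<pi> k - Init M \<pi> k" using post_link link_advance(1) by (metis DiffD1 DiffD2 DiffI)
next
  fix s assume "s \<in> Pre M \<pi> k - Init M \<pi> k"
  then show "\<exists>q\<in>Post M \<pi> k - Term M \<pi> k. s = advance k q" using pre_link link_advance(1) by (metis DiffD1 DiffD2 DiffI)
qed

lemma advance_weight:
  "q \<in> Post M \<pi> k - Term M \<pi> k \<Longrightarrow> state_weight (advance k q) = state_weight q"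
  using post_link link_advance by (metis DiffD1 DiffD2)

text \<open>Iterating a partial bijection of a finite set from outside its range cannot cycle, hence
  leaves the domain.\<close>

lemma orbit_bij:
  fixes d :: "'s \<Rightarrow> 'q" and t :: "'q \<Rightarrow> 's" and f :: "'s \<Rightarrow> 'r" and w :: "'s \<Rightarrow> 'w"
  assumes fin: "finite P" and sub: "I \<subseteq> P" "T \<subseteq> Q"
    and d: "bij_betw d P Q" and t: "bij_betw t (Q - T) (P - I)"
    and stop: "\<And>s. s \<in> P \<Longrightarrow> d s \<in> T \<Longrightarrow> f s = out (d s)"
    and go: "\<And>s. s \<in> P \<Longrightarrow> d s \<notin> T \<Longrightarrow> f s = f (t (d s))"
    and wd: "\<And>s. s \<in> P \<Longrightarrow> w' (d s) = w s" and wt: "\<And>q. q \<in> Q - T \<Longrightarrow> w (t q) = w' q"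
  shows "\<exists>h. bij_betw h I T \<and> (\<forall>s\<in>I. f s = out (h s) \<and> w' (h s) = w s)"
proof -
  define g where "g s = t (d s)" for s
  have dP: "d s \<in> Q" if "s \<in> P" for s using d that bij_betwE by blast
  have g: "g s \<in> P - I" if "s \<in> P" "d s \<notin> T" for s
    using t dP[OF that(1)] that unfolding g_def by (auto dest: bij_betwE)
  have g_inj: "s = s'" if "s \<in> P" "s' \<in> P" "d s \<notin> T" "d s' \<notin> T" "g s = g s'" for s s'
  proof -
    have "d s = d s'"
      using t that dP unfolding g_def bij_betw_def by (auto dest: inj_onD)
    then show ?thesis using d that unfolding bij_betw_def by (auto dest: inj_onD)
  qed
  have iter: "(g ^^ n) s \<in> P \<and> f s = f ((g ^^ n) s) \<and> w ((g ^^ n) s) = w s"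
    if "s \<in> P" "\<And>m. m < n \<Longrightarrow> d ((g ^^ m) s) \<notin> T" for n s
    using that(2)
  proof (induction n)
    case (Suc n)
    then have IH: "(g ^^ n) s \<in> P" "f s = f ((g ^^ n) s)" "w ((g ^^ n) s) = w s" by auto
    have nt: "d ((g ^^ n) s) \<notin> T" using Suc.prems by simp
    show ?case using IH g[OF IH(1) nt] go[OF IH(1) nt] wd[OF IH(1)] wt[of "d ((g ^^ n) s)"] dP[OF IH(1)] nt
      by (simp add: g_def[of "(g ^^ n) s"])
  qed (use that in simp)
  \<comment> \<open>Two orbits that meet can be followed backwards together until the shorter one
    reaches its start.\<close>
  have retrace: "s = (g ^^ (n' - n)) s'"
    if "s \<in> P" "s' \<in> P" "\<And>m. m < n \<Longrightarrow> d ((g ^^ m) s) \<notin> T" "\<And>m. m < n' \<Longrightarrow> d ((g ^^ m) s') \<notin> T"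
      "n \<le> n'" "(g ^^ n) s = (g ^^ n') s'" for s s' n n'
    using that(3-)
  proof (induction n arbitrary: n')
    case (Suc n)
    then obtain l where l: "n' = Suc l" by (cases n') auto
    have "(g ^^ n) s \<in> P" "(g ^^ l) s' \<in> P" using iter[OF that(1), of n] iter[OF that(2), of l] Suc.prems l by auto
    moreover have "d ((g ^^ n) s) \<notin> T" "d ((g ^^ l) s') \<notin> T"
      using Suc.prems(1)[of n] Suc.prems(2)[of l] l by simp_all
    moreover have "g ((g ^^ n) s) = g ((g ^^ l) s')" using Suc.prems(4) l by simp
    ultimately have eq: "(g ^^ n) s = (g ^^ l) s'" by (rule g_inj)
    have "s = (g ^^ (l - n)) s'"
      by (rule Suc.IH[OF _ _ _ eq]) (use Suc.prems(1-3) l in auto)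
    then show ?case using l by simp
  qed simp
  have not_I: "(g ^^ n) s \<notin> I" if sn: "s \<in> P" "0 < n" "\<And>m. m < n \<Longrightarrow> d ((g ^^ m) s) \<notin> T" for s n
  proof -
    obtain l where l: "n = Suc l" using sn(2) by (cases n) auto
    have "(g ^^ l) s \<in> P" using iter[OF sn(1), of l] sn(3) l by auto
    then show ?thesis using g[of "(g ^^ l) s"] sn(3)[of l] l by simp
  qed
  have ends: "\<exists>n. d ((g ^^ n) s) \<in> T" if "s \<in> I" for s
  proof (rule ccontr)
    assume "\<not> (\<exists>n. d ((g ^^ n) s) \<in> T)"
    then have nt: "d ((g ^^ n) s) \<notin> T" for n by blast
    have sP: "s \<in> P" using that sub by blast
    have "range (\<lambda>n. (g ^^ n) s) \<subseteq> P" using iter[OF sP] nt by auto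
    then have "finite (range (\<lambda>n. (g ^^ n) s))" using fin finite_subset by blast
    then have "\<not> inj (\<lambda>n. (g ^^ n) s)" using finite_imageD infinite_UNIV_nat by blast
    then obtain m n where mn: "m < n" "(g ^^ m) s = (g ^^ n) s"
      unfolding inj_def by (metis linorder_neqE_nat)
    then have "s = (g ^^ (n - m)) s" using retrace[OF sP sP, of m n] nt by simp
    then show False using not_I[OF sP, of "n - m"] nt mn that by auto
  qed
  define N where "N s = (LEAST n. d ((g ^^ n) s) \<in> T)" for s
  have N: "d ((g ^^ N s) s) \<in> T" "\<And>m. m < N s \<Longrightarrow> d ((g ^^ m) s) \<notin> T" if "s \<in> I" for s
    using LeastI_ex[OF ends[OF that]] not_less_Least[of _ "\<lambda>n. d ((g ^^ n) s) \<in> T"] unfolding N_def by auto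
  define h where "h s = d ((g ^^ N s) s)" for s
  have res: "f s = out (h s) \<and> w' (h s) = w s" if "s \<in> I" for s
  proof -
    have sP: "s \<in> P" using that sub by blast
    note it = iter[OF sP N(2)[OF that]]
    show ?thesis using it stop[of "(g ^^ N s) s"] wd[of "(g ^^ N s) s"] N(1)[OF that] by (simp add: h_def)
  qed
  have inj: "s = s'" if s: "s \<in> I" "s' \<in> I" "h s = h s'" "N s \<le> N s'" for s s'
  proof -
    have P: "s \<in> P" "s' \<in> P" using s sub by auto
    have "(g ^^ N s) s = (g ^^ N s') s'"
      using s(3) iter[OF P(1) N(2)[OF s(1)]] iter[OF P(2) N(2)[OF s(2)]] d
      unfolding h_def bij_betw_def by (auto dest: inj_onD)
    then have eq: "s = (g ^^ (N s' - N s)) s'"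
      using retrace[OF P N(2)[OF s(1)] N(2)[OF s(2)] s(4)] by blast
    show ?thesis
    proof (cases "N s' - N s")
      case (Suc l)
      then have "(g ^^ (N s' - N s)) s' \<notin> I" using N(2)[OF s(2)] by (intro not_I[OF P(2)]) auto
      then show ?thesis using eq s(1) by simp
    qed (use eq in simp)
  qed
  have "inj_on h I" using inj by (intro inj_onI) (metis linear)
  moreover have "h ` I \<subseteq> T" using N(1) by (auto simp: h_def)
  \<comment> \<open>Surjectivity is obtained by counting: removing \<open>I\<close> and
    \<open>T\<close> from equally large sets leaves equally large sets.\<close>
  moreover have "card I = card T"
  proof -
    have "finite Q" using d fin bij_betw_finite by blast
    have "card (P - I) = card (Q - T)" using t bij_betw_same_card by metis
    moreover have "card P = card Q" using d bij_betw_same_card by metis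
    moreover have "card (P - I) = card P - card I" "card (Q - T) = card Q - card T"
      using sub fin \<open>finite Q\<close> by (simp_all add: card_Diff_subset finite_subset)
    moreover have "card I \<le> card P" "card T \<le> card Q" using sub fin \<open>finite Q\<close> by (simp_all add: card_mono)
    ultimately show ?thesis by linarith
  qed
  moreover have "finite T" using sub d fin bij_betw_finite finite_subset by metis
  ultimately have "bij_betw h I T"
    unfolding bij_betw_def by (metis card_image card_subset_eq)
  then show ?thesis using res by blast
qed

section \<open>Insertion and recording chains\<close>

lemma finite_pipe_grids: "finite {D. pipe_grid M D}"
proof (rule finite_imageD)
  let ?C = "{1..M} \<times> {1..M}"
  let ?cut = "\<lambda>D :: tiling. restrict (\<lambda>(i, j). D i j) ?C"
  have "?cut ` {D. pipe_grid M D} \<subseteq> ?C \<rightarrow>\<^sub>E all_tiles"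
    using pipe_grid.tiles by (intro image_subsetI PiE_I) auto
  moreover have "finite (?C \<rightarrow>\<^sub>E all_tiles)" by (intro finite_PiE) (simp_all add: all_tiles_def)
  ultimately show "finite (?cut ` {D. pipe_grid M D})" by (rule finite_subset)
  show "inj_on ?cut {D. pipe_grid M D}"
  proof (rule inj_onI, intro ext)
    fix D E i j assume *: "D \<in> {D. pipe_grid M D}" "E \<in> {D. pipe_grid M D}" "?cut D = ?cut E"
    show "D i j = E i j"
    proof (cases "i \<in> {1..M} \<and> j \<in> {1..M}")
      case True
      then show ?thesis using fun_cong[OF *(3), of "(i, j)"] by simp
    next
      case False
      then have "i \<notin> {1..M} \<or> j \<notin> {1..M}" by blast
      then show ?thesis using pipe_grid.outside * by (metis mem_Collect_eq)
    qed
  qed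
qed

lemma finite_Post: "finite (Post M \<pi> k)"
proof (rule finite_subset)
  show "Post M \<pi> k \<subseteq> {D. pipe_grid M D} \<times> {1..M} \<times> {1..M}"
  proof
    fix q assume "q \<in> Post M \<pi> k"
    then obtain D a b where q: "q = (D, a, b)" "bumped M \<pi> D a b" "(West, North) \<in> D a b"
      by (cases q) (auto simp: Post_def)
    interpret traced_grid M D \<pi> using q by (simp add: bumped_def)
    have "D a b = j_elbow \<or> D a b = bump_tile"
      using tiles[of a b] q by (cases rule: all_tilesE) auto
    then show "q \<in> {D. pipe_grid M D} \<times> {1..M} \<times> {1..M}"
      using inside[of a b] q pipe_grid_axioms by auto
  qed
qed (use finite_pipe_grids in simp)

text \<open>One unfolding of the recursion. At a bump the search for some \<open>r\<close> with
  \<open>exits_from\<close> becomes a comparison of the exit row with \<open>k\<close>.\<close>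

lemma loop_step:
  assumes q: "min_droop D i j = (E, a, b)" "(E, a, b) \<in> Post M \<pi> k"
  shows "(E, a, b) \<in> Term M \<pi> k \<Longrightarrow> left_insert_loop k D i j = Some (toggle E a b)"
    "(E, a, b) \<notin> Term M \<pi> k \<Longrightarrow>
      left_insert_loop k D i j = (case advance k (E, a, b) of (F, c, d) \<Rightarrow> left_insert_loop k F c d)"
proof -
  have B: "bumped M \<pi> E a b" and turn: "(West, North) \<in> E a b" using q by (auto simp: Post_def)
  interpret traced_grid M E \<pi> using B by (simp add: bumped_def)
  have cases: "E a b = j_elbow \<or> E a b = bump_tile"
    using tiles[of a b] turn by (cases rule: all_tilesE) auto
  have low: "(\<exists>r\<le>k. exits_from E (a, b, South) r) \<longleftrightarrow> srow E a b \<le> k" if "E a b = bump_tile"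
    using live_cross[of a b] that exits_from_iff by auto
  show "left_insert_loop k D i j = Some (toggle E a b)" if T: "(E, a, b) \<in> Term M \<pi> k"
  proof -
    have T': "E a b = bump_tile" "k < srow E a b" "bump_crossings E a b = {}"
      using T by (auto simp: Term_def)
    then have "\<not> srow E a b \<le> k" by simp
    then show ?thesis
      using T' by (subst left_insert_loop.simps) (simp add: q(1) low toggle_def)
  qed
  show "left_insert_loop k D i j = (case advance k (E, a, b) of (F, c, d) \<Rightarrow> left_insert_loop k F c d)"
    if T: "(E, a, b) \<notin> Term M \<pi> k"
  proof (cases "E a b = j_elbow")
    case True
    then show ?thesis by (subst left_insert_loop.simps) (simp add: q(1))
  next
    case False
    then have bump: "E a b = bump_tile" using cases by simp
    show ?thesis
    proof (cases "srow E a b \<le> k")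
      case True
      then show ?thesis using bump by (subst left_insert_loop.simps) (simp add: q(1) low)
    next
      case False
      then have "bump_crossings E a b \<noteq> {}" using T bump q by (auto simp: Term_def)
      then show ?thesis using bump False by (subst left_insert_loop.simps) (simp add: q(1) low)
    qed
  qed
qed

lemma traced_unique:
  assumes "traced_grid M D \<pi>" "traced_grid M D \<sigma>"
  shows "\<pi> = \<sigma>"
proof
  interpret P: traced_grid M D \<pi> by fact
  interpret S: traced_grid M D \<sigma> by fact
  fix r
  show "\<pi> r = \<sigma> r"
  proof (cases "r \<in> {1..M}")
    case True
    then have "inv \<sigma> (\<pi> r) = r" using P.start(2)[of r M] S.exits[of "\<pi> r"] P.perm_in by simp
    then show ?thesis using S.inv_perm(2) by metis
  next
    case False
    then show ?thesis using P.perm S.perm unfolding permutes_def by simp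
  qed
qed

text \<open>The resulting tiling determines its permutation, hence the transposition, hence the
  unique cross of these two pipes; so the position of the former bump can be recovered. A cover that
  does not permute \<open>{1..M}\<close> contributes the empty set to the union.\<close>

lemma term_bij:
  assumes perm: "\<pi> permutes {1..M}"
  shows "bij_betw (\<lambda>(D, a, b). toggle D a b) (Term M \<pi> k) (\<Union>\<sigma>\<in>{\<sigma>. k_cover k \<pi> \<sigma>}. BPD M \<sigma>)"
proof (rule bij_betwI')
  fix s t assume s: "s \<in> Term M \<pi> k" and t: "t \<in> Term M \<pi> k"
  obtain D a b E c d where st: "s = (D, a, b)" "t = (E, c, d)" by (cases s; cases t)
  have rows: "cross_rows (toggle D a b) (a, b) = (wrow D a b, srow D a b) \<and>
      toggle D a b a b = cross_tile \<and>
      toggle D a b \<in> BPD M (\<pi> \<circ> transpose (wrow D a b) (srow D a b)) \<and>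
      wrow D a b < srow D a b \<and> toggle (toggle D a b) a b = D"
    if "(D, a, b) \<in> Term M \<pi> k" for D a b
  proof -
    have T: "bumped M \<pi> D a b" "D a b = bump_tile" "bump_crossings D a b = {}"
      "wrow D a b \<le> k" "k < srow D a b"
      using that by (auto simp: Term_def Post_def)
    interpret traced_grid M D \<pi> using T(1) by (simp add: bumped_def)
    have ab: "D a b = bump_tile \<or> D a b = cross_tile" using T(2) by simp
    have "live D (a, b, South)" "live D (a, b, West)" using live_cross ab by auto
    then have "cross_rows (toggle D a b) (a, b) = (wrow D a b, srow D a b)"
      unfolding cross_rows_def by (simp add: toggle_exit[OF ab])
    moreover have "toggle D a b a b = cross_tile" using T(2) by (simp add: toggle_apply)
    moreover have "wrow D a b < srow D a b" using T(4,5) by simp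
    ultimately show ?thesis
      using resolve_bump(2)[OF T] toggle_toggle[of D a b] ab by blast
  qed
  show "(case s of (D, a, b) \<Rightarrow> toggle D a b) = (case t of (D, a, b) \<Rightarrow> toggle D a b) \<longleftrightarrow> s = t"
  proof
    assume "(case s of (D, a, b) \<Rightarrow> toggle D a b) = (case t of (D, a, b) \<Rightarrow> toggle D a b)"
    then have eq: "toggle D a b = toggle E c d" by (simp add: st)
    note rD = rows[OF s[unfolded st]] and rE = rows[OF t[unfolded st]]
    define p q p' q' where "p = wrow D a b" and "q = srow D a b"
      and "p' = wrow E c d" and "q' = srow E c d"
    have "traced_grid M (toggle D a b) (\<pi> \<circ> transpose p q)" "traced_grid M (toggle D a b) (\<pi> \<circ> transpose p' q')"
      and red: "reduced (toggle D a b)"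
      using rD rE by (auto simp: eq BPD_iff p_def q_def p'_def q'_def)
    then have "\<pi> \<circ> transpose p q = \<pi> \<circ> transpose p' q'" by (intro traced_unique)
    then have "transpose p q x = transpose p' q' x" for x
      using permutes_inj[OF perm] by (metis comp_apply injD)
    moreover have "p < q" "p' < q'" using rD rE by (auto simp: p_def q_def p'_def q'_def)
    ultimately have pq: "p = p'" "q = q'"
      by (metis less_not_sym transpose_apply_first transpose_apply_second transpose_apply_other)+
    interpret T: traced_grid M "toggle D a b" "\<pi> \<circ> transpose p q" by fact
    have ab: "a = c \<and> b = d"
      by (rule T.reduced_cross_once[OF red]) (use rD rE pq in \<open>auto simp: eq p_def q_def p'_def q'_def\<close>)
    have "toggle (toggle D a b) a b = D" "toggle (toggle E c d) c d = E" using rD rE by blast+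
    then have "D = E" using eq ab by metis
    with ab show "s = t" by (simp add: st)
  qed simp
next
  fix s assume s: "s \<in> Term M \<pi> k"
  obtain D a b where st: "s = (D, a, b)" by (cases s)
  have T: "bumped M \<pi> D a b" "D a b = bump_tile" "bump_crossings D a b = {}"
    "wrow D a b \<le> k" "k < srow D a b"
    using s by (auto simp: st Term_def Post_def)
  show "(case s of (D, a, b) \<Rightarrow> toggle D a b) \<in> (\<Union>\<sigma>\<in>{\<sigma>. k_cover k \<pi> \<sigma>}. BPD M \<sigma>)"
    using resolve_bump[OF T] by (auto simp: st)
next
  fix E assume "E \<in> (\<Union>\<sigma>\<in>{\<sigma>. k_cover k \<pi> \<sigma>}. BPD M \<sigma>)"
  then obtain \<sigma> where "k_cover k \<pi> \<sigma>" "E \<in> BPD M \<sigma>" by auto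
  from unresolve_bump[OF perm this] obtain D a b where
    T: "bumped M \<pi> D a b" "D a b = bump_tile" "bump_crossings D a b = {}"
    "wrow D a b \<le> k" "k < srow D a b" "E = toggle D a b" by blast
  then have "(D, a, b) \<in> Term M \<pi> k" by (simp add: Term_def Post_def)
  with T show "\<exists>s\<in>Term M \<pi> k. E = (case s of (D, a, b) \<Rightarrow> toggle D a b)"
    by (intro bexI[of _ "(D, a, b)"]) auto
qed

text \<open>Every row of positive index is eventually horizontal and thus has an r-elbow; its pipe
  exits from a row at most \<open>b\<close>, so the invariant holds at the start.\<close>

lemma init_bij:
  assumes "k < M"
  shows "bij_betw (\<lambda>(b, D). (D, b, LEAST j. D b j = r_elbow)) ({1..k} \<times> BPD M \<pi>) (Init M \<pi> k)"
proof (rule bij_betwI')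
  fix x y assume "x \<in> {1..k} \<times> BPD M \<pi>" "y \<in> {1..k} \<times> BPD M \<pi>"
  show "(case x of (b, D) \<Rightarrow> (D, b, LEAST j. D b j = r_elbow)) =
      (case y of (b, D) \<Rightarrow> (D, b, LEAST j. D b j = r_elbow)) \<longleftrightarrow> x = y"
    by (cases x; cases y) auto
next
  fix x assume x: "x \<in> {1..k} \<times> BPD M \<pi>"
  obtain b D where bD: "x = (b, D)" by (cases x)
  have b: "0 < b" "b \<le> k" and D: "D \<in> BPD M \<pi>" using x by (auto simp: bD)
  interpret traced_grid M D \<pi> using D by (simp add: BPD_iff)
  have nb: "D i j \<noteq> bump_tile" for i j using D by (simp add: BPD_iff)
  define j where "j = (LEAST j. D b j = r_elbow)"
  obtain l where "D b l = r_elbow"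
    using r_elbow_ex[OF nb, of b "Suc (b + M)"] east_border[of b "Suc (b + M)"] b by auto
  then have r: "D b j = r_elbow" unfolding j_def by (rule LeastI)
  have "live D (b, j, South)" using r by (simp add: live_iff)
  then have "srow D b j \<le> k" using exit_row_le[of "(b, j, South)"] b by simp
  moreover have "bumped M \<pi> D b j" using D nb by (simp add: BPD_bumped[of D M \<pi> b j])
  ultimately show "(case x of (b, D) \<Rightarrow> (D, b, LEAST j. D b j = r_elbow)) \<in> Init M \<pi> k"
    using r b by (simp add: bD Init_def Pre_def flip: j_def)
next
  fix s assume s: "s \<in> Init M \<pi> k"
  obtain D a b where st: "s = (D, a, b)" by (cases s)
  have *: "bumped M \<pi> D a b" "D a b = r_elbow" "a \<le> k" "b = (LEAST j. D a j = r_elbow)"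
    using s by (auto simp: st Init_def Pre_def)
  interpret traced_grid M D \<pi> using * by (simp add: bumped_def)
  have "0 < a" using *(2) outside'(1)[of b] by (cases a) auto
  moreover have "D \<in> BPD M \<pi>" using * by (simp add: BPD_bumped[of D M \<pi> a b])
  ultimately show "\<exists>x\<in>{1..k} \<times> BPD M \<pi>. s = (case x of (b, D) \<Rightarrow> (D, b, LEAST j. D b j = r_elbow))"
    using * by (intro bexI[of _ "(a, D)"]) (auto simp: st)
qed

lemma insertion_bij:
  assumes perm: "\<pi> permutes {1..M}" and M: "\<pi> M = M" "k < M"
  shows "\<exists>G. bij_betw G ({1..k} \<times> BPD M \<pi>) (\<Union>\<sigma>\<in>{\<sigma>. k_cover k \<pi> \<sigma>}. BPD M \<sigma>) \<and>
    (\<forall>b\<in>{1..k}. \<forall>D\<in>BPD M \<pi>. left_insert b k D = Some (G (b, D)) \<and>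
      bpd_weight (G (b, D)) = X b * bpd_weight D)"
proof -
  define f where "f = (\<lambda>(D, a, b). left_insert_loop k D a b)"
  define out where "out = (\<lambda>(D, a, b). Some (toggle D a b))"
  define \<iota> where "\<iota> = (\<lambda>(b, D :: tiling). (D, b, LEAST j. D b j = r_elbow))"
  define \<tau> where "\<tau> = (\<lambda>(D, a, b). toggle D a b)"
  have d: "bij_betw droop (Pre M \<pi> k) (Post M \<pi> k)" using M by (rule droop_bij)
  have step: "f s = (if droop s \<in> Term M \<pi> k then out (droop s) else f (advance k (droop s)))"
    if "s \<in> Pre M \<pi> k" for s
  proof -
    obtain D i j where s: "s = (D, i, j)" by (cases s)
    obtain E a b where q: "min_droop D i j = (E, a, b)" by (cases "min_droop D i j")
    have "(E, a, b) \<in> Post M \<pi> k" using bij_betwE[OF d] that q by (auto simp: s)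
    from loop_step[OF q this] show ?thesis by (simp add: s q f_def out_def)
  qed
  \<comment> \<open>Since \<open>out\<close> always yields a \<open>Some\<close>, the equation
    \<open>f s = out (h s)\<close> includes termination.\<close>
  have "\<exists>h. bij_betw h (Init M \<pi> k) (Term M \<pi> k) \<and>
      (\<forall>s\<in>Init M \<pi> k. f s = out (h s) \<and> state_weight (h s) = state_weight s)"
  proof (rule orbit_bij[OF _ _ _ d advance_bij])
    show "finite (Pre M \<pi> k)" using finite_Post bij_betw_finite[OF d] by blast
    show "Init M \<pi> k \<subseteq> Pre M \<pi> k" "Term M \<pi> k \<subseteq> Post M \<pi> k" by (auto simp: Init_def Term_def)
  qed (use step droop_weight[where \<pi> = \<pi> and M = M and k = k] M advance_weight in auto)
  then obtain h where h: "bij_betw h (Init M \<pi> k) (Term M \<pi> k)"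
    "\<And>s. s \<in> Init M \<pi> k \<Longrightarrow> f s = out (h s)" "\<And>s. s \<in> Init M \<pi> k \<Longrightarrow> state_weight (h s) = state_weight s"
    by blast
  have \<iota>: "bij_betw \<iota> ({1..k} \<times> BPD M \<pi>) (Init M \<pi> k)" unfolding \<iota>_def by (rule init_bij[OF M(2)])
  have \<tau>: "bij_betw \<tau> (Term M \<pi> k) (\<Union>\<sigma>\<in>{\<sigma>. k_cover k \<pi> \<sigma>}. BPD M \<sigma>)"
    unfolding \<tau>_def by (rule term_bij[OF perm])
  have "left_insert b k D = Some ((\<tau> \<circ> h \<circ> \<iota>) (b, D)) \<and> bpd_weight ((\<tau> \<circ> h \<circ> \<iota>) (b, D)) = X b * bpd_weight D"
    if bD: "b \<in> {1..k}" "D \<in> BPD M \<pi>" for b D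
  proof -
    define s where "s = \<iota> (b, D)"
    have s: "s \<in> Init M \<pi> k" using bij_betwE[OF \<iota>] bD by (auto simp: s_def)
    then have "h s \<in> Term M \<pi> k" using bij_betwE[OF h(1)] by blast
    moreover obtain E c d where E: "h s = (E, c, d)" by (cases "h s")
    ultimately have bump: "E c d = bump_tile" by (simp add: Term_def)
    have "left_insert b k D = f s" by (simp add: left_insert_def f_def s_def \<iota>_def)
    also have "\<dots> = Some (toggle E c d)" using h(2)[OF s] by (simp add: out_def E)
    finally have "left_insert b k D = Some (\<tau> (h s))" by (simp add: \<tau>_def E)
    moreover have "bpd_weight (toggle E c d) = state_weight (h s)" using toggle_weight[of E c d] bump by (simp add: E)
    moreover have "state_weight s = X b * bpd_weight D"
      using bD by (auto simp: s_def \<iota>_def BPD_iff mult.commute)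
    ultimately show ?thesis using h(3)[OF s] by (simp add: \<tau>_def E flip: s_def)
  qed
  moreover have "bij_betw (\<tau> \<circ> h \<circ> \<iota>) ({1..k} \<times> BPD M \<pi>) (\<Union>\<sigma>\<in>{\<sigma>. k_cover k \<pi> \<sigma>}. BPD M \<sigma>)"
    using \<iota> h(1) \<tau> by (blast intro: bij_betw_trans)
  ultimately show ?thesis by blast
qed

text \<open>The nontrivial inclusion says that a bumpless pipe dream in the larger square has
  identity tiles in the last row and column when the permutation fixes the last value.\<close>

lemma BPD_Suc:
  assumes perm: "\<pi> permutes {1..n}"
  shows "BPD n \<pi> = BPD (Suc n) \<pi>"
proof (intro equalityI subsetI)
  fix D assume D: "D \<in> BPD n \<pi>"
  then interpret traced_grid n D \<pi> by (simp add: BPD_iff)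
  have fix_n: "inv \<pi> (Suc n) = Suc n" using permutes_not_in[OF permutes_inv[OF perm], of "Suc n"] by simp
  have "traced_grid (Suc n) D \<pi>"
  proof
    show "D i j = id_bpd i j" if "i \<notin> {1..Suc n} \<or> j \<notin> {1..Suc n}" for i j
      using that by (intro outside) auto
    show "D i j \<in> all_tiles" for i j by (rule tiles)
    show "edges_match D" by (rule edges)
    show "\<pi> permutes {1..Suc n}" using perm by (rule permutes_subset) auto
    fix c assume c: "c \<in> {1..Suc n}"
    show "srow D (Suc n) c = inv \<pi> c"
    proof (cases "c = Suc n")
      case True
      have "wrow D (Suc n) (Suc (Suc n)) = Suc n" by (rule exit_row_far_east) auto
      moreover have "(South, East) \<in> D (Suc n) (Suc n)" by (simp add: outside')
      ultimately show ?thesis using exit_row_east[of South "Suc n" "Suc n"] True fix_n by simp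
    next
      case False
      then show ?thesis using c south_bottom[of "Suc n" c] exits[of c] by simp
    qed
  qed
  then show "D \<in> BPD (Suc n) \<pi>" using D by (simp add: BPD_iff)
next
  define M where "M = Suc n"
  fix D assume "D \<in> BPD (Suc n) \<pi>"
  then have D: "D \<in> BPD M \<pi>" by (simp add: M_def)
  then interpret traced_grid M D \<pi> by (simp add: BPD_iff)
  have nb: "D i j \<noteq> bump_tile" for i j using D by (simp add: BPD_iff)
  have M: "\<pi> M = M" by (rule permutes_not_in[OF assms]) (simp add: M_def)
  have "M \<in> {1..M}" by (simp add: M_def)
  then have LM: "live D (M, M, South)" "srow D M M = M"
    using start[of M M] M by auto
  \<comment> \<open>Going north, pipe \<open>M\<close> would enter row \<open>n\<close>, from which
    it cannot reach its exit row \<open>M\<close>. Hence it turns at \<open>(M, M)\<close>.\<close>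
  have no_north: "(South, North) \<notin> D M M"
  proof
    assume N: "(South, North) \<in> D M M"
    then have "srow D n M = M" using exit_row_north[of South n M] LM by (simp add: M_def)
    moreover have "joined South (D n M)" using N edge_north[of n M] by (auto simp: M_def joined_def)
    ultimately show False using exit_row_le[of "(n, M, South)"] by (simp add: live_iff M_def)
  qed
  have MM: "D M M = r_elbow"
    using tiles[of M M] no_north nb[of M M] LM(1) by (cases rule: all_tilesE) (auto simp: live_iff)
  \<comment> \<open>From the corner leftwards: no segment leaves to the east, but each column is
    entered from below, which leaves only the vertical tile. The column above the corner is treated
    alike.\<close>
  have row: "\<not> joined West (D M (M - t)) \<and> (0 < t \<longrightarrow> D M (M - t) = vertical_tile)" if "t < M" for t
    using that
  proof (induction t)
    case (Suc t)
    then have "Suc (M - Suc t) = M - t" by simp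
    then have "\<not> joined East (D M (M - Suc t))" using edge_east[of M "M - Suc t"] Suc by simp
    moreover have "joined South (D M (M - Suc t))"
      using south_bottom[of M "M - Suc t"] Suc.prems by (simp add: live_iff)
    moreover from calculation have "D M (M - Suc t) \<noteq> cross_tile" by auto
    ultimately have "D M (M - Suc t) = vertical_tile" using tile_by_sides(2) nb by blast
    then show ?case by simp
  qed (simp add: MM)
  have col: "\<not> joined North (D (M - t) M) \<and> (0 < t \<longrightarrow> D (M - t) M = horizontal_tile)" if "t < M" for t
    using that
  proof (induction t)
    case (Suc t)
    then have "Suc (M - Suc t) = M - t" by simp
    then have "\<not> joined South (D (M - Suc t) M)" using edge_north[of "M - Suc t" M] Suc by simp
    moreover have "joined East (D (M - Suc t) M)"
      using edge_east[of "M - Suc t" M] east_border[of "M - Suc t" "Suc M"] Suc.prems by simp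
    moreover from calculation have "D (M - Suc t) M \<noteq> cross_tile" by auto
    ultimately have "D (M - Suc t) M = horizontal_tile" using tile_by_sides(4) nb by blast
    then show ?case by simp
  qed (simp add: MM)
  have rowM: "D M j = vertical_tile" if "0 < j" "j < M" for j using row[of "M - j"] that by simp
  have colM: "D i M = horizontal_tile" if "0 < i" "i < M" for i using col[of "M - i"] that by simp
  have "traced_grid n D \<pi>"
  proof
    show "D i j \<in> all_tiles" for i j by (rule tiles)
    show "edges_match D" by (rule edges)
    show "D i j = id_bpd i j" if "i \<notin> {1..n} \<or> j \<notin> {1..n}" for i j
    proof (cases "i \<in> {1..M} \<and> j \<in> {1..M}")
      case True
      then have "i = M \<or> j = M" "0 < i" "i \<le> M" "0 < j" "j \<le> M" using that by (auto simp: M_def)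
      then show ?thesis using rowM[of j] colM[of i] MM by (cases "i = M"; cases "j = M") auto
    qed (use outside in blast)
    show "\<pi> permutes {1..n}" by (rule assms)
    fix c assume c: "c \<in> {1..n}"
    have "D M c = vertical_tile" using c by (intro rowM) (auto simp: M_def)
    then have "srow D n c = srow D M c"
      using exit_row_north[of South n c] by (simp add: M_def)
    then show "srow D n c = inv \<pi> c" using exits[of c] c by (simp add: M_def)
  qed
  then show "D \<in> BPD n \<pi>" using D by (simp add: BPD_iff)
qed

lemma BPD_stable:
  assumes "\<pi> permutes {1..n}" "n \<le> m"
  shows "BPD n \<pi> = BPD m \<pi>"
  using assms(2)
proof (induction m rule: dec_induct)
  case (step m)
  then have "\<pi> permutes {1..m}" using permutes_subset[OF assms(1), of "{1..m}"] by simp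
  then show ?case using step BPD_Suc by simp
qed simp

lemma BPD_permutes: "D \<in> BPD n \<pi> \<Longrightarrow> \<pi> permutes {1..n}"
  by (simp add: BPD_def)

lemma bpd_perm_eq:
  assumes D: "D \<in> BPD n \<pi>"
  shows "bpd_perm D = \<pi>"
  unfolding bpd_perm_def
proof (rule the_equality)
  show "\<exists>n. D \<in> BPD n \<pi>" using D by blast
  fix \<sigma> assume "\<exists>n. D \<in> BPD n \<sigma>"
  then obtain m where m: "D \<in> BPD m \<sigma>" by blast
  have "D \<in> BPD (max n m) \<pi>" "D \<in> BPD (max n m) \<sigma>"
    using D m BPD_stable[OF BPD_permutes[OF D], of "max n m"] BPD_stable[OF BPD_permutes[OF m], of "max n m"] by auto
  then show "\<sigma> = \<pi>" using traced_unique by (metis BPD_iff)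
qed

text \<open>For \<open>n = 0\<close> all tiles are prescribed, and stability transports this to
  every size.\<close>

lemma BPD_id: "BPD n id = {id_bpd}"
proof -
  have "BPD 0 id = {id_bpd}"
  proof (intro equalityI subsetI)
    fix D assume "D \<in> BPD 0 id"
    then have "D i j = id_bpd i j" for i j by (simp add: BPD_def)
    then show "D \<in> {id_bpd}" by (simp add: fun_eq_iff)
  next
    fix D assume "D \<in> {id_bpd}"
    moreover have "edges_match id_bpd" by (auto simp: edges_match_def id_bpd_def)
    ultimately show "D \<in> BPD 0 id" by (simp add: BPD_def permutes_id)
  qed
  then show ?thesis using BPD_stable[of id 0 n] by (simp add: permutes_id)
qed

section \<open>Induction along the chain\<close>

lemma chain_between_snoc:
  "chain_between \<rho> (c @ [(k, \<sigma>)]) \<pi> \<longleftrightarrow> (\<exists>\<tau>. chain_between \<rho> c \<tau> \<and> k_cover k \<tau> \<sigma> \<and> \<sigma> = \<pi>)"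
  by (induction c arbitrary: \<rho>) auto

lemma chain_bound:
  assumes "chain_between \<rho> c \<pi>" "\<rho> permutes {1..N}"
  shows "\<exists>M\<ge>N. \<forall>(k, \<sigma>)\<in>set c. k < M \<and> \<sigma> permutes {1..M}"
  using assms
proof (induction c arbitrary: \<rho> N)
  case (Cons x c)
  obtain k \<sigma> where x: "x = (k, \<sigma>)" by (cases x)
  with Cons.prems have cov: "k_cover k \<rho> \<sigma>" and c: "chain_between \<sigma> c \<pi>" by auto
  obtain a b where ab: "1 \<le> a" "a \<le> k" "k < b" "\<sigma> = \<rho> \<circ> transpose a b"
    using cov by (auto simp: k_cover_def)
  \<comment> \<open>Since \<open>k < b\<close>, the same bound covers the label and the support of
    the new permutation.\<close>
  define L where "L = max N b"
  have "\<rho> permutes {1..L}" using permutes_subset[OF Cons.prems(2), of "{1..L}"] by (simp add: L_def)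
  moreover have "a \<in> {1..L}" "b \<in> {1..L}" using ab by (auto simp: L_def)
  ultimately have "\<sigma> permutes {1..L}" unfolding ab(4) by (intro permutes_compose permutes_swap_id)
  from Cons.IH[OF c this] obtain M where M: "M \<ge> L" "\<forall>(k, \<sigma>)\<in>set c. k < M \<and> \<sigma> permutes {1..M}" by blast
  have "\<sigma> permutes {1..M}" using permutes_subset[OF \<open>\<sigma> permutes {1..L}\<close>, of "{1..M}"] M by simp
  then show ?case using M ab by (intro exI[of _ M]) (auto simp: x L_def)
qed auto

text \<open>The induction peels off the last step of the chain because it belongs to the first
  letter of the biword, the one inserted last. A uniform \<open>M\<close> keeps all insertions in
  one square.\<close>

lemma recording_bij:
  assumes "chain_between id c \<pi>" "\<forall>(k, \<sigma>)\<in>set c. k < M \<and> \<sigma> permutes {1..M} \<and> \<sigma> M = M"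
  shows "bij_betw (\<lambda>Q. fst (the (left_record Q))) (biwords_recording c) (BPD M \<pi>) \<and>
    (\<forall>Q\<in>biwords_recording c. biword_weight Q = bpd_weight (fst (the (left_record Q))))"
  using assms
proof (induction c arbitrary: \<pi> rule: rev_induct)
  case Nil
  have "Q = []" if "Q \<in> biwords_recording []" for Q
    using that left_record_labels[of Q] by (auto simp: biwords_recording_def)
  moreover have "[] \<in> biwords_recording []" by (simp add: biwords_recording_def is_biword_def)
  ultimately have "biwords_recording [] = {[]}" by (intro set_eqI) blast
  moreover have "blanks id_bpd = {}"
    by (intro set_eqI) (auto simp: blanks_def id_bpd_def)
  moreover have "\<pi> = id" using Nil(1) by (simp add: id_def)
  ultimately show ?case
    by (simp only: BPD_id) (simp add: biword_weight_def bpd_weight_blanks bij_betw_def)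
next
  case (snoc x c)
  obtain k \<sigma> where x: "x = (k, \<sigma>)" by (cases x)
  define F where "F = (\<lambda>Q. fst (the (left_record Q)))"
  from snoc.prems(1) obtain \<rho> where \<rho>: "chain_between id c \<rho>" "k_cover k \<rho> \<pi>" "\<sigma> = \<pi>"
    unfolding x chain_between_snoc by blast
  have IH: "bij_betw F (biwords_recording c) (BPD M \<rho>)"
    "\<And>Q. Q \<in> biwords_recording c \<Longrightarrow> biword_weight Q = bpd_weight (F Q)"
    using snoc.IH[OF \<rho>(1)] snoc.prems(2) by (auto simp: F_def)
  have k: "k < M" using snoc.prems(2) by (simp add: x)
  have "\<rho> permutes {1..M} \<and> \<rho> M = M"
  proof (cases c rule: rev_cases)
    case Nil
    then show ?thesis using \<rho>(1) by (auto simp: permutes_id)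
  next
    case (snoc c' y)
    then show ?thesis using \<rho>(1) snoc.prems(2) by (cases y) (auto simp: chain_between_snoc)
  qed
  then obtain G where G: "bij_betw G ({1..k} \<times> BPD M \<rho>) (\<Union>\<sigma>\<in>{\<sigma>. k_cover k \<rho> \<sigma>}. BPD M \<sigma>)"
    "\<And>b D. b \<in> {1..k} \<Longrightarrow> D \<in> BPD M \<rho> \<Longrightarrow> left_insert b k D = Some (G (b, D))"
    "\<And>b D. b \<in> {1..k} \<Longrightarrow> D \<in> BPD M \<rho> \<Longrightarrow> bpd_weight (G (b, D)) = X b * bpd_weight D"
    using insertion_bij[of \<rho> M k] k by blast
  have rec: "left_record Q = Some (F Q, c)" if "Q \<in> biwords_recording c" for Q c
    using that by (auto simp: biwords_recording_def F_def)
  have FB: "F Q \<in> BPD M \<rho>" if "Q \<in> biwords_recording c" for Q using bij_betwE[OF IH(1)] that by blast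
  \<comment> \<open>This turns the equation on the recorded permutation into membership, so that a
    fixed last step selects one member of the union in the range of \<open>G\<close>.\<close>
  have perm_G: "bpd_perm (G (b, D)) = \<pi> \<longleftrightarrow> G (b, D) \<in> BPD M \<pi>" if "b \<in> {1..k}" "D \<in> BPD M \<rho>" for b D
  proof -
    have "G (b, D) \<in> (\<Union>\<sigma>\<in>{\<sigma>. k_cover k \<rho> \<sigma>}. BPD M \<sigma>)"
      using bij_betwE[OF G(1)] that by simp
    then obtain \<sigma>' where "G (b, D) \<in> BPD M \<sigma>'" by auto
    then show ?thesis using bpd_perm_eq by metis
  qed
  have mem: "Q \<in> biwords_recording (c @ [x]) \<longleftrightarrow>
      (\<exists>b Q'. Q = (b, k) # Q' \<and> b \<in> {1..k} \<and> Q' \<in> biwords_recording c \<and> G (b, F Q') \<in> BPD M \<pi>)"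
    (is "?L \<longleftrightarrow> ?R") for Q
  proof
    assume ?L
    then obtain D where D: "is_biword Q" "left_record Q = Some (D, c @ [(k, \<pi>)])"
      by (auto simp: biwords_recording_def x \<rho>)
    then obtain b k' Q' where Q: "Q = (b, k') # Q'" by (cases Q) auto
    from D(2) obtain D' c' D'' where r: "left_record Q' = Some (D', c')" "left_insert b k' D' = Some D''"
      "c' @ [(k', bpd_perm D'')] = c @ [(k, \<pi>)]"
      by (auto simp: Q split: option.splits)
    then have r': "c' = c" "k' = k" "bpd_perm D'' = \<pi>" by auto
    have b: "b \<in> {1..k}" and Q': "Q' \<in> biwords_recording c"
      using D(1) r r' by (auto simp: Q is_biword_def biwords_recording_def)
    have "F Q' = D'" using r by (simp add: F_def)
    then have "G (b, F Q') = D''" using G(2)[OF b FB[OF Q']] r r' by simp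
    then have "G (b, F Q') \<in> BPD M \<pi>" using perm_G[OF b FB[OF Q']] r' by simp
    then show ?R using Q b Q' r' by blast
  next
    assume ?R
    then obtain b Q' where Q: "Q = (b, k) # Q'" "b \<in> {1..k}" "Q' \<in> biwords_recording c" "G (b, F Q') \<in> BPD M \<pi>"
      by blast
    have "is_biword Q'" using Q by (simp add: biwords_recording_def)
    then have "is_biword Q" using Q by (auto simp: is_biword_def)
    moreover have "bpd_perm (G (b, F Q')) = \<pi>" using perm_G[OF Q(2) FB[OF Q(3)]] Q by simp
    ultimately show ?L
      using rec[OF Q(3)] G(2)[OF Q(2) FB[OF Q(3)]] by (simp add: biwords_recording_def Q x \<rho>)
  qed
  have FG: "F ((b, k) # Q') = G (b, F Q')" if "b \<in> {1..k}" "Q' \<in> biwords_recording c" for b Q'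
  proof -
    have "left_record ((b, k) # Q') = Some (G (b, F Q'), c @ [(k, bpd_perm (G (b, F Q')))])"
      using rec[OF that(2)] G(2)[OF that(1) FB[OF that(2)]] by simp
    then show ?thesis unfolding F_def by (simp del: left_record.simps)
  qed
  have "bij_betw F (biwords_recording (c @ [x])) (BPD M \<pi>)"
  proof (rule bij_betwI')
    fix P Q assume PQ: "P \<in> biwords_recording (c @ [x])" "Q \<in> biwords_recording (c @ [x])"
    obtain b P' where P: "P = (b, k) # P'" "b \<in> {1..k}" "P' \<in> biwords_recording c" using PQ(1) mem by blast
    obtain d Q' where Q: "Q = (d, k) # Q'" "d \<in> {1..k}" "Q' \<in> biwords_recording c" using PQ(2) mem by blast
    show "F P = F Q \<longleftrightarrow> P = Q"
    proof
      assume "F P = F Q"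
      then have "G (b, F P') = G (d, F Q')" using FG P Q by simp
      then have "(b, F P') = (d, F Q')"
        using G(1) P Q FB unfolding bij_betw_def by (auto dest: inj_onD)
      then show "P = Q" using IH(1) P Q unfolding bij_betw_def by (auto dest: inj_onD)
    qed simp
  next
    fix Q assume "Q \<in> biwords_recording (c @ [x])"
    then show "F Q \<in> BPD M \<pi>" using mem FG by metis
  next
    fix D assume D: "D \<in> BPD M \<pi>"
    then have "D \<in> G ` ({1..k} \<times> BPD M \<rho>)"
      unfolding bij_betw_imp_surj_on[OF G(1)] using \<rho>(2) by auto
    then obtain b D' where b: "b \<in> {1..k}" "D' \<in> BPD M \<rho>" "D = G (b, D')" by blast
    have "D' \<in> F ` biwords_recording c" unfolding bij_betw_imp_surj_on[OF IH(1)] by (rule b(2))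
    then obtain Q' where Q': "Q' \<in> biwords_recording c" "D' = F Q'" by blast
    have "(b, k) # Q' \<in> biwords_recording (c @ [x])" using mem b Q' D by blast
    moreover have "D = F ((b, k) # Q')" using FG b Q' by simp
    ultimately show "\<exists>Q\<in>biwords_recording (c @ [x]). D = F Q" by blast
  qed
  moreover have "biword_weight Q = bpd_weight (F Q)" if "Q \<in> biwords_recording (c @ [x])" for Q
  proof -
    obtain b Q' where Q: "Q = (b, k) # Q'" "b \<in> {1..k}" "Q' \<in> biwords_recording c" using mem \<open>Q \<in> _\<close> by blast
    have "biword_weight Q = X b * bpd_weight (F Q')" using IH(2)[OF Q(3)] by (simp add: Q biword_weight_def)
    then show ?thesis using G(3)[OF Q(2) FB[OF Q(3)]] FG[OF Q(2,3)] Q(1) by simp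
  qed
  ultimately show ?case by (simp add: F_def)
qed

theorem theorem3p6:
  fixes n :: nat and \<pi> :: "nat \<Rightarrow> nat" and c :: labelled_chain
  assumes "\<pi> permutes {1..n}"
    and "mixed_chain c \<pi>"
  shows "schubert n \<pi> = (\<Sum>Q \<in> biwords_recording c. biword_weight Q)"
proof -
  have c: "chain_between id c \<pi>" using assms(2) by (simp add: mixed_chain_def)
  obtain N where N: "n \<le> N" "\<forall>(k, \<sigma>)\<in>set c. k < N \<and> \<sigma> permutes {1..N}"
    using chain_bound[OF c permutes_id] by blast
  \<comment> \<open>One more than the bound, so that all permutations of the chain fix
    \<open>M\<close>.\<close>
  define M where "M = Suc N"
  have "k < M \<and> \<sigma> permutes {1..M} \<and> \<sigma> M = M" if "(k, \<sigma>) \<in> set c" for k \<sigma>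
  proof -
    have *: "k < N" "\<sigma> permutes {1..N}" using N(2) that by auto
    then have "\<sigma> permutes {1..M}" by (auto intro: permutes_subset simp: M_def)
    moreover have "\<sigma> M = M" by (rule permutes_not_in[OF *(2)]) (simp add: M_def)
    ultimately show ?thesis using * by (simp add: M_def)
  qed
  then have "\<forall>(k, \<sigma>)\<in>set c. k < M \<and> \<sigma> permutes {1..M} \<and> \<sigma> M = M" by blast
  note rec = recording_bij[OF c this]
  have "schubert n \<pi> = (\<Sum>D\<in>BPD M \<pi>. bpd_weight D)"
    using BPD_stable[OF assms(1), of M] N by (simp add: schubert_def M_def)
  also have "\<dots> = (\<Sum>Q\<in>biwords_recording c. bpd_weight (fst (the (left_record Q))))"
    using sum.reindex_bij_betw[of _ "biwords_recording c" "BPD M \<pi>" bpd_weight] rec by metis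
  also have "\<dots> = (\<Sum>Q\<in>biwords_recording c. biword_weight Q)"
    using rec by (intro sum.cong) auto
  finally show ?thesis .
qed

end
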